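(* Let $f$ be a holomorphic cusp form of weight $k$ for $SL_2(\mathbb{Z})$ which is a normalized Hecke eigenform, with $n$-th Fourier coefficient $a_f(n)$, and put $\lambda_f(n)=a_f(n)/n^{(k-1)/2}$. Let $L_f(s)=\sum_{n=1}^\infty \lambda_f(n)n^{-s}$ ($\mathrm{Re}\, s>1$), continued analytically to an entire function, and let $L_f^{(m)}(s)$ denote its $m$-th derivative. Then for any $m\in\mathbb{Z}_{\geq 0}$ the following hold: (i) There exists $\sigma_{f,m}\in\mathbb{R}_{>1}$ such that $L_f^{(m)}(s)$ has no zero for $\mathrm{Re}\, s\geq \sigma_{f,m}$. (ii) For any $\varepsilon\in\mathbb{R}_{>0}$ there exists $\delta_{f,m,\varepsilon}\in\mathbb{R}_{>(k-1)/2+1}$ such that $L_f^{(m)}(s)$ has no zero for $|s|\geq \delta_{f,m,\varepsilon}$ satisfying $\mathrm{Re}\, s\leq -\varepsilon$ and $|\mathrm{Im}\, s|\geq \varepsilon$. (iii) There exists $\alpha_{f,m}\in\mathbb{R}_{<-(k-1)/2-1}$ such that $L_f^{(m)}(s)$ has only real zeros for $\mathrm{Re}\, s\leq \alpha_{f,m}$, and one real zero in each interval $(n-1,n)$ for every integer $n\leq \alpha_{f,m}$.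
   Context: $L_f(s)$ extends to an entire function satisfying the functional equation $L_f(s)=\chi_f(s)L_f(1-s)$ with $\chi_f(s)=(-1)^{-k/2}(2\pi)^{2s-1}\Gamma(1-s+\frac{k-1}{2})/\Gamma(s+\frac{k-1}{2})$; hence every derivative $L_f^{(m)}$ is entire. *)

theory Defs
  imports "HOL-Complex_Analysis.Complex_Analysis"
begin

definition upper_half_plane :: "complex set" where
  "upper_half_plane = {z. Im z > 0}"

definition has_q_expansion :: "(complex \<Rightarrow> complex) \<Rightarrow> (nat \<Rightarrow> complex) \<Rightarrow> bool" where
  "has_q_expansion f a \<longleftrightarrow>
     (\<forall>z\<in>upper_half_plane.
        (\<lambda>n. a n * exp (2 * of_real pi * \<i> * of_nat n * z)) sums f z)"

(* The q-expansion, if it exists, is unique by uniqueness of power series coefficients. *)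
definition fourier_coeff :: "(complex \<Rightarrow> complex) \<Rightarrow> nat \<Rightarrow> complex" where
  "fourier_coeff f = (THE a. has_q_expansion f a)"

(* Forms are total functions on the complex plane; only their values on the upper
   half plane matter. *)
definition cusp_form :: "nat \<Rightarrow> (complex \<Rightarrow> complex) \<Rightarrow> bool" where
  "cusp_form k f \<longleftrightarrow>
     f holomorphic_on upper_half_plane \<and>
     (\<forall>a b c d :: int. a * d - b * c = 1 \<longrightarrow>
        (\<forall>z\<in>upper_half_plane.
           f ((of_int a * z + of_int b) / (of_int c * z + of_int d)) =
           (of_int c * z + of_int d) ^ k * f z)) \<and>
     (\<exists>a. has_q_expansion f a \<and> a 0 = 0)"

(* T_n f (z) = n^(k-1) * sum over a*d = n, 0 <= b < d of d^(-k) * f ((a*z + b) / d) *)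
definition hecke_operator ::
    "nat \<Rightarrow> nat \<Rightarrow> (complex \<Rightarrow> complex) \<Rightarrow> complex \<Rightarrow> complex" where
  "hecke_operator k n f z =
     of_nat n powi (int k - 1) *
     (\<Sum>d | d dvd n. \<Sum>b<d.
        of_nat d powi (- int k) * f ((of_nat (n div d) * z + of_nat b) / of_nat d))"

definition normalized_hecke_eigenform :: "nat \<Rightarrow> (complex \<Rightarrow> complex) \<Rightarrow> bool" where
  "normalized_hecke_eigenform k f \<longleftrightarrow>
     cusp_form k f \<and>
     (\<forall>n\<ge>1. \<exists>c. \<forall>z\<in>upper_half_plane. hecke_operator k n f z = c * f z) \<and>
     fourier_coeff f 1 = 1"

definition hecke_lambda :: "nat \<Rightarrow> (complex \<Rightarrow> complex) \<Rightarrow> nat \<Rightarrow> complex" where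
  "hecke_lambda k f n = fourier_coeff f n / of_real (real n powr ((real k - 1) / 2))"

(* The entire continuation of the Dirichlet series; it is unique by the identity theorem. *)
definition cusp_L :: "nat \<Rightarrow> (complex \<Rightarrow> complex) \<Rightarrow> complex \<Rightarrow> complex" where
  "cusp_L k f =
     (THE L. L holomorphic_on UNIV \<and>
        (\<forall>s. Re s > 1 \<longrightarrow>
           (\<lambda>n. hecke_lambda k f (Suc n) * of_nat (Suc n) powr (- s)) sums L s))"

end

theory Submission
  imports Defs
begin

text \<open>Put \<open>w = 1 - s\<close>. For \<open>Re w > 1\<close> the functional equation and the reflection formula for the Gamma
  function give \<open>L(1 - w) = \<Phi>(w) (e^(i \<pi> w) + e^(-i \<pi> w))\<close> with \<open>\<Phi>\<close> free of zeros. Since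
  \<open>Re (\<Phi>'/\<Phi>)\<close> tends to infinity, differentiating \<open>m\<close> times multiplies both exponential terms by
  asymptotically equal factors, so the zeros are the solutions of \<open>e^(2 \<pi> i w) = - R(w)\<close> with
  \<open>R(w) \<rightarrow> 1\<close>. This excludes zeros away from the real axis. Near the real axis the equation has exactly one
  solution in each unit strip, and it is real because \<open>|R| = 1\<close> on the real line.

  Three facts about the form are needed. Bessel's inequality for \<open>f(x + i y)\<close> on a horizontal line and the
  invariance of \<open>|f|^2 y^k\<close> give absolute convergence for \<open>Re s > 1\<close>; the Hecke relations at
  finitely many primes bound \<open>L\<close> away from 0 on \<open>Re w \<ge> c > 1\<close>; self-adjointness of the Hecke
  operators for the Petersson product makes the coefficients real.\<close>

section \<open>Power series in q\<close>

text \<open>Part (ii) allows every \<epsilon>, so bounds are needed on all of Re w >= c with c close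
  to 1, where the terms after the first need not be small. Finitely many Euler factors remove all
  small indices and leave 1 plus a small tail; each factor is bounded above, so no uniform bound on
  the Hecke eigenvalues enters. With L'/L bounded, the growth of the logarithmic derivative of
  \<Phi> comes from its two Gamma factors, and the divergence of the harmonic series takes the place
  of Stirling's formula.

  Reality of the coefficients makes the two exponential terms complex conjugate on the real line,
  whence |R| = 1. For the Petersson product a weight on a Siegel set stands in for a fundamental
  domain: with one weight at z and one at gz, the sum over matrices of determinant n is finite and
  symmetric under the adjugate, and self-adjointness becomes a change of variables.

  In part (i) the constant term of the Dirichlet series is lost as soon as m > 0. The next nonzero
  coefficient then leads, and it exists because q alone is not modular.\<close>

abbreviation tpi :: complex where "tpi \<equiv> 2 * of_real pi * \<i>"

abbreviation nome :: "complex \<Rightarrow> complex" where "nome z \<equiv> exp (tpi * z)"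

lemma exp_q_power:
  "exp (tpi * of_nat n * z) = nome z ^ n"
  by (subst exp_of_nat_mult [symmetric]) (simp add: mult_ac)

lemma norm_exp_q: "norm (nome z) = exp (- 2 * pi * Im z)"
  by simp

lemma q_surj:
  assumes "q \<noteq> 0" "norm q < 1"
  obtains z where "Im z > 0" "nome z = q"
proof
  define z where "z = Ln q / (tpi)"
  show 1: "nome z = q"
    using assms by (simp add: z_def)
  have "exp (- 2 * pi * Im z) < 1"
    using norm_exp_q [of z] 1 assms by simp
  then show "Im z > 0"
    by (simp add: zero_less_mult_iff)
qed

lemma q_expansion_unique:
  assumes "has_q_expansion f a" "has_q_expansion f b"
  shows "a = b"
proof (rule ccontr)
  assume "a \<noteq> b"
  then obtain n0 where n0: "a n0 \<noteq> b n0" by blast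
  \<comment> \<open>Multiplying the difference of the two series by q makes it vanish at 0 as well,
    the one point of the disc that no \<open>z\<close> reaches. Isolation of zeros then
    applies.\<close>
  define c where "c n = (case n of 0 \<Rightarrow> 0 | Suc m \<Rightarrow> a m - b m)" for n
  have sums: "(\<lambda>n. c n * (x - 0) ^ n) sums 0" if x: "norm (x - 0) < 1" for x
  proof (cases "x = 0")
    case True
    have "(\<lambda>n. c n * 0 ^ n) sums c 0" by (rule powser_sums_zero)
    then show ?thesis using True by (simp add: c_def)
  next
    case False
    then obtain z where z: "Im z > 0" "nome z = x"
      using x q_surj[of x] by auto
    then have zU: "z \<in> upper_half_plane" by (simp add: upper_half_plane_def)
    have "(\<lambda>n. a n * x ^ n) sums f z" "(\<lambda>n. b n * x ^ n) sums f z"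
      using assms zU z unfolding has_q_expansion_def exp_q_power by auto
    then have "(\<lambda>n. a n * x ^ n - b n * x ^ n) sums (f z - f z)"
      by (rule sums_diff)
    then have "(\<lambda>n. x * ((a n - b n) * x ^ n)) sums (x * 0)"
      by (intro sums_mult) (simp add: algebra_simps)
    then have "(\<lambda>n. c (Suc n) * x ^ Suc n) sums 0"
      by (simp add: c_def mult_ac)
    then have "(\<lambda>n. c n * x ^ n) sums (0 + c 0 * x ^ 0)"
      by (rule sums_Suc)
    then show ?thesis
      by (simp add: c_def)
  qed
  obtain s where s: "0 < s" "\<And>z. z \<in> cball 0 s - {0::complex} \<Longrightarrow> (0::complex) \<noteq> 0"
    by (rule powser_0_nonzero [of 1 0 c "\<lambda>_. 0" "Suc n0"])
       (use sums n0 in \<open>auto simp: c_def\<close>)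
  have "complex_of_real s \<in> cball 0 s - {0}" using s(1) by auto
  then show False using s(2) by blast
qed

lemma fourier_coeff_eqI: "has_q_expansion f a \<Longrightarrow> fourier_coeff f = a"
  unfolding fourier_coeff_def by (rule the_equality) (auto intro: q_expansion_unique)

lemma q_expansion_abs_summable:
  assumes "has_q_expansion f a" "y > 0"
  shows "summable (\<lambda>n. norm (a n) * exp (- 2 * pi * y) ^ n)"
proof -
  \<comment> \<open>Any radius strictly between exp (- 2 pi y) and 1 serves: convergence there gives
    absolute convergence further in.\<close>
  define w where "w = complex_of_real (exp (- pi * y))"
  have "norm w < 1" "w \<noteq> 0" using assms by (simp_all add: w_def)
  then obtain z where z: "Im z > 0" "nome z = w"
    using q_surj[of w] by blast
  have "summable (\<lambda>n. a n * w ^ n)"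
    using assms z unfolding has_q_expansion_def exp_q_power upper_half_plane_def
    by (auto simp: sums_iff)
  moreover have "norm (complex_of_real (exp (- 2 * pi * y))) < norm w"
    using assms by (simp add: w_def)
  ultimately have "summable (\<lambda>n. norm (a n * complex_of_real (exp (- 2 * pi * y)) ^ n))"
    by (rule powser_insidea)
  then show ?thesis by (simp add: norm_mult norm_power)
qed

text \<open>The factor q^N comes out of the series, and what remains is dominated by its value at
  height \<open>y0\<close>. The case N = 1 is the decay of a cusp form; N = 2 is applied to f -
  q.\<close>

lemma q_expansion_bound:
  assumes f: "has_q_expansion f a" and "\<And>j. j < N \<Longrightarrow> a j = 0" and "y0 > 0"
  obtains C where "C > 0" "\<And>z. Im z \<ge> y0 \<Longrightarrow> norm (f z) \<le> C * exp (- 2 * pi * Im z) ^ N"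
proof
  define r where "r = exp (- 2 * pi * y0)"
  have r: "r > 0" by (simp add: r_def)
  have sm: "summable (\<lambda>n. norm (a n) * r ^ n)"
    unfolding r_def by (rule q_expansion_abs_summable [OF assms(1,3)])
  define S where "S = (\<Sum>n. norm (a n) * r ^ n)"
  have S: "S \<ge> 0" unfolding S_def by (rule suminf_nonneg [OF sm]) (use r in auto)
  show "(S + 1) / r ^ N > 0" using S r by simp
  fix z assume z: "Im z \<ge> y0"
  define q where "q = exp (- 2 * pi * Im z)"
  have q: "0 < q" "q \<le> r" using z by (simp_all add: q_def r_def)
  have le: "norm (a n * exp (tpi * of_nat n * z)) \<le> norm (a n) * r ^ n * (q / r) ^ N" for n
  proof (cases "n < N")
    case True then show ?thesis using assms(2) by simp
  next
    case False
    then have "q ^ n = q ^ N * q ^ (n - N)" by (simp flip: power_add)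
    also have "\<dots> \<le> q ^ N * r ^ (n - N)" using q by (intro mult_left_mono power_mono) auto
    also have "\<dots> = r ^ n * (q / r) ^ N" using False r
      by (simp add: power_divide field_simps flip: power_add)
    finally have "norm (a n) * q ^ n \<le> norm (a n) * (r ^ n * (q / r) ^ N)"
      by (intro mult_left_mono) auto
    then show ?thesis unfolding exp_q_power norm_mult norm_power norm_exp_q q_def[symmetric]
      by (simp add: mult_ac)
  qed
  have "(\<lambda>n. a n * exp (tpi * of_nat n * z)) sums f z"
    using f z assms(3) unfolding has_q_expansion_def upper_half_plane_def by auto
  then have "f z = (\<Sum>n. a n * exp (tpi * of_nat n * z))"
    by (simp add: sums_iff)
  also have "norm \<dots> \<le> (\<Sum>n. norm (a n) * r ^ n * (q / r) ^ N)"
    by (intro norm_suminf_le le summable_mult2 sm)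
  finally have "norm (f z) \<le> (\<Sum>n. norm (a n) * r ^ n * (q / r) ^ N)" .
  also have "\<dots> = S * (q / r) ^ N"
    unfolding S_def by (rule suminf_mult2 [OF sm, symmetric])
  also have "\<dots> \<le> (S + 1) * (q / r) ^ N" using q r by (intro mult_right_mono) auto
  finally show "norm (f z) \<le> (S + 1) / r ^ N * exp (- 2 * pi * Im z) ^ N"
    by (simp add: q_def power_divide)
qed

lemma sum_roots_of_unity:
  fixes m :: int
  assumes "d > 0"
  shows "(\<Sum>b<d. exp (tpi * (of_int m * of_nat b / of_nat d)))
     = (if int d dvd m then of_nat d else (0 :: complex))"
proof -
  define w where "w = exp (tpi * (of_int m / of_nat d))"
  have pw: "exp (tpi * (of_int m * of_nat b / of_nat d)) = w ^ b" for b
    unfolding w_def by (subst exp_of_nat_mult [symmetric]) (simp add: mult_ac)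
  have wd: "w ^ d = 1"
    using assms unfolding pw[symmetric] by (simp add: exp_eq_1 mult.commute)
  have w1: "w = 1 \<longleftrightarrow> int d dvd m"
  proof
    assume "w = 1"
    then obtain j :: int where "2 * pi * (of_int m / of_nat d) = of_int (2 * j) * pi"
      unfolding w_def exp_eq_1 by auto
    then have "real_of_int m = of_int (int d * j)"
      using assms by (simp add: field_simps)
    then have "m = int d * j" by linarith
    then show "int d dvd m" by simp
  next
    assume "int d dvd m"
    then obtain j where "m = int d * j" by auto
    then show "w = 1" using assms unfolding w_def exp_eq_1
      by (auto simp: field_simps intro!: exI[of _ j])
  qed
  show ?thesis
  proof (cases "w = 1")
    case True then show ?thesis using w1 unfolding pw by simp
  next
    case False
    then have "(\<Sum>b<d. w ^ b) = (w ^ d - 1) / (w - 1)" by (rule geometric_sum)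
    then show ?thesis using False w1 wd unfolding pw by simp
  qed
qed

text \<open>The partial sums satisfy an exact Parseval identity for the discrete Fourier transform.\<close>

lemma bessel_trig:
  fixes c :: "nat \<Rightarrow> complex"
  assumes sm: "summable (\<lambda>n. norm (c n))"
    and B: "\<And>x::real. norm (\<Sum>n. c n * exp (tpi * of_nat n * of_real x)) \<le> B"
  shows "(\<Sum>n<N. (norm (c n))\<^sup>2) \<le> B\<^sup>2"
proof -
  define e where "e n x = exp (tpi * of_nat n * of_real x)" for n and x :: real
  have ne: "norm (e n x) = 1" for n x by (simp add: e_def)
  define t where "t K = (\<Sum>n. norm (c (n + K)))" for K
  have t0: "t \<longlonglongrightarrow> 0" unfolding t_def using suminf_exist_split2[OF sm] .
  have PK: "norm (\<Sum>n<K. c n * e n x) \<le> B + t K" for K x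
  proof -
    have s2: "summable (\<lambda>n. norm (c n * e n x))" using sm by (simp add: norm_mult ne)
    have "(\<Sum>n<K. c n * e n x) = (\<Sum>n. c n * e n x) - (\<Sum>n. c (n + K) * e (n + K) x)"
      using suminf_split_initial_segment[OF summable_norm_cancel[OF s2], of K] by simp
    also have "norm \<dots> \<le> B + norm (\<Sum>n. c (n + K) * e (n + K) x)"
      using B[of x] unfolding e_def by (intro order.trans[OF norm_triangle_ineq4] add_right_mono)
    also have "norm (\<Sum>n. c (n + K) * e (n + K) x) \<le> (\<Sum>n. norm (c (n + K) * e (n + K) x))"
      by (rule summable_norm) (rule summable_ignore_initial_segment[OF s2])
    also have "\<dots> = t K" by (simp add: t_def norm_mult ne)
    finally show ?thesis by simp
  qed
  \<comment> \<open>Sampling at the points j / K replaces an integral over the period: frequencies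
    below K are distinct modulo K, so the cross terms cancel exactly. Cutting the series at K costs
    only the tail \<open>t K\<close>.\<close>
  have key: "(\<Sum>n<K. (norm (c n))\<^sup>2) \<le> (B + t K)\<^sup>2" if K: "K > 0" for K
  proof -
  let ?ee = "\<lambda>n m j. (e n (real j / real K) * cnj (e m (real j / real K)))"
  let ?S = "\<lambda>j. (\<Sum>n<K. c n * e n (real j / real K))"
    have pars: "(\<Sum>j<K. complex_of_real ((norm (?S j))\<^sup>2))
        = of_nat K * of_real (\<Sum>n<K. (norm (c n))\<^sup>2)"
    proof -
      have ee: "e n (real j / real K) * cnj (e m (real j / real K)) =
          exp (tpi * (of_int (int n - int m) * of_nat j / of_nat K))" for n m j
        unfolding e_def by (simp add: exp_cnj flip: exp_add) (simp add: algebra_simps diff_divide_distrib)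
      have "(\<Sum>j<K. complex_of_real ((norm (?S j))\<^sup>2))
         = (\<Sum>j<K. \<Sum>n<K. \<Sum>m<K. c n * cnj (c m) * (?ee n m j))"
        unfolding complex_norm_square by (simp add: sum_product mult_ac)
      also have "\<dots> = (\<Sum>n<K. \<Sum>j<K. \<Sum>m<K. c n * cnj (c m) * (?ee n m j))"
        by (rule sum.swap)
      also have "\<dots> = (\<Sum>n<K. \<Sum>m<K. \<Sum>j<K. c n * cnj (c m) * (?ee n m j))"
        by (intro sum.cong refl sum.swap)
      also have "\<dots> = (\<Sum>n<K. \<Sum>m<K. c n * cnj (c m) * (if int K dvd int n - int m then of_nat K else 0))"
        unfolding ee sum_distrib_left[symmetric] sum_roots_of_unity[OF K] ..
      also have "\<dots> = (\<Sum>n<K. \<Sum>m<K. if m = n then c n * cnj (c m) * of_nat K else 0)"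
      proof (intro sum.cong refl)
        fix n m assume "n \<in> {..<K}" "m \<in> {..<K}"
        then have "int K dvd int n - int m \<longleftrightarrow> m = n"
          by (auto simp: mod_eq_dvd_iff [symmetric])
        then show "c n * cnj (c m) * (if int K dvd int n - int m then of_nat K else 0)
           = (if m = n then c n * cnj (c m) * of_nat K else 0)" by simp
      qed
      also have "\<dots> = of_nat K * of_real (\<Sum>n<K. (norm (c n))\<^sup>2)"
        by (simp add: sum_distrib_left complex_norm_square mult_ac del: of_real_power)
      finally show ?thesis .
    qed
    have "real K * (\<Sum>n<K. (norm (c n))\<^sup>2) = (\<Sum>j<K. (norm (?S j))\<^sup>2)"
      proof -
      have "complex_of_real (real K * (\<Sum>n<K. (norm (c n))\<^sup>2)) =
          of_real (\<Sum>j<K. (norm (?S j))\<^sup>2)"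
        unfolding of_real_sum of_real_mult of_real_of_nat_eq using pars by simp
      then show ?thesis by (simp only: of_real_eq_iff)
    qed
    also have "\<dots> \<le> (\<Sum>j<K. (B + t K)\<^sup>2)"
      by (intro sum_mono power_mono PK) auto
    finally show ?thesis using K by simp
  qed
  have "(\<lambda>K. (B + t K)\<^sup>2) \<longlonglongrightarrow> (B + 0)\<^sup>2"
    by (intro tendsto_intros t0)
  moreover have "(\<Sum>n<N. (norm (c n))\<^sup>2) \<le> (B + t K)\<^sup>2" if "K \<ge> max 1 N" for K
    by (rule order.trans[OF _ key]) (use that in \<open>auto intro!: sum_mono2\<close>)
  ultimately show ?thesis
    by (intro LIMSEQ_le_const[where X="\<lambda>K. (B + t K)\<^sup>2"]) (auto intro!: exI[of _ "max 1 N"])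
qed

section \<open>Integer matrices acting on the upper half plane\<close>

text \<open>Quadruples are the entries of a 2 by 2 matrix read row by row. The determinant is
  recorded by \<open>imats\<close>, so that the modular group (determinant 1) and the Hecke matrices
  share one action.\<close>

type_synonym imat = "int \<times> int \<times> int \<times> int"

definition imats :: "int \<Rightarrow> imat set" where
  "imats n = {(a, b, c, d). a * d - b * c = n}"

fun mob :: "imat \<Rightarrow> complex \<Rightarrow> complex" where
  "mob (a, b, c, d) z = (of_int a * z + of_int b) / (of_int c * z + of_int d)"

fun autfac :: "imat \<Rightarrow> complex \<Rightarrow> complex" where
  "autfac (a, b, c, d) z = of_int c * z + of_int d"

fun imult :: "imat \<Rightarrow> imat \<Rightarrow> imat" where
  "imult (a, b, c, d) (a', b', c', d') =
     (a * a' + b * c', a * b' + b * d', c * a' + d * c', c * b' + d * d')"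

text \<open>The adjugate is the determinant times the inverse: it stays integral, keeps the
  determinant, and acts as the inverse Moebius map.\<close>

fun iadj :: "imat \<Rightarrow> imat" where
  "iadj (a, b, c, d) = (d, - b, - c, a)"

lemma imats_imult: "g \<in> imats m \<Longrightarrow> h \<in> imats n \<Longrightarrow> imult g h \<in> imats (m * n)"
proof -
  assume gh: "g \<in> imats m" "h \<in> imats n"
  obtain a b c d a' b' c' d' where [simp]: "g = (a, b, c, d)" "h = (a', b', c', d')"
    by (metis prod.exhaust)
  have "m * n = (a * d - b * c) * (a' * d' - b' * c')" using gh by (simp add: imats_def)
  then show ?thesis by (simp add: imats_def algebra_simps)
qed

lemma iadj_imats [simp]: "iadj g \<in> imats n \<longleftrightarrow> g \<in> imats n"
  by (cases g) (auto simp: imats_def algebra_simps)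

lemma iadj_iadj [simp]: "iadj (iadj g) = g"
  by (cases g) auto

lemma imult_assoc: "imult (imult g h) l = imult g (imult h l)"
  by (cases g; cases h; cases l) (simp add: algebra_simps)

lemma imult_iadj: "g \<in> imats n \<Longrightarrow> imult g (iadj g) = (n, 0, 0, n)"
  "g \<in> imats n \<Longrightarrow> imult (iadj g) g = (n, 0, 0, n)"
  by (cases g; auto simp: imats_def algebra_simps)+

lemma imult_1 [simp]: "imult (1, 0, 0, 1) g = g" "imult g (1, 0, 0, 1) = g"
  by (cases g; simp)+

lemma autfac_nonzero:
  assumes "g \<in> imats n" "n \<noteq> 0" "Im z > 0"
  shows "autfac g z \<noteq> 0"
proof (cases g)
  case (fields a b c d)
  show ?thesis
  proof
    assume "autfac g z = 0"
    then have "of_int c * Im z = 0" "of_int c * Re z + of_int d = 0"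
      by (auto simp: fields complex_eq_iff)
    then show False using assms by (auto simp: fields imats_def)
  qed
qed

lemma Im_mob:
  assumes "g \<in> imats n"
  shows "Im (mob g z) = of_int n * Im z / (norm (autfac g z))\<^sup>2"
proof (cases g)
  case (fields a b c d)
  have n: "real_of_int n = of_int a * of_int d - of_int b * of_int c"
    using assms by (auto simp: fields imats_def)
  have "of_int a * Im z * (of_int c * Re z + of_int d) -
      (of_int a * Re z + of_int b) * (of_int c * Im z) = of_int n * Im z"
    unfolding n by (simp add: algebra_simps)
  then show ?thesis
    by (simp add: fields Im_divide cmod_power2)
qed

lemma Im_mob_pos: "g \<in> imats n \<Longrightarrow> n > 0 \<Longrightarrow> Im z > 0 \<Longrightarrow> Im (mob g z) > 0"
  using autfac_nonzero[of g n z] by (simp add: Im_mob)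

lemma autfac_imult:
  assumes "h \<in> imats n" "n \<noteq> 0" "Im z > 0"
  shows "autfac (imult g h) z = autfac g (mob h z) * autfac h z"
  using autfac_nonzero[OF assms] by (cases g; cases h) (simp add: field_simps)

lemma mob_imult:
  assumes "h \<in> imats n" "n \<noteq> 0" "Im z > 0"
  shows "mob (imult g h) z = mob g (mob h z)"
proof -
  obtain a b c d a' b' c' d' where [simp]: "g = (a, b, c, d)" "h = (a', b', c', d')"
    by (metis prod.exhaust)
  have nz: "of_int c' * z + of_int d' \<noteq> 0" using autfac_nonzero[OF assms] by simp
  have "mob g (mob h z) = ((of_int a * mob h z + of_int b) * (of_int c' * z + of_int d')) /
      ((of_int c * mob h z + of_int d) * (of_int c' * z + of_int d'))"
    using nz by simp
  also have "\<dots> = mob (imult g h) z"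
    using nz by (simp add: distrib_right) (simp add: algebra_simps)
  finally show ?thesis ..
qed

lemma mob_scalar: "n \<noteq> 0 \<Longrightarrow> mob (n, 0, 0, n) z = z" "autfac (n, 0, 0, n) z = of_int n"
  by simp_all

text \<open>The imaginary part of cz + d bounds c, and the triangle inequality then bounds d. Hence
  an orbit has only finitely many heights above a given one.\<close>

lemma finite_autfac_le:
  assumes "Im z > 0"
  shows "finite {(c::int, d::int). norm (of_int c * z + of_int d) \<le> B}"
proof -
  have "{(c, d). norm (of_int c * z + of_int d) \<le> B} \<subseteq>
     {c. \<bar>of_int c\<bar> \<le> B / Im z} \<times> {d. \<bar>of_int d\<bar> \<le> B + B / Im z * norm z}"
  proof (intro subsetI, elim CollectE case_prodE, hypsubst)
    fix c d assume *: "norm (of_int c * z + of_int d) \<le> B"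
    have "\<bar>of_int c\<bar> * Im z \<le> norm (of_int c * z + of_int d)"
      using abs_Im_le_cmod[of "of_int c * z + of_int d"] assms by (simp add: abs_mult)
    then have c: "\<bar>of_int c\<bar> \<le> B / Im z" using * assms by (simp add: field_simps)
    have "norm (of_int d :: complex) \<le> norm (of_int c * z + of_int d) + norm (of_int c * z)"
      by (metis add_diff_cancel_left' norm_triangle_ineq4 )
    then have "\<bar>of_int d\<bar> \<le> B + \<bar>of_int c\<bar> * norm z"
      using * by (simp add: norm_mult)
    also have "\<bar>of_int c\<bar> * norm z \<le> B / Im z * norm z" using c by (intro mult_right_mono) auto
    finally show "(c, d) \<in> {c. \<bar>of_int c\<bar> \<le> B / Im z} \<times> {d. \<bar>of_int d\<bar> \<le> B + B / Im z * norm z}"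
      using c by simp
  qed
  moreover have "finite {c::int. \<bar>of_int c\<bar> \<le> (r::real)}" for r
  proof (rule finite_subset)
    show "{c::int. \<bar>of_int c\<bar> \<le> r} \<subseteq> {- \<lceil>r\<rceil>..\<lceil>r\<rceil>}"
    proof
      fix c :: int assume "c \<in> {c. \<bar>of_int c\<bar> \<le> r}"
      then have "real_of_int \<bar>c\<bar> \<le> of_int \<lceil>r\<rceil>" by simp linarith
      then show "c \<in> {- \<lceil>r\<rceil>..\<lceil>r\<rceil>}" by auto
    qed
  qed auto
  ultimately show ?thesis by (meson finite_SigmaI finite_imageI finite_subset)
qed

text \<open>A Siegel set strictly containing the usual fundamental domain. The straight lower edge
  avoids the circular arc, at the price of overlapping translates, which \<open>weight\<close>
  compensates.\<close>

definition siegel :: "complex set" where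
  "siegel = {z. \<bar>Re z\<bar> \<le> 1/2 \<and> Im z \<ge> 1/2}"

lemma siegel_Im_pos: "z \<in> siegel \<Longrightarrow> Im z > 0"
  by (auto simp: siegel_def)

text \<open>A point of maximal height in the orbit exists, since heights of at least
  \<open>Im z\<close> force |cz + d| <= 1. After translation to |Re v| <= 1/2, a norm below 1 would
  let the inversion raise the height further.\<close>

lemma siegel_reduction:
  assumes z: "Im z > 0"
  obtains g where "g \<in> imats 1" "mob g z \<in> siegel"
proof -
  define T where "T = {Im (mob g z) |g. g \<in> imats 1 \<and> Im (mob g z) \<ge> Im z}"
  have "T \<subseteq> (\<lambda>(c, d). Im z / (norm (of_int c * z + of_int d))\<^sup>2) `
      {(c::int, d::int). norm (of_int c * z + of_int d) \<le> 1}"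
  proof
    fix t assume "t \<in> T"
    then obtain g where g: "g \<in> imats 1" "Im (mob g z) \<ge> Im z" "t = Im (mob g z)"
      unfolding T_def by blast
    obtain a b c d where gg: "g = (a, b, c, d)" by (metis prod.exhaust)
    have "norm (autfac g z) > 0" using autfac_nonzero[OF g(1)] z by simp
    then have "(norm (autfac g z))\<^sup>2 \<le> 1\<^sup>2" using g(2) Im_mob[OF g(1), of z] z
      by (simp add: field_simps)
    then have "norm (autfac g z) \<le> 1" by (rule power2_le_imp_le) simp
    then show "t \<in> (\<lambda>(c, d). Im z / (norm (of_int c * z + of_int d))\<^sup>2) `
      {(c::int, d::int). norm (of_int c * z + of_int d) \<le> 1}"
      using g Im_mob[OF g(1), of z] by (intro image_eqI[of _ _ "(c, d)"]) (use \<open>norm (autfac g z) \<le> 1\<close> in \<open>auto simp: gg\<close>)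
  qed
  then have fT: "finite T" using finite_autfac_le[OF z] finite_subset by blast
  have "(1, 0, 0, 1) \<in> imats 1" "Im (mob (1, 0, 0, 1) z) = Im z" by (auto simp: imats_def)
  then have "Im z \<in> T" unfolding T_def by force
  then have "Max T \<in> T" using fT by (intro Max_in) auto
  moreover have "\<exists>g. g \<in> imats 1 \<and> Im (mob g z) = t \<and> Im (mob g z) \<ge> Im z" if "t \<in> T" for t
    using that unfolding T_def by blast
  ultimately obtain g where g: "g \<in> imats 1" "Im (mob g z) = Max T" "Im (mob g z) \<ge> Im z"
    by blast
  define w where "w = mob g z"
  have w: "Im w > 0" using Im_mob_pos[OF g(1)] z by (simp add: w_def)
  define h :: imat where "h = (1, - round (Re w), 0, 1)"
  have h: "h \<in> imats 1" by (simp add: h_def imats_def)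
  define v where "v = mob (imult h g) z"
  have v: "v = w - of_int (round (Re w))"
    using mob_imult[OF g(1) _ z, of h] by (simp add: v_def w_def h_def)
  have Rev: "\<bar>Re v\<bar> \<le> 1/2" using of_int_round_abs_le[of "Re w"] by (simp add: v abs_minus_commute)
  have Imv: "Im v = Im w" by (simp add: v)
  have hg: "imult h g \<in> imats 1" using imats_imult[OF h g(1)] by simp
  have nv: "norm v \<ge> 1"
  proof (rule ccontr)
    assume less: "\<not> norm v \<ge> 1"
    define s :: imat where "s = (0, - 1, 1, 0)"
    have s: "s \<in> imats 1" by (simp add: s_def imats_def)
    have shg: "imult s (imult h g) \<in> imats 1" using imats_imult[OF s hg] by simp
    have v0: "v \<noteq> 0" using w Imv by auto
    have "Im (mob (imult s (imult h g)) z) = Im w / (norm v)\<^sup>2"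
      using mob_imult[OF hg _ z, of s] Im_mob[OF s, of v] Imv by (simp add: v_def s_def)
    moreover have "(norm v)\<^sup>2 < 1" using less by (simp add: power_less_one_iff abs_square_less_1)
    then have "Im w / (norm v)\<^sup>2 > Im w" using w v0
      by (simp add: field_simps)
    ultimately have gt: "Im (mob (imult s (imult h g)) z) > Max T" using g(2) w_def by simp
    then have "Im (mob (imult s (imult h g)) z) \<in> T" using shg g unfolding T_def
      by (smt (verit, best) mem_Collect_eq)
    then show False using gt fT Max_ge by fastforce
  qed
  \<comment> \<open>The two inequalities even give (Im v)^2 >= 3/4; the Siegel set asks only for
    1/4.\<close>
  have "(1/2)\<^sup>2 \<le> (Im v)\<^sup>2"
  proof -
    have "1\<^sup>2 \<le> (norm v)\<^sup>2" using nv by (intro power_mono) auto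
    moreover have "(Re v)\<^sup>2 \<le> (1/2)\<^sup>2" using Rev by (intro power2_le_iff_abs_le[THEN iffD2]) auto
    ultimately show ?thesis using cmod_power2[of v] by (simp add: power_divide)
  qed
  then have "1/2 \<le> Im v" using w Imv by (intro power2_le_imp_le[of "1/2"]) auto
  then show ?thesis using Rev hg that by (auto simp: siegel_def v_def)
qed

section \<open>Fourier coefficients of a normalized form\<close>

locale normalized_form =
  fixes k :: nat and f :: "complex \<Rightarrow> complex" and a :: "nat \<Rightarrow> complex"
  assumes hol: "f holomorphic_on upper_half_plane"
    and modular: "\<And>g z. g \<in> imats 1 \<Longrightarrow> Im z > 0 \<Longrightarrow> f (mob g z) = autfac g z ^ k * f z"
    and q_exp: "has_q_expansion f a"
    and a_0: "a 0 = 0" and a_1: "a (Suc 0) = 1"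
begin

abbreviation half_wt :: complex where "half_wt \<equiv> of_real ((real k - 1) / 2)"

lemma f_sums: "Im z > 0 \<Longrightarrow> (\<lambda>n. a n * nome z ^ n) sums f z"
  using q_exp unfolding has_q_expansion_def exp_q_power upper_half_plane_def by auto

lemma f_bound:
  obtains C where "C > 0" "\<And>z. Im z \<ge> 1/2 \<Longrightarrow> norm (f z) \<le> C * exp (- 2 * pi * Im z)"
  using q_expansion_bound[OF q_exp, of 1 "1/2"] a_0 by auto

lemma f_asymp:
  obtains C where "C > 0"
    "\<And>z. Im z \<ge> 1/2 \<Longrightarrow> norm (f z - nome z) \<le> C * exp (- 2 * pi * Im z) ^ 2"
proof -
  define b where "b n = (if n = 1 then 0 else a n)" for n
  have "has_q_expansion (\<lambda>z. f z - nome z) b"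
    unfolding has_q_expansion_def exp_q_power
  proof
    fix z assume "z \<in> upper_half_plane"
    then have "(\<lambda>n. a n * nome z ^ n) sums f z"
      using q_exp unfolding has_q_expansion_def exp_q_power by auto
    then have "(\<lambda>n. a n * nome z ^ n
         - (if n = 1 then nome z else 0)) sums
           (f z - nome z)"
      by (rule sums_diff) (rule sums_single)
    also have "(\<lambda>n. a n * nome z ^ n
         - (if n = 1 then nome z else 0)) = (\<lambda>n. b n * nome z ^ n)"
      by (auto simp: b_def a_1)
    finally show "\<dots> sums (f z - nome z)" .
  qed
  moreover have "b j = 0" if "j < 2" for j using that a_0 by (auto simp: b_def less_2_cases_iff)
  ultimately obtain C where "C > 0"
    "\<And>z. Im z \<ge> 1/2 \<Longrightarrow> norm (f z - nome z) \<le> C * exp (- 2 * pi * Im z) ^ 2"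
    by (rule q_expansion_bound[where ?y0.0 = "1/2"]) auto
  then show ?thesis by (rule that)
qed

text \<open>High up the leading term q dominates the error O(q^2). This serves both the parity of
  the weight and the positivity of the Petersson norm.\<close>

lemma f_nonzero:
  obtains Y where "\<And>z. Im z \<ge> Y \<Longrightarrow> f z \<noteq> 0"
proof -
  obtain C where C: "C > 0"
    "\<And>z. Im z \<ge> 1/2 \<Longrightarrow> norm (f z - nome z) \<le> C * exp (- 2 * pi * Im z) ^ 2"
    using f_asymp by metis
  show ?thesis
  proof (rule that)
    \<comment> \<open>Above height C one has C < exp C <= exp (2 pi Im z), which is exactly what
      makes the error smaller than the leading term.\<close>
    fix z assume z: "Im z \<ge> max (1/2) C"
    have "C < exp C" using exp_ge_add_one_self[of C] by linarith
    also have "C \<le> 2 * pi * Im z"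
      using z C(1) pi_ge_two mult_mono[of 1 "2 * pi" C "Im z"] by auto
    finally have "C * exp (- 2 * pi * Im z) < 1"
      by (simp add: exp_minus field_simps)
    then have "C * exp (- 2 * pi * Im z) ^ 2 < exp (- 2 * pi * Im z)"
      by (simp add: power2_eq_square flip: mult.assoc)
    then show "f z \<noteq> 0" using C(2)[of z] z norm_exp_q[of z] by (auto simp: norm_minus_commute)
  qed
qed

text \<open>Minus the identity acts trivially on points but with automorphy factor (-1)^k.\<close>

lemma even_weight: "even k"
proof (rule ccontr)
  assume odd: "odd k"
  obtain Y where Y: "\<And>z. Im z \<ge> Y \<Longrightarrow> f z \<noteq> 0" using f_nonzero by metis
  define z where "z = Complex 0 (max 1 Y)"
  have "f (mob (-1, 0, 0, -1) z) = autfac (-1, 0, 0, -1) z ^ k * f z"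
    by (rule modular) (auto simp: imats_def z_def)
  then have "f z = - f z" using odd by simp
  then show False using Y[of z] by (simp add: z_def)
qed

text \<open>Otherwise f = q, and the inversion at iy equates exp (- 2 pi / y), bounded below for y
  >= 1, with y^k exp (- 2 pi y), which tends to 0.\<close>

lemma exists_coeff: "\<exists>n\<ge>2. a n \<noteq> 0"
proof (rule ccontr)
  assume none: "\<not> (\<exists>n\<ge>2. a n \<noteq> 0)"
  have fz: "f z = nome z" if "Im z > 0" for z
  proof -
    have "a n = (if n = 1 then 1 else 0)" for n
      using none a_0 a_1 by (cases "n = 0"; cases "n = 1") auto
    then have "(\<lambda>n. a n * nome z ^ n) =
       (\<lambda>n. if n = 1 then nome z else 0)" by auto
    then show ?thesis using f_sums[OF that] sums_single[of 1 "\<lambda>_. nome z"]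
      by (metis sums_unique2)
  qed
  have eq: "exp (- 2 * pi) \<le> y ^ k / exp y" if y: "y \<ge> 1" for y :: real
  proof -
    have "f (mob (0, -1, 1, 0) (\<i> * y)) = autfac (0, -1, 1, 0) (\<i> * y) ^ k * f (\<i> * y)"
      by (rule modular) (use y in \<open>auto simp: imats_def\<close>)
    moreover have "mob (0, -1, 1, 0) (\<i> * y) = \<i> * of_real (1 / y)"
      using y by (simp add: field_simps)
    ultimately have "norm (f (\<i> * of_real (1 / y))) = norm ((\<i> * y) ^ k * f (\<i> * y))" by simp
    then have "exp (- 2 * pi * (1 / y)) = y ^ k * exp (- 2 * pi * y)"
      using y by (simp add: fz norm_mult norm_power)
    moreover have "exp (- 2 * pi) \<le> exp (- 2 * pi * (1 / y))"
      using y by (simp add: field_simps)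
    moreover have "exp (- 2 * pi * y) \<le> exp (- y)"
      using y pi_ge_two by simp
    then have "y ^ k * exp (- 2 * pi * y) \<le> y ^ k * exp (- y)"
      using y by (intro mult_left_mono) auto
    ultimately have "exp (- 2 * pi) \<le> y ^ k * exp (- y)" by linarith
    then show ?thesis by (simp add: exp_minus field_simps)
  qed
  have "((\<lambda>y::real. y ^ k / exp y) \<longlongrightarrow> 0) at_top" by (rule tendsto_power_div_exp_0)
  then have "eventually (\<lambda>y::real. y ^ k / exp y < exp (- 2 * pi)) at_top"
    by (rule order_tendstoD) simp
  moreover have "eventually (\<lambda>y::real. y \<ge> 1) at_top" by (rule eventually_ge_at_top)
  ultimately have "eventually (\<lambda>y::real. False) at_top"
    by eventually_elim (use eq in force)
  then show False by simp
qed

section \<open>The invariant height and mean squares of the Fourier coefficients\<close>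

abbreviation height :: "complex \<Rightarrow> real" where "height z \<equiv> (norm (f z))\<^sup>2 * Im z ^ k"

lemma invariant_height:
  assumes "g \<in> imats 1" "Im z > 0"
  shows "height (mob g z) = height z"
  using autfac_nonzero[OF assms(1) _ assms(2)]
  by (simp add: modular[OF assms] Im_mob[OF assms(1)] norm_mult norm_power power_mult_distrib
      power_divide flip: power_mult) (simp add: mult.commute)

text \<open>On the Siegel set the exponential decay of f beats y^k, with y^k <= k! exp y supplying
  the constant; invariance carries the bound to every other point.\<close>

lemma height_bound:
  obtains C where "C > 0" "\<And>z. Im z > 0 \<Longrightarrow> height z \<le> C"
proof -
  obtain C where C: "C > 0" "\<And>z. Im z \<ge> 1/2 \<Longrightarrow> norm (f z) \<le> C * exp (- 2 * pi * Im z)"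
    using f_bound by metis
  have fin: "height z \<le> C\<^sup>2 * fact k" if "z \<in> siegel" for z
  proof -
    define y where "y = Im z"
    have y: "y \<ge> 1/2" using that by (simp add: y_def siegel_def)
    have "(norm (f z))\<^sup>2 \<le> (C * exp (- 2 * pi * y))\<^sup>2"
      using C(2)[of z] y by (intro power_mono) (auto simp: y_def)
    also have "\<dots> = C\<^sup>2 * exp (- 4 * pi * y)"
      by (simp add: power_mult_distrib exp_of_nat_mult[symmetric] flip: exp_of_nat_mult exp_double)
    also have "\<dots> \<le> C\<^sup>2 * exp (- y)" using y pi_ge_two by (intro mult_left_mono) auto
    finally have "(norm (f z))\<^sup>2 * y ^ k \<le> C\<^sup>2 * exp (- y) * y ^ k"
      using y by (intro mult_right_mono) auto
    also have "y ^ k / fact k \<le> exp y"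
    proof -
      have "(\<lambda>n. y ^ n / fact n) sums exp y" using exp_converges[of y] by (simp add: divide_inverse mult.commute)
      then show ?thesis using y sum_le_suminf[of "\<lambda>n. y ^ n / fact n" "{k}"] by (auto simp: sums_iff)
    qed
    then have "C\<^sup>2 * exp (- y) * y ^ k \<le> C\<^sup>2 * fact k"
      using C(1) by (simp add: exp_minus field_simps)
    finally show ?thesis by (simp add: y_def)
  qed
  show ?thesis
  proof (rule that[of "C\<^sup>2 * fact k"])
    show "C\<^sup>2 * fact k > 0" using C by simp
    fix z assume z: "Im z > 0"
    then obtain g where "g \<in> imats 1" "mob g z \<in> siegel" using siegel_reduction by metis
    then show "height z \<le> C\<^sup>2 * fact k"
      using fin[of "mob g z"] invariant_height z by simp
  qed
qed

text \<open>Bessel's inequality at height 1 / X, where the height bound reads |f|^2 <= C X^k. For n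
  <= X the squared damping factor exp (- 4 pi n / X) is at least exp (- 4 pi), hence the factor
  \<open>exp (4 * pi)\<close>.\<close>

lemma coeff_square_bound:
  obtains C where "C > 0" "\<And>X. X > 0 \<Longrightarrow> (\<Sum>n\<le>X. (norm (a n))\<^sup>2) \<le> C * real X ^ k"
proof -
  obtain C where C: "C > 0" "\<And>z. Im z > 0 \<Longrightarrow> height z \<le> C"
    using height_bound by metis
  show ?thesis
  proof (rule that[of "exp (4 * pi) * C"])
    fix X :: nat assume X: "X > 0"
    define y where "y = 1 / real X"
    have y: "y > 0" "real X * y = 1" using X by (simp_all add: y_def)
    define c where "c n = a n * of_real (exp (- 2 * pi * y) ^ n)" for n
    have nc: "norm (c n) = norm (a n) * exp (- 2 * pi * y) ^ n" for n
      by (simp add: c_def norm_mult norm_power)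
    have "(\<Sum>n<Suc X. (norm (c n))\<^sup>2) \<le> (sqrt (C * real X ^ k))\<^sup>2"
    proof (rule bessel_trig)
      show "summable (\<lambda>n. norm (c n))"
        unfolding nc using q_expansion_abs_summable[OF q_exp y(1)] .
      fix x :: real
      have eq: "c n * exp (tpi * of_nat n * of_real x) =
          a n * exp (tpi * Complex x y) ^ n" for n
      proof -
        have "complex_of_real (exp (- 2 * pi * y) ^ n) = exp (of_nat n * of_real (- 2 * pi * y))"
          unfolding of_real_power exp_of_nat_mult exp_of_real ..
        moreover have "of_nat n * of_real (- 2 * pi * y) + tpi * of_nat n * of_real x =
            tpi * of_nat n * Complex x y"
          by (simp add: complex_eq_iff)
        ultimately show ?thesis
          unfolding c_def exp_q_power[symmetric] by (simp only: mult.assoc exp_add [symmetric])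
      qed
      have "(\<lambda>n. a n * exp (tpi * Complex x y) ^ n) sums f (Complex x y)"
        using f_sums[of "Complex x y"] y by simp
      then have "norm (\<Sum>n. c n * exp (tpi * of_nat n * of_real x)) = norm (f (Complex x y))"
        unfolding eq by (simp add: sums_iff)
      also have "\<dots> \<le> sqrt (C * real X ^ k)"
      proof (rule real_le_rsqrt)
        have "(norm (f (Complex x y)))\<^sup>2 * y ^ k \<le> C" using C(2)[of "Complex x y"] y by simp
        then have "(norm (f (Complex x y)))\<^sup>2 * y ^ k * real X ^ k \<le> C * real X ^ k"
          by (intro mult_right_mono) auto
        moreover have "y ^ k * real X ^ k = 1"
          using y(2) by (metis mult.commute power_mult_distrib power_one)
        ultimately show "(norm (f (Complex x y)))\<^sup>2 \<le> C * real X ^ k" by (simp add: mult.assoc)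
      qed
      finally show "norm (\<Sum>n. c n * exp (tpi * of_nat n * of_real x)) \<le> sqrt (C * real X ^ k)" .
    qed
    then have le: "(\<Sum>n\<le>X. (norm (c n))\<^sup>2) \<le> C * real X ^ k"
      using C(1) by (simp add: lessThan_Suc_atMost)
    have "(norm (a n))\<^sup>2 \<le> exp (4 * pi) * (norm (c n))\<^sup>2" if "n \<le> X" for n
    proof -
      have "real n * y \<le> 1" using that y mult_right_mono[of "real n" "real X" y] by simp
      then have "4 * pi - 4 * pi * (n * y) \<ge> 0" by (simp add: field_simps)
      then have "1 \<le> exp (4 * pi - 4 * pi * (n * y))" by simp
      also have "\<dots> = exp (4 * pi) * (exp (- 2 * pi * y) ^ n)\<^sup>2"
        by (simp add: exp_diff exp_minus exp_of_nat_mult[symmetric] field_simps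
            flip: power_mult exp_add)
      finally have "(norm (a n))\<^sup>2 * 1 \<le> (norm (a n))\<^sup>2 * (exp (4 * pi) * (exp (- 2 * pi * y) ^ n)\<^sup>2)"
        by (intro mult_left_mono) auto
      then show ?thesis unfolding nc by (simp add: power_mult_distrib mult_ac)
    qed
    then have "(\<Sum>n\<le>X. (norm (a n))\<^sup>2) \<le> (\<Sum>n\<le>X. exp (4 * pi) * (norm (c n))\<^sup>2)"
      by (intro sum_mono) auto
    also have "\<dots> \<le> exp (4 * pi) * (C * real X ^ k)"
      unfolding sum_distrib_left[symmetric] using le by (intro mult_left_mono) auto
    finally show "(\<Sum>n\<le>X. (norm (a n))\<^sup>2) \<le> exp (4 * pi) * C * real X ^ k" by simp
  qed (use C in auto)
qed

section \<open>Normalized coefficients and absolute convergence\<close>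

text \<open>At index 0 the value is 0 because \<open>a 0 = 0\<close>, so Dirichlet series may be
  summed over all natural numbers.\<close>

definition lam :: "nat \<Rightarrow> complex" where
  "lam n = a n / of_real (real n powr ((real k - 1) / 2))"

lemma lam_0 [simp]: "lam 0 = 0" and lam_1 [simp]: "lam (Suc 0) = 1"
  by (simp_all add: lam_def a_0 a_1)

lemma norm_lam_sq: "n > 0 \<Longrightarrow> (norm (lam n))\<^sup>2 = (norm (a n))\<^sup>2 * real n powr (1 - real k)"
proof -
  assume n: "n > 0"
  have "(real n powr ((real k - 1) / 2))\<^sup>2 = real n powr (real k - 1)"
    using n by (simp add: powr_power diff_divide_distrib)
  moreover have "real n powr (1 - real k) = 1 / real n powr (real k - 1)"
    by (simp flip: powr_minus_divide)
  ultimately show ?thesis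
    by (simp add: lam_def norm_divide power_divide)
qed

text \<open>Partial summation in disguise: with e = k + \<sigma> the factor n^(1 - e) is at most 2^e
  times the sum of m^(-e) over n <= m < 2n. After the exchange of sums the inner sum over n is
  bounded by \<open>coeff_square_bound\<close>, and m^(k - e) = m^(-\<sigma>) is summable.\<close>

lemma lam_sq_summable:
  assumes s: "\<sigma> > 1"
  shows "summable (\<lambda>n. (norm (lam n))\<^sup>2 * real n powr (- \<sigma>))"
proof -
  define e where "e = real k + \<sigma>"
  have e: "e > 0" using s by (simp add: e_def)
  let ?b = "\<lambda>n m. 2 powr e * (norm (a n))\<^sup>2 * real m powr (- e)"
  obtain C where C: "C > 0" "\<And>X. X > 0 \<Longrightarrow> (\<Sum>n\<le>X. (norm (a n))\<^sup>2) \<le> C * real X ^ k"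
    using coeff_square_bound by metis
  have sm: "summable (\<lambda>m. real m powr (- \<sigma>))" using s summable_real_powr_iff by simp
  have t: "(norm (lam n))\<^sup>2 * real n powr (- \<sigma>) \<le> 2 powr e * (norm (a n))\<^sup>2 * (\<Sum>m = n..<2*n. real m powr (- e))" for n
  proof (cases "n = 0")
    case False
    have "real n powr (1 - e) = (\<Sum>m = n..<2*n. real n powr (- e))"
      using False by (simp add: powr_diff powr_minus field_simps)
    also have "\<dots> \<le> (\<Sum>m = n..<2*n. 2 powr e * real m powr (- e))"
    proof (rule sum_mono)
      fix m assume m: "m \<in> {n..<2*n}"
      have "real m powr e \<le> (2 * real n) powr e" using m e by (intro powr_mono2) auto
      then show "real n powr (- e) \<le> 2 powr e * real m powr (- e)"
        using m False by (simp add: powr_mult powr_minus field_simps)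
    qed
    finally have "(norm (a n))\<^sup>2 * real n powr (1 - e) \<le> (norm (a n))\<^sup>2 * (\<Sum>m = n..<2*n. 2 powr e * real m powr (- e))"
      by (intro mult_left_mono) auto
    moreover have "(norm (lam n))\<^sup>2 * real n powr (- \<sigma>) = (norm (a n))\<^sup>2 * real n powr (1 - e)"
      using False by (simp add: norm_lam_sq e_def mult.assoc flip: powr_add) (simp add: algebra_simps)
    ultimately show ?thesis
      by (simp add: sum_distrib_left mult_ac)
  qed auto
  show ?thesis
  proof (rule summableI_nonneg_bounded)
    fix N
    have "(\<Sum>n<N. (norm (lam n))\<^sup>2 * real n powr (- \<sigma>)) \<le>
        (\<Sum>n<N. \<Sum>m = n..<2*n. (?b n m))"
      using t by (intro sum_mono) (simp add: sum_distrib_left)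
    also have "\<dots> = (\<Sum>n<N. \<Sum>m | m \<in> {1..<2*N} \<and> n \<le> m \<and> m < 2*n. (?b n m))"
      by (intro sum.cong refl) auto
    also have "\<dots> = (\<Sum>m\<in>{1..<2*N}. \<Sum>n | n \<in> {..<N} \<and> n \<le> m \<and> m < 2*n. (?b n m))"
      by (rule sum.swap_restrict) auto
    also have "\<dots> \<le> (\<Sum>m\<in>{1..<2*N}. 2 powr e * C * real m powr (- \<sigma>))"
    proof (rule sum_mono)
      fix m assume m: "m \<in> {1..<2*N}"
      have "(\<Sum>n | n \<in> {..<N} \<and> n \<le> m \<and> m < 2*n. (norm (a n))\<^sup>2) \<le> (\<Sum>n\<le>m. (norm (a n))\<^sup>2)"
        by (intro sum_mono2) auto
      also have "\<dots> \<le> C * real m ^ k" using m by (intro C) auto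
      finally have "(\<Sum>n | n \<in> {..<N} \<and> n \<le> m \<and> m < 2*n. (norm (a n))\<^sup>2) * (2 powr e * real m powr (- e)) \<le>
          C * real m ^ k * (2 powr e * real m powr (- e))"
        by (intro mult_right_mono) auto
      also have "\<dots> = 2 powr e * C * real m powr (- \<sigma>)"
        using m by (simp add: e_def powr_diff powr_minus powr_add powr_realpow field_simps)
      finally show "(\<Sum>n | n \<in> {..<N} \<and> n \<le> m \<and> m < 2*n. (?b n m))
          \<le> 2 powr e * C * real m powr (- \<sigma>)"
        by (simp add: sum_distrib_left sum_distrib_right mult_ac)
    qed
    also have "\<dots> = 2 powr e * C * (\<Sum>m\<in>{1..<2*N}. real m powr (- \<sigma>))"
      by (simp add: sum_distrib_left)
    also have "\<dots> \<le> 2 powr e * C * (\<Sum>m. real m powr (- \<sigma>))"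
      using C(1) sm by (intro mult_left_mono sum_le_suminf) auto
    finally show "(\<Sum>n<N. (norm (lam n))\<^sup>2 * real n powr (- \<sigma>)) \<le> 2 powr e * C * (\<Sum>m. real m powr (- \<sigma>))" .
  qed auto
qed

text \<open>The inequality x <= x^2 + 1 turns the mean square bound into absolute convergence, in
  place of a pointwise bound on the coefficients.\<close>

lemma lam_summable:
  assumes s: "\<sigma> > 1"
  shows "summable (\<lambda>n. norm (lam n) * real n powr (- \<sigma>))"
proof (rule summable_comparison_test')
  show "summable (\<lambda>n. (norm (lam n))\<^sup>2 * real n powr (- \<sigma>) + real n powr (- \<sigma>))"
    using s summable_real_powr_iff by (intro summable_add lam_sq_summable) auto
  fix n
  have "norm (lam n) \<le> (norm (lam n))\<^sup>2 + 1"
    by (smt (verit) power2_eq_square mult_left_le_imp_le norm_ge_zero mult_le_cancel_left1 zero_le_power2)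
  then have "norm (lam n) * real n powr (- \<sigma>) \<le> ((norm (lam n))\<^sup>2 + 1) * real n powr (- \<sigma>)"
    by (intro mult_right_mono) auto
  then show "norm (norm (lam n) * real n powr (- \<sigma>)) \<le> (norm (lam n))\<^sup>2 * real n powr (- \<sigma>) + real n powr (- \<sigma>)"
    by (simp add: distrib_right)
qed

end

section \<open>Hecke relations and the Euler product\<close>

lemma sums_reindex_mult:
  fixes g :: "nat \<Rightarrow> 'a::real_normed_vector"
  assumes "d > 0"
  shows "(\<lambda>j. if d dvd j then g j else 0) sums X \<longleftrightarrow> (\<lambda>l. g (d * l)) sums X"
proof -
  have "strict_mono (\<lambda>l. d * l)" using assms by (auto simp: strict_mono_def)
  from sums_mono_reindex[OF this, of "\<lambda>j. if d dvd j then g j else 0" X]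
  show ?thesis by (auto simp: dvd_def image_iff)
qed

locale normalized_eigenform = normalized_form +
  assumes eigen: "\<And>n. n \<ge> 1 \<Longrightarrow> \<exists>c. \<forall>z\<in>upper_half_plane. hecke_operator k n f z = c * f z"
begin

text \<open>The classical coefficient of T_n f: with e = n / d, the summand for d is e^(k - 1) a(mn
  / e^2), present when e divides m.\<close>

definition hecke_coeff :: "nat \<Rightarrow> nat \<Rightarrow> complex" where
  "hecke_coeff n m = of_nat n powi (int k - 1) *
     (\<Sum>d | d dvd n. if n div d dvd m then of_nat d powi (1 - int k) * a (d * (m div (n div d))) else 0)"

text \<open>Summing over b is a filter: the roots of unity kill the exponents not divisible by d and
  multiply the others by d. The surviving exponent d l turns into e l in terms of q.\<close>

lemma hecke_inner_sums:
  assumes "d > 0" "e > 0" and z: "Im z > 0"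
  shows "(\<lambda>m. (if e dvd m then of_nat d * a (d * (m div e)) else 0) * nome z ^ m) sums
      (\<Sum>b<d. f ((of_nat e * z + of_nat b) / of_nat d))"
proof -
  let ?X = "(\<Sum>b<d. f ((of_nat e * z + of_nat b) / of_nat d))"
  let ?t = "\<lambda>b j. a j * exp (tpi * of_nat j * ((of_nat e * z + of_nat b) / of_nat d))"
  define q where "q = nome z"
  define E where "E j = exp (tpi * of_nat j * (of_nat e * z / of_nat d))" for j
  have "(\<lambda>j. (?t b j))
      sums f ((of_nat e * z + of_nat b) / of_nat d)" for b
    using q_exp assms unfolding has_q_expansion_def upper_half_plane_def
    by (auto simp: Im_divide_of_nat simp del: times_divide_eq_right)
  then have "(\<lambda>j. \<Sum>b<d. (?t b j))
      sums ?X"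
    by (intro sums_sum)
  also have "(\<lambda>j. \<Sum>b<d. (?t b j))
      = (\<lambda>j. if d dvd j then of_nat d * a j * E j else 0)"
  proof
    fix j
    have "exp (tpi * of_nat j * ((of_nat e * z + of_nat b) / of_nat d)) =
        E j * exp (tpi * (of_int (int j) * of_nat b / of_nat d))" for b
      unfolding E_def exp_add[symmetric] by (rule arg_cong[of _ _ exp]) (simp add: field_simps add_divide_distrib)
    then have "(\<Sum>b<d. (?t b j))
      = a j * E j * (\<Sum>b<d. exp (tpi * (of_int (int j) * of_nat b / of_nat d)))"
      by (simp add: sum_distrib_left mult.assoc)
    then show "(\<Sum>b<d. (?t b j))
      = (if d dvd j then of_nat d * a j * E j else 0)"
      unfolding sum_roots_of_unity[OF assms(1)] by simp
  qed
  finally have "(\<lambda>l. of_nat d * a (d * l) * E (d * l)) sums ?X"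
    using sums_reindex_mult[OF assms(1), of "\<lambda>j. of_nat d * a j * E j"] by blast
  also have "(\<lambda>l. of_nat d * a (d * l) * E (d * l)) = (\<lambda>l. (of_nat d * a (d * ((e * l) div e))) * q ^ (e * l))"
  proof
    fix l
    have "E (d * l) = q ^ (e * l)"
      unfolding q_def E_def exp_of_nat_mult[symmetric]
      using assms(1) by (intro arg_cong[of _ _ exp]) (simp add: field_simps)
    then show "of_nat d * a (d * l) * E (d * l) = (of_nat d * a (d * ((e * l) div e))) * q ^ (e * l)"
      using assms(2) by simp
  qed
  finally have "(\<lambda>m. if e dvd m then (of_nat d * a (d * (m div e))) * q ^ m else 0) sums
      ?X"
    using sums_reindex_mult[OF assms(2), of "\<lambda>m. (of_nat d * a (d * (m div e))) * q ^ m"] by blast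
  then show ?thesis unfolding q_def by (simp add: if_distrib[of "\<lambda>x. x * _"] cong: if_cong)
qed

lemma hecke_q_expansion:
  assumes n: "n \<ge> 1"
  shows "has_q_expansion (hecke_operator k n f) (hecke_coeff n)"
  unfolding has_q_expansion_def exp_q_power
proof
  fix z assume "z \<in> upper_half_plane"
  then have z: "Im z > 0" by (simp add: upper_half_plane_def)
  define q where "q = nome z"
  let ?t = "\<lambda>d m. (if n div d dvd m then of_nat d * a (d * (m div (n div d))) else 0) * q ^ m"
  have "(\<lambda>m. of_nat n powi (int k - 1) * (\<Sum>d | d dvd n. of_nat d powi (- int k) *
        (?t d m))) sums
      (of_nat n powi (int k - 1) * (\<Sum>d | d dvd n. of_nat d powi (- int k) *
        (\<Sum>b<d. f ((of_nat (n div d) * z + of_nat b) / of_nat d))))"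
    unfolding q_def using n z
    by (intro sums_mult sums_sum hecke_inner_sums) (auto intro!: Nat.gr0I dest: dvd_div_eq_0_iff)
  also have "(\<lambda>m. of_nat n powi (int k - 1) * (\<Sum>d | d dvd n. of_nat d powi (- int k) *
        (?t d m)))
      = (\<lambda>m. hecke_coeff n m * q ^ m)"
  proof
    fix m
    have "of_nat d powi (- int k) * (?t d m)
       = (if n div d dvd m then of_nat d powi (1 - int k) * a (d * (m div (n div d))) else 0) * q ^ m"
       if "d dvd n" for d
    proof -
      have "of_nat d powi (- int k) * of_nat d = (of_nat d powi (1 - int k) :: complex)"
        using that n power_int_add[of "of_nat d :: complex" "- int k" 1] by auto
      then show ?thesis by (simp add: mult.assoc [symmetric])
    qed
    then have "(\<Sum>d | d dvd n. of_nat d powi (- int k) *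
        (?t d m)) =
        (\<Sum>d | d dvd n. (if n div d dvd m then of_nat d powi (1 - int k) * a (d * (m div (n div d))) else 0) * q ^ m)"
      by (intro sum.cong) auto
    then show "of_nat n powi (int k - 1) * (\<Sum>d | d dvd n. of_nat d powi (- int k) *
        (?t d m))
      = hecke_coeff n m * q ^ m"
      unfolding hecke_coeff_def by (simp only: sum_distrib_right mult.assoc)
  qed
  finally show "(\<lambda>m. hecke_coeff n m * nome z ^ m) sums hecke_operator k n f z"
    unfolding q_def hecke_operator_def by (simp add: sum_distrib_left)
qed

lemma hecke_coeff_1:
  assumes "n \<ge> 1"
  shows "hecke_coeff n 1 = a n"
proof -
  have "(\<Sum>d | d dvd n. if n div d dvd 1 then of_nat d powi (1 - int k) * a (d * (1 div (n div d))) else 0)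
     = (\<Sum>d | d dvd n. if d = n then of_nat n powi (1 - int k) * a n else 0)"
    using assms by (intro sum.cong refl) (auto elim!: dvdE split: if_splits)
  also have "\<dots> = of_nat n powi (1 - int k) * a n"
    using assms by simp
  finally show ?thesis
    using assms power_int_add[of "of_nat n :: complex" "int k - 1" "1 - int k"]
    unfolding hecke_coeff_def by (simp flip: mult.assoc)
qed

text \<open>Comparing the coefficients of q^1 identifies the eigenvalue as \<open>a n\<close>, since
  \<open>a 1 = 1\<close>; the remaining coefficients then give the Hecke relations.\<close>

lemma hecke_eigenvalue:
  assumes n: "n \<ge> 1"
  shows "Im z > 0 \<Longrightarrow> hecke_operator k n f z = a n * f z"
    and "hecke_coeff n m = a n * a m"
proof -
  obtain c where c: "\<And>z. z \<in> upper_half_plane \<Longrightarrow> hecke_operator k n f z = c * f z"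
    using eigen[OF n] by blast
  have "has_q_expansion (hecke_operator k n f) (\<lambda>m. c * a m)"
    unfolding has_q_expansion_def
  proof
    fix z assume z: "z \<in> upper_half_plane"
    then have "(\<lambda>m. a m * exp (tpi * of_nat m * z)) sums f z"
      using q_exp unfolding has_q_expansion_def by blast
    from sums_mult[OF this, of c]
    show "(\<lambda>m. c * a m * exp (tpi * of_nat m * z)) sums hecke_operator k n f z"
      using c[OF z] by (simp add: mult.assoc)
  qed
  then have eq: "hecke_coeff n = (\<lambda>m. c * a m)"
    using q_expansion_unique hecke_q_expansion[OF n] by blast
  then have "c = a n" using hecke_coeff_1[OF n] a_1 by simp
  then show "Im z > 0 \<Longrightarrow> hecke_operator k n f z = a n * f z" "hecke_coeff n m = a n * a m"
    using c[of z] eq by (auto simp: upper_half_plane_def)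
qed

lemma coeff_prime_mult:
  assumes p: "prime p"
  shows "a p * a m = a (p * m) + (if p dvd m then of_nat p powi (int k - 1) * a (m div p) else 0)"
proof -
  have p0: "p > 0" "p \<noteq> 1" using p prime_gt_0_nat by auto
  have "{d. d dvd p} = {1, p}" using p by (auto simp: prime_nat_iff)
  then have "hecke_coeff p m = of_nat p powi (int k - 1) *
     (of_nat p powi (1 - int k) * a (p * m) + (if p dvd m then a (m div p) else 0))"
    unfolding hecke_coeff_def using p0 by simp
  also have "\<dots> = a (p * m) + (if p dvd m then of_nat p powi (int k - 1) * a (m div p) else 0)"
    using p0 power_int_add[of "of_nat p :: complex" "int k - 1" "1 - int k"]
    by (simp add: distrib_left flip: mult.assoc)
  finally show ?thesis using hecke_eigenvalue(2)[of p m] p0 by simp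
qed

text \<open>The normalization is chosen so that p^(k - 1) cancels: for m = p l, the power (p m)^((k
  - 1) / 2) equals p^(k - 1) l^((k - 1) / 2).\<close>

lemma lam_prime_mult:
  assumes p: "prime p"
  shows "lam (p * m) = lam p * lam m - (if p dvd m then lam (m div p) else 0)"
proof -
  have p0: "p > 0" using p prime_gt_0_nat by auto
  define h where "h = (real k - 1) / 2"
  have split: "complex_of_real (real (p * m) powr h) = of_real (real p powr h) * of_real (real m powr h)"
    by (simp add: powr_mult)
  have nz: "real p powr h \<noteq> 0" using p0 by simp
  have "lam p * lam m = a p * a m / of_real (real (p * m) powr h)"
    unfolding lam_def h_def[symmetric] split by simp
  also have "\<dots> = lam (p * m) +
      (if p dvd m then of_nat p powi (int k - 1) * a (m div p) else 0) / of_real (real (p * m) powr h)"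
    unfolding coeff_prime_mult[OF p] lam_def h_def[symmetric] by (simp add: add_divide_distrib)
  also have "(if p dvd m then of_nat p powi (int k - 1) * a (m div p) else 0) / of_real (real (p * m) powr h)
      = (if p dvd m then lam (m div p) else 0)"
  proof (cases "p dvd m")
    case True
    then obtain l where l: "m = p * l" by blast
    have "real (p * m) powr h = real p powr (h + h) * real l powr h"
      using p0 unfolding l by (simp only: of_nat_mult powr_mult powr_add mult.assoc)
    also have "real p powr (h + h) = real p powr (of_int (int k - 1))"
      by (simp add: h_def)
    also have "\<dots> = real p powi (int k - 1)" using p0 by (intro powr_real_of_int') auto
    finally have "complex_of_real (real (p * m) powr h) = of_nat p powi (int k - 1) * of_real (real l powr h)"
      by (simp add: of_real_power_int)
    then show ?thesis using p0 by (simp add: l lam_def h_def[symmetric])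
  qed auto
  finally show ?thesis by simp
qed

section \<open>The Dirichlet series, sieving by primes, and a lower bound\<close>

definition Ldir :: "complex \<Rightarrow> complex" where
  "Ldir w = (\<Sum>n. lam n * of_nat n powr (- w))"

lemma norm_nat_powr: "norm ((of_nat n :: complex) powr w) = real n powr Re w"
  by (cases "n = 0") (simp_all add: norm_powr_real_powr)

lemma norm_Ldir_term: "norm (lam n * of_nat n powr (- w)) = norm (lam n) * real n powr (- Re w)"
  by (simp add: norm_mult norm_nat_powr)

lemma Ldir_abs_summable: "Re w > 1 \<Longrightarrow> summable (\<lambda>n. norm (lam n * of_nat n powr (- w)))"
  unfolding norm_Ldir_term by (rule lam_summable)

lemma Ldir_sums: "Re w > 1 \<Longrightarrow> (\<lambda>n. lam n * of_nat n powr (- w)) sums Ldir w"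
  unfolding Ldir_def by (rule summable_sums [OF summable_norm_cancel [OF Ldir_abs_summable]])

abbreviation euler :: "complex \<Rightarrow> nat \<Rightarrow> complex" where
  "euler w p \<equiv> 1 - lam p * of_nat p powr (- w) + (of_nat p powr (- w))\<^sup>2"

definition sifted :: "nat set \<Rightarrow> complex \<Rightarrow> nat \<Rightarrow> complex" where
  "sifted S w n = (if \<forall>p\<in>S. \<not> p dvd n then lam n * of_nat n powr (- w) else 0)"

lemma of_nat_mult_powr: "(of_nat (m * n) :: complex) powr w = of_nat m powr w * of_nat n powr w"
  unfolding of_nat_mult by (rule powr_times_real) auto

text \<open>By the Hecke relation the terms at multiples of p add up to (\<open>lam p\<close> P -
  P^2) X with P = p^(-w); removing them multiplies the sum by the reciprocal Euler factor. As p lies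
  outside S, multiplying an index by p does not change whether it survives the sieve.\<close>

lemma sifted_step:
  assumes S: "\<And>p. p \<in> S \<Longrightarrow> prime p" and p: "prime p" "p \<notin> S"
    and X: "sifted S w sums X"
  shows "sifted (insert p S) w sums (X * euler w p)"
proof -
  have p0: "p > 0" using p prime_gt_0_nat by auto
  define P where "P = (of_nat p :: complex) powr (- w)"
  have cop: "(\<forall>q\<in>S. \<not> q dvd p * m) \<longleftrightarrow> (\<forall>q\<in>S. \<not> q dvd m)" for m
  proof (rule ball_cong[OF refl])
    fix q assume q: "q \<in> S"
    have "q \<noteq> p" using q p(2) by blast
    then have "\<not> q dvd p" using primes_dvd_imp_eq[OF S[OF q] p(1)] by blast
    then show "\<not> q dvd p * m \<longleftrightarrow> \<not> q dvd m" using S[OF q] by (simp add: prime_dvd_mult_iff)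
  qed
  have "(\<lambda>l. P\<^sup>2 * sifted S w l) sums (P\<^sup>2 * X)" by (intro sums_mult X)
  then have "(\<lambda>m. if p dvd m then P\<^sup>2 * sifted S w (m div p) else 0) sums (P\<^sup>2 * X)"
    using sums_reindex_mult[OF p0, of "\<lambda>m. P\<^sup>2 * sifted S w (m div p)"] p0 by simp
  then have "(\<lambda>m. lam p * P * sifted S w m - (if p dvd m then P\<^sup>2 * sifted S w (m div p) else 0)) sums
      (lam p * P * X - P\<^sup>2 * X)"
    by (intro sums_diff sums_mult X)
  also have "(\<lambda>m. lam p * P * sifted S w m - (if p dvd m then P\<^sup>2 * sifted S w (m div p) else 0))
     = (\<lambda>m. sifted S w (p * m))"
  proof
    fix m
    show "lam p * P * sifted S w m - (if p dvd m then P\<^sup>2 * sifted S w (m div p) else 0) = sifted S w (p * m)"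
    proof (cases "p dvd m")
      case True
      then obtain l where l: "m = p * l" by blast
      then show ?thesis
        unfolding sifted_def cop lam_prime_mult[OF p(1)] of_nat_mult_powr P_def[symmetric]
        using p0 cop[of l] lam_prime_mult[OF p(1)]
        by (auto simp: l of_nat_mult_powr P_def[symmetric] power2_eq_square algebra_simps
            simp del: of_nat_mult)
    next
      case False
      then show ?thesis
        unfolding sifted_def cop lam_prime_mult[OF p(1)] of_nat_mult_powr P_def[symmetric]
        by auto
    qed
  qed
  finally have "(\<lambda>n. if p dvd n then sifted S w n else 0) sums (lam p * P * X - P\<^sup>2 * X)"
    using sums_reindex_mult[OF p0, of "sifted S w"] by blast
  then have "(\<lambda>n. sifted S w n - (if p dvd n then sifted S w n else 0)) sums (X - (lam p * P * X - P\<^sup>2 * X))"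
    by (intro sums_diff X)
  also have "(\<lambda>n. sifted S w n - (if p dvd n then sifted S w n else 0)) = sifted (insert p S) w"
    by (auto simp: sifted_def)
  finally show ?thesis by (simp add: P_def algebra_simps)
qed

lemma sifted_sums:
  assumes "finite S" "\<And>p. p \<in> S \<Longrightarrow> prime p" "Re w > 1"
  shows "sifted S w sums (Ldir w * (\<Prod>p\<in>S. euler w p))"
  using assms(1,2)
proof (induction S rule: finite_induct)
  case empty
  then show ?case using Ldir_sums[OF assms(3)] by (simp add: sifted_def)
next
  case (insert p S)
  have "sifted (insert p S) w sums (Ldir w * (\<Prod>p\<in>S. euler w p)
      * euler w p)"
    using insert by (intro sifted_step) auto
  then show ?case using insert.hyps by (simp add: mult_ac)
qed

text \<open>Choose K with a tail below 1/2 on Re w >= c and sieve by the primes below K. Every index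
  strictly between 1 and K disappears, so the sifted series has norm at least 1/2, while the
  finitely many factors multiply to at most B. The result is the bound 1 / (2B).\<close>

lemma Ldir_lower_bound:
  assumes c: "c > 1"
  obtains \<kappa> where "\<kappa> > 0" "\<And>w. Re w \<ge> c \<Longrightarrow> norm (Ldir w) \<ge> \<kappa>"
proof -
  have sm: "summable (\<lambda>n. norm (lam n) * real n powr (- c))" by (rule lam_summable[OF c])
  have "(\<lambda>K. \<Sum>n. norm (lam (n + K)) * real (n + K) powr (- c)) \<longlonglongrightarrow> 0"
    using suminf_exist_split2[of "\<lambda>n. norm (lam n) * real n powr (- c)"] sm by simp
  then have "\<forall>\<^sub>F K in sequentially. (\<Sum>n. norm (lam (n + K)) * real (n + K) powr (- c)) < 1/2"
    by (rule order_tendstoD) simp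
  then obtain K where K: "K \<ge> 2" "(\<Sum>n. norm (lam (n + K)) * real (n + K) powr (- c)) < 1/2"
    unfolding eventually_sequentially by (meson max.cobounded1 max.cobounded2)
  define S where "S = {p. prime p \<and> p < K}"
  have S: "finite S" "\<And>p. p \<in> S \<Longrightarrow> prime p" by (auto simp: S_def)
  define B where "B = (\<Prod>p\<in>S. 2 + norm (lam p))"
  have B: "B > 0" unfolding B_def by (intro prod_pos) (auto intro: add_pos_nonneg)
  show ?thesis
  proof (rule that[of "1 / (2 * B)"])
    show "1 / (2 * B) > 0" using B by simp
    fix w assume w: "Re w \<ge> c"
    then have w1: "Re w > 1" using c by simp
    define X where "X = Ldir w * (\<Prod>p\<in>S. euler w p)"
    have X: "sifted S w sums X" unfolding X_def by (rule sifted_sums[OF S w1])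
    have "sifted S w n = (if n = 1 then 1 else 0)" if "n < K" for n
    proof -
      consider "n = 0" | "n = 1" | "n > 1" by linarith
      then show ?thesis
      proof cases
        case 3
        then obtain p where "prime p" "p dvd n" using prime_factor_nat[of n] by auto
        moreover then have "p \<in> S" using that 3 dvd_imp_le[of p n] by (auto simp: S_def)
        ultimately show ?thesis using 3 by (auto simp: sifted_def)
      qed (auto simp: sifted_def dest: S(2))
    qed
    then have "(\<Sum>n<K. sifted S w n) = (\<Sum>n<K. if n = 1 then 1 else 0)" by (intro sum.cong) auto
    then have "(\<Sum>n<K. sifted S w n) = 1" using K(1) by simp
    then have "X = (\<Sum>n. sifted S w (n + K)) + 1"
      using suminf_split_initial_segment[of "sifted S w" K] X by (simp add: sums_iff)
    moreover have "norm (\<Sum>n. sifted S w (n + K)) \<le> (\<Sum>n. norm (lam (n + K)) * real (n + K) powr (- c))"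
    proof (rule norm_suminf_le)
      show "summable (\<lambda>n. norm (lam (n + K)) * real (n + K) powr (- c))"
        using summable_ignore_initial_segment[OF sm] .
      fix n
      have "real (n + K) powr (- Re w) \<le> real (n + K) powr (- c)"
        using K(1) w by (intro powr_mono) auto
      then have "norm (lam (n + K)) * real (n + K) powr (- Re w) \<le> norm (lam (n + K)) * real (n + K) powr (- c)"
        by (intro mult_left_mono) auto
      then show "norm (sifted S w (n + K)) \<le> norm (lam (n + K)) * real (n + K) powr (- c)"
        unfolding sifted_def using norm_Ldir_term[of "n + K" w] by simp
    qed
    ultimately have "norm X \<ge> 1/2"
      using K(2) norm_triangle_ineq2[of 1 "- (\<Sum>n. sifted S w (n + K))"] by (simp add: add.commute)
    moreover have "norm X \<le> norm (Ldir w) * B"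
    proof -
      have "norm (euler w p) \<le> 2 + norm (lam p)" if "p \<in> S" for p
      proof -
        have "p \<ge> 1" using S(2)[OF that] prime_ge_1_nat by blast
        then have "real p powr (- Re w) \<le> real p powr 0" using w1 by (intro powr_mono) auto
        then have le: "norm ((of_nat p :: complex) powr (- w)) \<le> 1"
          using \<open>p \<ge> 1\<close> by (simp add: norm_nat_powr)
        have "norm (euler w p) \<le>
            norm (1 :: complex) + norm (lam p * of_nat p powr (- w)) + norm (((of_nat p :: complex) powr (- w))\<^sup>2)"
          by (intro order.trans[OF norm_triangle_ineq] add_right_mono norm_triangle_ineq4)
        also have "\<dots> \<le> 1 + norm (lam p) * 1 + 1"
          unfolding norm_mult norm_power using le
          by (intro add_mono mult_left_mono power_le_one) auto
        finally show ?thesis by simp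
      qed
      then show ?thesis unfolding X_def B_def norm_mult prod_norm[symmetric]
        by (intro mult_left_mono prod_mono) auto
    qed
    ultimately show "norm (Ldir w) \<ge> 1 / (2 * B)" using B by (simp add: field_simps)
  qed
qed

end

section \<open>The invariant measure on the upper half plane\<close>

text \<open>The change of variables is carried out on \<open>real ^ 2\<close>; these two maps
  translate between that space and the complex plane.\<close>

definition plane_pt :: "real ^ 2 \<Rightarrow> complex" where
  "plane_pt v = Complex (v $ 1) (v $ 2)"

definition plane_vec :: "complex \<Rightarrow> real ^ 2" where
  "plane_vec z = vector [Re z, Im z]"

lemma plane_pt_vec [simp]: "plane_pt (plane_vec z) = z" "plane_vec (plane_pt v) = v"
  by (simp_all add: plane_pt_def plane_vec_def complex_eq_iff vec_eq_iff forall_2)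

lemma plane_vec_nth [simp]: "plane_vec z $ 1 = Re z" "plane_vec z $ 2 = Im z"
  by (simp_all add: plane_vec_def)

lemma Re_plane_pt [simp]: "Re (plane_pt v) = v $ 1" and Im_plane_pt [simp]: "Im (plane_pt v) = v $ 2"
  by (simp_all add: plane_pt_def)

lemma linear_plane_pt: "linear plane_pt" and linear_plane_vec: "linear plane_vec"
  by (rule linearI; simp add: complex_eq_iff vec_eq_iff forall_2)+

lemma measurable_plane_pt [measurable]: "plane_pt \<in> borel_measurable borel"
  by (intro borel_measurable_continuous_onI linear_continuous_on linear_conv_bounded_linear[THEN iffD1] linear_plane_pt)

definition half_space :: "(real ^ 2) set" where
  "half_space = {v. v $ 2 > 0}"

lemma half_space_eq: "half_space = plane_pt -` upper_half_plane"
  by (auto simp: half_space_def upper_half_plane_def)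

lemma open_half_space: "open half_space"
  unfolding half_space_def by (rule open_Collect_less) (intro continuous_intros)+

lemma mob_iadj:
  assumes "g \<in> imats n" "n > 0" "Im z > 0"
  shows "mob (iadj g) (mob g z) = z" "mob g (mob (iadj g) z) = z"
  using mob_imult[OF assms(1) _ assms(3), of "iadj g"] mob_imult[of "iadj g" n z g] assms
  by (simp_all add: imult_iadj mob_scalar del: mob.simps)

lemma autfac_iadj:
  assumes "g \<in> imats n" "n > 0" "Im z > 0"
  shows "autfac g (mob (iadj g) z) * autfac (iadj g) z = of_int n"
  using autfac_imult[of "iadj g" n z g] assms by (simp add: imult_iadj)

lemma mob_has_field_derivative:
  assumes "g \<in> imats n" "n > 0" "Im z > 0"
  shows "(mob g has_field_derivative of_int n / (autfac g z)\<^sup>2) (at z)"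
proof -
  obtain a b c d where g: "g = (a, b, c, d)" by (metis prod.exhaust)
  have nz: "of_int c * z + of_int d \<noteq> 0" using autfac_nonzero[of g n z] assms g by simp
  have n: "(of_int n :: complex) = of_int a * of_int d - of_int b * of_int c"
    using assms(1) by (auto simp: g imats_def)
  have "((\<lambda>z. (of_int a * z + of_int b) / (of_int c * z + of_int d)) has_field_derivative
      of_int n / (of_int c * z + of_int d)\<^sup>2) (at z)"
    using nz by (auto intro!: derivative_eq_intros simp: n power2_eq_square) (simp add: algebra_simps)
  moreover have "mob g = (\<lambda>z. (of_int a * z + of_int b) / (of_int c * z + of_int d))"
    by (simp add: g fun_eq_iff)
  ultimately show ?thesis by (simp add: g)
qed

lemma det_mult_complex: "det (matrix (\<lambda>h. plane_vec (D * plane_pt h))) = (norm D)\<^sup>2"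
  unfolding cmod_power2 by (simp add: det_2 matrix_def axis_def power2_eq_square)

text \<open>The Jacobian of g is |n / (cz + d)^2|^2, the square of Im(gz) / Im z, which cancels
  against the density 1 / y^2. Determinants n > 1 are included because Hecke matrices are
  substituted later.\<close>

lemma invariant_integral:
  fixes F :: "complex \<Rightarrow> real"
  assumes g: "g \<in> imats n" "n > 0"
    and F: "(\<lambda>v. F (plane_pt v) / (v $ 2)\<^sup>2) absolutely_integrable_on half_space"
  shows "integral half_space (\<lambda>v. F (mob g (plane_pt v)) / (v $ 2)\<^sup>2) =
         integral half_space (\<lambda>v. F (plane_pt v) / (v $ 2)\<^sup>2)"
proof -
  define t where "t v = plane_vec (mob g (plane_pt v))" for v
  define t' where "t' v = (\<lambda>h. plane_vec (of_int n / (autfac g (plane_pt v))\<^sup>2 * plane_pt h))" for v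
  \<comment> \<open>The integrand is wrapped into \<open>real ^ 1\<close> to fit the vector-valued
    change of variables theorem.\<close>
  define G :: "real ^ 2 \<Rightarrow> real ^ 1" where "G v = vec (F (plane_pt v) / (v $ 2)\<^sup>2)" for v
  have G: "G absolutely_integrable_on half_space"
    using F unfolding G_def by (simp add: absolutely_integrable_on_1_iff o_def)
  have der: "(t has_derivative t' v) (at v within half_space)" if "v \<in> half_space" for v
  proof -
    have "Im (plane_pt v) > 0" using that by (simp add: half_space_def)
    from mob_has_field_derivative[OF g this]
    have 1: "(mob g has_derivative (*) (of_int n / (autfac g (plane_pt v))\<^sup>2)) (at (plane_pt v))"
      by (simp add: has_field_derivative_def)
    have 2: "(plane_pt has_derivative plane_pt) (at v within half_space)"
      by (rule linear_imp_has_derivative[OF linear_plane_pt])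
    have 3: "(plane_vec has_derivative plane_vec) (at z)" for z
      by (rule linear_imp_has_derivative[OF linear_plane_vec])
    show ?thesis
      using has_derivative_compose[OF has_derivative_compose[OF 2 1] 3]
      unfolding t_def t'_def by simp
  qed
  have Uv: "v \<in> half_space \<longleftrightarrow> Im (plane_pt v) > 0" for v by (simp add: half_space_def)
  have inj: "inj_on t half_space"
  proof (rule inj_on_inverseI)
    fix v assume "v \<in> half_space"
    then show "plane_vec (mob (iadj g) (plane_pt (t v))) = v"
      using mob_iadj[OF g] by (simp add: t_def Uv)
  qed
  have im: "t ` half_space = half_space"
  proof safe
    fix v assume "v \<in> half_space"
    then show "t v \<in> half_space" using Im_mob_pos[OF g] by (simp add: t_def Uv)
  next
    fix v assume v: "v \<in> half_space"
    then have "v = t (plane_vec (mob (iadj g) (plane_pt v)))"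
      using mob_iadj[OF g] by (simp add: t_def Uv)
    moreover have "plane_vec (mob (iadj g) (plane_pt v)) \<in> half_space"
      using Im_mob_pos[of "iadj g" n] g v by (simp add: Uv)
    ultimately show "v \<in> t ` half_space" by blast
  qed
  have "half_space \<in> sets lebesgue" using open_half_space by (simp add: borel_open)
  then have "integral (t ` half_space) G = integral half_space (\<lambda>v. \<bar>det (matrix (t' v))\<bar> *\<^sub>R G (t v))"
    by (rule integral_change_of_variables[OF _ der inj]) (use G im in auto)
  also have "\<dots> = integral half_space (\<lambda>v. vec (F (mob g (plane_pt v)) / (v $ 2)\<^sup>2))"
  proof (rule integral_cong)
    fix v assume v: "v \<in> half_space"
    have nz: "autfac g (plane_pt v) \<noteq> 0" using autfac_nonzero[OF g(1)] g v by (simp add: Uv)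
    have "Im (mob g (plane_pt v)) = of_int n * v $ 2 / (norm (autfac g (plane_pt v)))\<^sup>2"
      using Im_mob[OF g(1), of "plane_pt v"] by simp
    then have "norm (of_int n / (autfac g (plane_pt v))\<^sup>2) = Im (mob g (plane_pt v)) / v $ 2"
      using nz g(2) v by (simp add: norm_divide norm_power half_space_def)
    moreover have "Im (mob g (plane_pt v)) > 0" using Im_mob_pos[OF g] v by (simp add: Uv)
    ultimately show "\<bar>det (matrix (t' v))\<bar> *\<^sub>R G (t v) = vec (F (mob g (plane_pt v)) / (v $ 2)\<^sup>2)"
      unfolding t'_def det_mult_complex G_def t_def
      by (simp add: vec_eq_iff power_divide)
  qed
  finally have "integral half_space (\<lambda>v. vec (F (plane_pt v) / (v $ 2)\<^sup>2) :: real ^ 1) =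
      integral half_space (\<lambda>v. vec (F (mob g (plane_pt v)) / (v $ 2)\<^sup>2))"
    unfolding im G_def[abs_def] .
  then show ?thesis by (simp add: integral_on_1_eq vec_eq_iff)
qed

lemma ennreal_le_suminf: "f j \<le> (\<Sum>i. f i)" for f :: "nat \<Rightarrow> ennreal"
  using sum_le_suminf[of f "{j}"] by simp

lemma siegel_finite_volume:
  "integrable lborel (\<lambda>v :: real ^ 2. indicator siegel (plane_pt v) / (v $ 2)\<^sup>2 :: real)"
proof (rule integrableI_nonneg)
  have [measurable]: "siegel \<in> sets borel"
    unfolding siegel_def by measurable
  show "(\<lambda>v :: real ^ 2. indicator siegel (plane_pt v) / (v $ 2)\<^sup>2 :: real) \<in> borel_measurable lborel"
    by measurable
  \<comment> \<open>Boxes of area 1/2 on which 1 / y^2 is at most 4 / j^2. The box for j = 0 gets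
    coefficient 4 / 0 = 0, harmless because y >= 1/2 places every point of the Siegel set in a box
    with j >= 1.\<close>
  define B where "B j = cbox (vector [- 1/2, real j / 2] :: real ^ 2) (vector [1/2, real (Suc j) / 2])" for j
  have le: "ennreal (indicator siegel (plane_pt v) / (v $ 2)\<^sup>2) \<le>
      (\<Sum>j. ennreal (4 / (real j)\<^sup>2) * indicator (B j) v)" for v :: "real ^ 2"
  proof (cases "plane_pt v \<in> siegel")
    case True
    then have v: "\<bar>v $ 1\<bar> \<le> 1/2" "v $ 2 \<ge> 1/2" by (auto simp: siegel_def)
    define j where "j = nat \<lfloor>2 * v $ 2\<rfloor>"
    have j: "real j \<le> 2 * v $ 2" "2 * v $ 2 \<le> real (Suc j)" "j \<ge> 1"
      using v unfolding j_def by (simp_all add: le_nat_floor) linarith+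
    have "v \<in> B j" using v j by (auto simp: B_def mem_box_cart forall_2)
    have "(real j)\<^sup>2 \<le> (2 * v $ 2)\<^sup>2" using j by (intro power_mono) auto
    then have "1 / (v $ 2)\<^sup>2 \<le> 4 / (real j)\<^sup>2" using v j by (simp add: field_simps)
    then have "ennreal (indicator siegel (plane_pt v) / (v $ 2)\<^sup>2) \<le> ennreal (4 / (real j)\<^sup>2) * indicator (B j) v"
      using True \<open>v \<in> B j\<close> by (simp add: ennreal_leI)
    also have "\<dots> \<le> (\<Sum>j. ennreal (4 / (real j)\<^sup>2) * indicator (B j) v)"
      by (rule ennreal_le_suminf)
    finally show ?thesis .
  qed auto
  have "(\<integral>\<^sup>+ v. ennreal (indicator siegel (plane_pt v) / (v $ 2)\<^sup>2) \<partial>lborel) \<le>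
      (\<integral>\<^sup>+ v. (\<Sum>j. ennreal (4 / (real j)\<^sup>2) * indicator (B j) v) \<partial>lborel)"
    by (intro nn_integral_mono le)
  also have "\<dots> = (\<Sum>j. ennreal (4 / (real j)\<^sup>2) * emeasure lborel (B j))"
    by (subst nn_integral_suminf) (auto simp: B_def nn_integral_cmult_indicator)
  also have "\<dots> = (\<Sum>j. ennreal (2 / (real j)\<^sup>2))"
  proof (rule suminf_cong)
    fix j
    have "emeasure lborel (B j) = ennreal (measure lborel (B j))"
      unfolding B_def by (rule emeasure_eq_ennreal_measure) (simp add: emeasure_lborel_cbox_eq)
    also have "measure lborel (B j) = 1/2"
    proof -
      have "B j \<noteq> {}" by (auto simp: B_def interval_ne_empty_cart forall_2)
      then show ?thesis unfolding B_def by (simp add: content_cbox_cart UNIV_2 field_simps)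
    qed
    finally have e: "emeasure lborel (B j) = ennreal (1/2)" .
    have "ennreal (4 / (real j)\<^sup>2) * ennreal (1/2) = ennreal (4 / (real j)\<^sup>2 * (1/2))"
      by (rule ennreal_mult [symmetric]) auto
    also have "4 / (real j)\<^sup>2 * (1/2) = 2 / (real j)\<^sup>2" by simp
    finally show "ennreal (4 / (real j)\<^sup>2) * emeasure lborel (B j) = ennreal (2 / (real j)\<^sup>2)"
      unfolding e .
  qed
  also have "\<dots> < \<infinity>"
  proof -
    have "summable (\<lambda>j. 2 * (1 / (real j)\<^sup>2))"
      using inverse_power_summable[of 2, where ?'a = real] by (intro summable_mult) (simp add: divide_inverse)
    then show ?thesis by (subst suminf_ennreal2) auto
  qed
  finally show "(\<integral>\<^sup>+ v. ennreal (indicator siegel (plane_pt v) / (v $ 2)\<^sup>2) \<partial>(lborel :: (real ^ 2) measure)) < \<infinity>" .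
qed auto

text \<open>The integrand is split because f is controlled only on the half plane, where
  \<open>c\<close> is continuous, whereas the weights are merely measurable but defined everywhere
  and cut off by the Siegel set.\<close>

lemma siegel_integrable:
  fixes c w :: "complex \<Rightarrow> real"
  assumes c: "continuous_on upper_half_plane c" and w [measurable]: "w \<in> borel_measurable borel"
    and w0: "\<And>z. z \<notin> siegel \<Longrightarrow> w z = 0" and C: "\<And>z. z \<in> siegel \<Longrightarrow> \<bar>c z * w z\<bar> \<le> C"
  shows "(\<lambda>v. (c (plane_pt v) * w (plane_pt v)) / (v $ 2)\<^sup>2) absolutely_integrable_on half_space"
proof -
  have cm: "(\<lambda>v. indicator half_space v *\<^sub>R c (plane_pt v)) \<in> borel_measurable borel"
  proof (rule borel_measurable_continuous_on_indicator)
    show "half_space \<in> sets borel" using open_half_space by (rule borel_open)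
    show "continuous_on half_space (\<lambda>v. c (plane_pt v))"
      using linear_plane_pt by (intro continuous_on_compose2[OF c] linear_continuous_on)
        (auto simp: half_space_eq linear_conv_bounded_linear)
  qed
  have "integrable lborel (\<lambda>v. (indicator half_space v *\<^sub>R c (plane_pt v)) * w (plane_pt v) / (v $ 2)\<^sup>2)"
  proof (rule Bochner_Integration.integrable_bound)
    show "integrable lborel (\<lambda>v :: real ^ 2. C * (indicator siegel (plane_pt v) / (v $ 2)\<^sup>2))"
      by (intro integrable_mult_right siegel_finite_volume)
    show "(\<lambda>v. (indicator half_space v *\<^sub>R c (plane_pt v)) * w (plane_pt v) / (v $ 2)\<^sup>2) \<in> borel_measurable lborel"
      using cm by measurable
    show "AE v :: real ^ 2 in lborel. norm ((indicator half_space v *\<^sub>R c (plane_pt v)) * w (plane_pt v) / (v $ 2)\<^sup>2)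
        \<le> norm (C * (indicator siegel (plane_pt v) / (v $ 2)\<^sup>2))"
    proof (rule AE_I2)
      fix v :: "real ^ 2"
      show "norm ((indicator half_space v *\<^sub>R c (plane_pt v)) * w (plane_pt v) / (v $ 2)\<^sup>2)
        \<le> norm (C * (indicator siegel (plane_pt v) / (v $ 2)\<^sup>2))"
      proof (cases "plane_pt v \<in> siegel")
        case True
        have "\<bar>c (plane_pt v) * w (plane_pt v)\<bar> \<le> \<bar>C\<bar>" using C[OF True] by linarith
        then show ?thesis using True by (auto simp: indicator_def abs_mult divide_right_mono)
      qed (use w0 in auto)
    qed
  qed
  then have "integrable lebesgue (\<lambda>v. (indicator half_space v *\<^sub>R c (plane_pt v)) * w (plane_pt v) / (v $ 2)\<^sup>2)"
    by (subst integrable_completion) (auto intro: borel_measurable_integrable)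
  then show ?thesis unfolding set_integrable_def
    by (simp add: mult_ac)
qed

section \<open>Reality of the Hecke eigenvalues\<close>

definition siegel_mats :: "int \<Rightarrow> imat set" where
  "siegel_mats n = {g \<in> imats n. \<exists>z\<in>siegel. mob g z \<in> siegel}"

text \<open>Both heights are at least 1/2, so N = |cz + d| satisfies N^2 <= 2ny; with N >= |c| y
  this gives c^2 y <= 2n and bounds c. If c is nonzero, then y <= 2n and N <= 2n, which bounds
  d.\<close>

lemma siegel_mats_lower_bound:
  assumes g: "(a, b, c, d) \<in> imats n" "n > 0" and z: "z \<in> siegel" and w: "mob (a, b, c, d) z \<in> siegel"
  shows "\<bar>c\<bar> \<le> 4 * n" "c \<noteq> 0 \<Longrightarrow> \<bar>d\<bar> \<le> 4 * n"
proof -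
  define y where "y = Im z"
  have y: "y \<ge> 1/2" "\<bar>Re z\<bar> \<le> 1/2" using z by (auto simp: y_def siegel_def)
  define N where "N = norm (of_int c * z + of_int d)"
  have N: "N > 0" using autfac_nonzero[OF g(1), of z] g y by (simp add: N_def y_def)
  have Im: "Im (mob (a, b, c, d) z) = of_int n * y / N\<^sup>2"
    using Im_mob[OF g(1), of z] by (simp add: N_def y_def)
  moreover have "Im (mob (a, b, c, d) z) \<ge> 1/2" using w by (simp only: siegel_def mem_Collect_eq)
  ultimately have "of_int n * y / N\<^sup>2 \<ge> 1/2" by simp
  then have N2: "N\<^sup>2 \<le> 2 * of_int n * y" using N by (simp add: field_simps)
  have "(of_int c * y)\<^sup>2 \<le> N\<^sup>2"
    unfolding N_def cmod_power2 by (simp add: y_def)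
  then have "(of_int c)\<^sup>2 * y * y \<le> 2 * of_int n * y" using N2 by (simp add: power2_eq_square mult_ac)
  then have cy: "(of_int c)\<^sup>2 * y \<le> 2 * of_int n" using y by (simp add: mult_le_cancel_right)
  moreover have "(of_int c)\<^sup>2 * (1/2) \<le> (of_int c)\<^sup>2 * y" using y by (intro mult_left_mono) auto
  ultimately have "real_of_int (c\<^sup>2) \<le> of_int (4 * n)" by simp
  then have c2: "c\<^sup>2 \<le> 4 * n" by linarith
  have "\<bar>c\<bar> \<le> c\<^sup>2"
    using mult_left_mono[of 1 "\<bar>c\<bar>" "\<bar>c\<bar>"] by (cases "c = 0") (auto simp: power2_eq_square)
  then show c4: "\<bar>c\<bar> \<le> 4 * n" using c2 by linarith
  assume "c \<noteq> 0"
  then have "1 \<le> c\<^sup>2" by (simp add: int_one_le_iff_zero_less)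
  then have "real_of_int 1 \<le> of_int (c\<^sup>2)" by linarith
  then have "1 * y \<le> (of_int c)\<^sup>2 * y" using y by (intro mult_right_mono) auto
  then have "y \<le> 2 * of_int n" using cy by linarith
  then have "2 * of_int n * y \<le> 2 * of_int n * (2 * of_int n)" using g(2) by (intro mult_left_mono) auto
  with N2 have "N\<^sup>2 \<le> 2 * of_int n * (2 * of_int n)" by (rule order.trans)
  then have "N\<^sup>2 \<le> (2 * of_int n)\<^sup>2" by (simp add: power2_eq_square)
  then have "N \<le> 2 * of_int n" using power2_le_imp_le[of N "2 * of_int n"] g(2) by auto
  moreover have "\<bar>of_int c * Re z + of_int d\<bar> \<le> N"
    using abs_Re_le_cmod[of "of_int c * z + of_int d"] by (simp add: N_def)
  moreover have "\<bar>of_int c * Re z\<bar> \<le> 2 * of_int n"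
  proof -
    have "\<bar>of_int c * Re z\<bar> \<le> \<bar>of_int c\<bar> * (1/2)" unfolding abs_mult using y by (intro mult_left_mono) auto
    moreover have "real_of_int \<bar>c\<bar> \<le> of_int (4 * n)" using c4 by linarith
    ultimately show ?thesis by simp
  qed
  ultimately have "real_of_int \<bar>d\<bar> \<le> of_int (4 * n)" by simp
  then show "\<bar>d\<bar> \<le> 4 * n" by linarith
qed

text \<open>For c nonzero, the entry a is bounded by applying the previous estimate to the adjugate
  at the point gz, and b follows from the determinant. For c = 0 both diagonal entries divide n, and
  the real parts of z and gz bound b.\<close>

lemma finite_siegel_mats:
  assumes n: "n > 0"
  shows "finite (siegel_mats n)"
proof (rule finite_subset)
  \<comment> \<open>The constant comes from |b| <= |a| |d| + n <= 16 n^2 + n.\<close>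
  define I where "I = {- (17 * n * n) .. 17 * n * n}"
  show "finite (I \<times> I \<times> I \<times> I)" by (simp add: I_def)
  have nn: "4 * n \<le> 17 * n * n" "n \<le> 17 * n * n" using n mult_left_mono[of 1 n "17 * n"] by auto
  show "siegel_mats n \<subseteq> I \<times> I \<times> I \<times> I"
  proof
    fix g assume g: "g \<in> siegel_mats n"
    obtain a b c d where abcd: "g = (a, b, c, d)" by (metis prod.exhaust)
    obtain z where z: "g \<in> imats n" "z \<in> siegel" "mob g z \<in> siegel"
      using g by (auto simp: siegel_mats_def)
    have det: "a * d - b * c = n" using z(1) by (simp add: abcd imats_def)
    show "g \<in> I \<times> I \<times> I \<times> I"
    proof (cases "c = 0")
      case True
      have "a dvd n" "d dvd n" using det True by auto
      then have ad: "\<bar>a\<bar> \<le> n" "\<bar>d\<bar> \<le> n" "d \<noteq> 0" using n dvd_imp_le_int[of n] by auto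
      have "\<bar>Re (mob g z)\<bar> \<le> 1/2" "\<bar>Re z\<bar> \<le> 1/2" using z by (auto simp only: siegel_def mem_Collect_eq)
      then have bb: "\<bar>Re (mob g z) * of_int d\<bar> \<le> 1/2 * \<bar>of_int d\<bar>" "\<bar>of_int a * Re z\<bar> \<le> \<bar>of_int a\<bar> * (1/2)"
        unfolding abs_mult by (intro mult_mono; simp)+
      have "of_int b = Re (mob g z) * of_int d - of_int a * Re z"
        using ad by (simp add: abcd True)
      then have "\<bar>of_int b\<bar> \<le> 1/2 * \<bar>of_int d\<bar> + \<bar>of_int a\<bar> * (1/2 :: real)"
        using bb abs_triangle_ineq4[of "Re (mob g z) * of_int d" "of_int a * Re z"] by linarith
      moreover have "real_of_int \<bar>d\<bar> \<le> of_int n" "real_of_int \<bar>a\<bar> \<le> of_int n" using ad by linarith+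
      ultimately have "real_of_int \<bar>b\<bar> \<le> of_int n" by simp
      then have "\<bar>b\<bar> \<le> n" by linarith
      then show ?thesis using ad nn True by (auto simp: abcd I_def)
    next
      case False
      have cd: "\<bar>c\<bar> \<le> 4 * n" "\<bar>d\<bar> \<le> 4 * n"
        using siegel_mats_lower_bound[of a b c d n z] z n False by (auto simp: abcd)
      have "mob (iadj g) (mob g z) = z" using mob_iadj(1)[OF z(1) n] siegel_Im_pos[OF z(2)] by blast
      then have a: "\<bar>a\<bar> \<le> 4 * n"
        using siegel_mats_lower_bound[of d "- b" "- c" a n "mob g z"] z n False iadj_imats[of g n]
        by (simp add: abcd del: mob.simps)
      have "\<bar>b\<bar> \<le> \<bar>b * c\<bar>" using False mult_left_mono[of 1 "\<bar>c\<bar>" "\<bar>b\<bar>"] by (simp add: abs_mult)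
      also have "\<bar>b * c\<bar> = \<bar>a * d - n\<bar>" using det by (simp add: algebra_simps)
      also have "\<bar>a * d - n\<bar> \<le> \<bar>a\<bar> * \<bar>d\<bar> + n" using n abs_triangle_ineq4[of "a * d" n] by (simp add: abs_mult)
      finally have "\<bar>b\<bar> \<le> \<bar>a\<bar> * \<bar>d\<bar> + n" .
      moreover have "\<bar>a\<bar> * \<bar>d\<bar> \<le> (4 * n) * (4 * n)" using a cd n by (intro mult_mono) auto
      moreover have "4 * n * (4 * n) + n \<le> 17 * n * n" using n mult_left_mono[of 1 n n] by simp
      ultimately have "\<bar>b\<bar> \<le> 17 * n * n" by linarith
      then show ?thesis using a cd nn by (auto simp: abcd I_def)
    qed
  qed
qed

lemma siegel_mats_iadj: "n > 0 \<Longrightarrow> g \<in> siegel_mats n \<Longrightarrow> iadj g \<in> siegel_mats n"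
  unfolding siegel_mats_def using mob_iadj(1) siegel_Im_pos by (smt (verit) iadj_imats mem_Collect_eq)

definition returns :: "complex \<Rightarrow> imat set" where
  "returns z = {g \<in> imats 1. mob g z \<in> siegel}"

text \<open>The number of ways to move a point into the Siegel set is therefore constant on orbits,
  which is what makes the weights add up to 1.\<close>

lemma bij_imult_right:
  assumes "h \<in> imats 1" "Im z > 0"
  shows "bij_betw (\<lambda>g. imult g h) (returns (mob h z)) (returns z)"
proof (rule bij_betw_byWitness[where f' = "\<lambda>g. imult g (iadj h)"])
  have h': "iadj h \<in> imats 1" using assms by simp
  show "\<forall>g\<in>returns (mob h z). imult (imult g h) (iadj h) = g"
    "\<forall>g\<in>returns z. imult (imult g (iadj h)) h = g"
    using imult_iadj[OF assms(1)] by (simp_all add: imult_assoc)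
  show "(\<lambda>g. imult g h) ` returns (mob h z) \<subseteq> returns z"
    using imats_imult[of _ 1 h 1] assms mob_imult[OF assms(1) _ assms(2)]
    by (auto simp: returns_def simp del: mob.simps)
  have "mob (imult g (iadj h)) (mob h z) = mob g z" for g
    using mob_imult[OF h', of "mob h z" g] Im_mob_pos[OF assms(1) _ assms(2)] mob_iadj(1)[OF assms(1) _ assms(2)]
    by simp
  then show "(\<lambda>g. imult g (iadj h)) ` returns z \<subseteq> returns (mob h z)"
    using imats_imult[of _ 1 "iadj h" 1] h' by (auto simp: returns_def simp del: mob.simps)
qed

lemma returns_siegel: "z \<in> siegel \<Longrightarrow> returns z \<subseteq> siegel_mats 1"
  by (auto simp: returns_def siegel_mats_def)

lemma returns_finite_nonempty:
  assumes "Im z > 0"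
  shows "finite (returns z)" "returns z \<noteq> {}"
proof -
  obtain h where h: "h \<in> imats 1" "mob h z \<in> siegel" using siegel_reduction[OF assms] by metis
  then show "returns z \<noteq> {}" unfolding returns_def by blast
  have "finite (returns (mob h z))"
    using returns_siegel[OF h(2)] finite_siegel_mats[of 1] finite_subset by auto
  then show "finite (returns z)" using bij_betw_finite[OF bij_imult_right[OF h(1) assms]] by blast
qed

text \<open>The translates of this weight under the modular group sum to 1, so it replaces a fundamental domain
  in the Petersson inner product.\<close>

definition weight :: "complex \<Rightarrow> real" where
  "weight z = (if z \<in> siegel then 1 / (\<Sum>g\<in>siegel_mats 1. indicator siegel (mob g z)) else 0)"

text \<open>Summing over the fixed finite set \<open>siegel_mats 1\<close> makes
  \<open>weight\<close> visibly measurable; on the Siegel set that sum just counts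
  \<open>returns z\<close>.\<close>

lemma weight_siegel:
  assumes "z \<in> siegel"
  shows "weight z = 1 / card (returns z)"
proof -
  have "(\<Sum>g\<in>siegel_mats 1. indicator siegel (mob g z)) = (\<Sum>g\<in>siegel_mats 1. if g \<in> returns z then 1 else 0 :: real)"
    by (intro sum.cong refl) (auto simp: returns_def siegel_mats_def indicator_def simp del: mob.simps)
  also have "\<dots> = card (siegel_mats 1 \<inter> returns z)"
    using finite_siegel_mats[of 1] by (simp add: sum.If_cases)
  also have "siegel_mats 1 \<inter> returns z = returns z" using returns_siegel[OF assms] by blast
  finally show ?thesis using assms by (simp add: weight_def)
qed

lemma weight_outside: "z \<notin> siegel \<Longrightarrow> weight z = 0"
  by (simp add: weight_def)

lemma weight_nonneg: "weight z \<ge> 0"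
  by (simp add: weight_def sum_nonneg)

lemma weight_le_1: "weight z \<le> 1"
proof (cases "z \<in> siegel")
  case True
  then have "card (returns z) > 0" using returns_finite_nonempty siegel_Im_pos card_gt_0_iff by metis
  then show ?thesis using weight_siegel[OF True] by simp
qed (simp add: weight_def)

lemma weight_lower:
  assumes "z \<in> siegel"
  shows "weight z \<ge> 1 / card (siegel_mats 1)"
proof -
  have "card (returns z) > 0" using returns_finite_nonempty siegel_Im_pos card_gt_0_iff assms by metis
  moreover have "card (returns z) \<le> card (siegel_mats 1)"
    using returns_siegel[OF assms] finite_siegel_mats[of 1] by (intro card_mono) auto
  ultimately show ?thesis unfolding weight_siegel[OF assms] by (intro divide_left_mono) auto
qed

lemma weight_measurable [measurable]: "weight \<in> borel_measurable borel"
proof -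
  have [measurable]: "siegel \<in> sets borel" unfolding siegel_def by measurable
  have [measurable]: "mob g \<in> borel_measurable borel" for g
  proof -
    obtain a b c d where g: "g = (a, b, c, d)" by (metis prod.exhaust)
    have "mob g = (\<lambda>z. (of_int a * z + of_int b) / (of_int c * z + of_int d))" by (simp add: g fun_eq_iff)
    then show ?thesis by simp
  qed
  show ?thesis unfolding weight_def[abs_def] by measurable
qed

text \<open>All summands equal the reciprocal of the number of summands, since
  \<open>returns\<close> has the same size at every point of the orbit.\<close>

lemma weight_partition:
  assumes z: "Im z > 0"
  shows "(\<Sum>g\<in>returns z. weight (mob g z)) = 1"
proof -
  have "weight (mob g z) = 1 / card (returns z)" if g: "g \<in> returns z" for g
    using weight_siegel[of "mob g z"] bij_betw_same_card[OF bij_imult_right[of g z]] g z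
    by (auto simp: returns_def simp del: mob.simps)
  then show ?thesis using returns_finite_nonempty[OF z] by simp
qed

section \<open>Matrices of determinant n modulo the modular group\<close>

text \<open>Upper triangular representatives for left multiplication by the modular group, indexed
  exactly as in the double sum of \<open>hecke_operator\<close>.\<close>

definition hecke_reps :: "nat \<Rightarrow> imat set" where
  "hecke_reps n = (\<lambda>(d, b). (int (n div d), int b, 0, int d)) ` (SIGMA d:{d. d dvd n}. {..<d})"

lemma hecke_reps_iff:
  assumes "n > 0"
  shows "(a, b, c, d) \<in> hecke_reps n \<longleftrightarrow> c = 0 \<and> a * d = int n \<and> 0 < d \<and> 0 \<le> b \<and> b < d"
proof
  assume "(a, b, c, d) \<in> hecke_reps n"
  then show "c = 0 \<and> a * d = int n \<and> 0 < d \<and> 0 \<le> b \<and> b < d"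
    using assms by (auto simp: hecke_reps_def simp flip: of_nat_mult)
next
  assume *: "c = 0 \<and> a * d = int n \<and> 0 < d \<and> 0 \<le> b \<and> b < d"
  then have "int (nat d) dvd int n" by (metis dvd_triv_right int_nat_eq less_imp_le)
  then have dvd: "nat d dvd n" by (simp only: of_nat_dvd_iff)
  have "int (n div nat d) = a" using * by (simp add: zdiv_int) (metis nonzero_mult_div_cancel_right order_less_irrefl)
  then show "(a, b, c, d) \<in> hecke_reps n"
    unfolding hecke_reps_def using * dvd by (intro image_eqI[of _ _ "(nat d, nat b)"]) auto
qed

lemma hecke_reps_imats: "n > 0 \<Longrightarrow> g \<in> hecke_reps n \<Longrightarrow> g \<in> imats (int n)"
  by (cases g) (auto simp: hecke_reps_iff imats_def)

lemma hecke_reps_finite: "n > 0 \<Longrightarrow> finite (hecke_reps n)"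
  unfolding hecke_reps_def by (intro finite_imageI finite_SigmaI) auto

text \<open>Hermite normal form: the gcd e of the first column is the new upper left entry, Bezout
  coefficients complete a column of h, and \<open>t\<close> reduces the upper right entry modulo
  D.\<close>

lemma hecke_reps_cover:
  assumes g: "g \<in> imats (int n)" and n: "n > 0"
  obtains h r where "h \<in> imats 1" "r \<in> hecke_reps n" "g = imult h r"
proof -
  obtain a b c d where abcd: "g = (a, b, c, d)" by (metis prod.exhaust)
  have det: "a * d - b * c = int n" using g by (simp add: abcd imats_def)
  define e where "e = gcd a c"
  have e: "e > 0" using det n by (auto simp: e_def gcd_pos_int)
  obtain a' c' where a': "a = e * a'" "c = e * c'" unfolding e_def by (metis dvdE gcd_dvd1 gcd_dvd2)
  obtain x y where "x * a + y * c = e" using bezout_int[of a c] by (auto simp: e_def)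
  then have "e * (x * a' + y * c') = e * 1" unfolding a' by (simp add: algebra_simps)
  then have xy: "x * a' + y * c' = 1" using e by simp
  define D where "D = a' * d - c' * b"
  have eD: "e * D = int n" using det unfolding a' D_def by (simp add: algebra_simps)
  then have D: "D > 0" using e n by (metis of_nat_0_less_iff zero_less_mult_pos)
  define B where "B = x * b + y * d"
  define t where "t = B div D"
  define h where "h = (a', - y + t * a', c', x + t * c')"
  define r where "r = (e, B mod D, 0 :: int, D)"
  have "h \<in> imats 1" using xy by (simp add: h_def imats_def algebra_simps)
  moreover have "r \<in> hecke_reps n" using eD D n by (simp add: r_def hecke_reps_iff)
  moreover have "g = imult h r"
  proof -
    have BD: "t * D + B mod D = B" by (simp add: t_def)
    have "a' * (B mod D) + (- y + t * a') * D = a' * (t * D + B mod D) - y * D" by (simp add: algebra_simps)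
    also have "\<dots> = (x * a' + y * c') * b" by (simp only: BD) (simp add: B_def D_def algebra_simps)
    finally have 1: "b = a' * (B mod D) + (- y + t * a') * D" using xy by simp
    have "c' * (B mod D) + (x + t * c') * D = c' * (t * D + B mod D) + x * D" by (simp add: algebra_simps)
    also have "\<dots> = (x * a' + y * c') * d" by (simp only: BD) (simp add: B_def D_def algebra_simps)
    finally have 2: "d = c' * (B mod D) + (x + t * c') * D" using xy by simp
    show ?thesis using 1 2 a' by (simp add: abcd h_def r_def mult.commute)
  qed
  ultimately show ?thesis by (rule that)
qed

text \<open>The quotient s of h by h' carries one triangular form to another. Hence it is unipotent,
  and 0 <= x, x' < D leaves no room for a nonzero translation.\<close>

lemma hecke_reps_unique:
  assumes "h \<in> imats 1" "h' \<in> imats 1" "r \<in> hecke_reps n" "r' \<in> hecke_reps n" "n > 0"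
    and eq: "imult h r = imult h' r'"
  shows "h = h' \<and> r = r'"
proof -
  define s where "s = imult (iadj h') h"
  have s: "s \<in> imats 1" using imats_imult[of "iadj h'" 1 h 1] assms by (simp add: s_def)
  have "imult s r = imult (iadj h') (imult h' r')" unfolding s_def imult_assoc eq ..
  then have sr: "imult s r = r'" using imult_iadj(2)[OF assms(2)] by (simp flip: imult_assoc)
  obtain a b c d where sd: "s = (a, b, c, d)" by (metis prod.exhaust)
  obtain e x y D where rd: "r = (e, x, y, D)" by (metis prod.exhaust)
  obtain e' x' y' D' where rd': "r' = (e', x', y', D')" by (metis prod.exhaust)
  have r: "y = 0" "e * D = int n" "0 < D" "0 \<le> x" "x < D"
    and r': "y' = 0" "e' * D' = int n" "0 < D'" "0 \<le> x'" "x' < D'"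
    using assms(3-5) by (auto simp: rd rd' hecke_reps_iff)
  have e: "e > 0" "e' > 0" using r r' assms(5) by (metis of_nat_0_less_iff zero_less_mult_pos2)+
  have eqs: "a * e = e'" "a * x + b * D = x'" "c * e = 0" "c * x + d * D = D'"
    using sr r r' by (auto simp: sd rd rd')
  have c: "c = 0" using eqs e by simp
  have ad: "a * d = 1" using s c by (simp add: sd imats_def)
  have "a > 0" using eqs(1) e by (metis zero_less_mult_pos2)
  then have a: "a = 1" "d = 1" using ad zmult_eq_1_iff by auto
  have D: "D' = D" using eqs c a by simp
  have "x' - x = b * D" using eqs a by simp
  then have "D dvd x' - x" by simp
  then have "x' mod D = x mod D" by (simp add: mod_eq_dvd_iff)
  then have x: "x' = x" using r r' D by simp
  then have b: "b = 0" using \<open>x' - x = b * D\<close> r by simp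
  have s1: "s = (1, 0, 0, 1)" using a b c by (simp add: sd)
  have "imult h' s = h" using imult_iadj(1)[OF assms(2)] by (simp add: s_def flip: imult_assoc)
  then show ?thesis using s1 sr by simp
qed

section \<open>The weighted Petersson product and self-adjointness of the Hecke operators\<close>

context normalized_eigenform
begin

text \<open>The Petersson integrand pairing f transformed by g with f. The power of the determinant
  is left out here and restored as n^(k - 1) in \<open>hecke_petersson\<close>.\<close>

definition petersson_term :: "imat \<Rightarrow> complex \<Rightarrow> complex" where
  "petersson_term g z = f (mob g z) / autfac g z ^ k * cnj (f z) * of_real (Im z ^ k)"

lemma petersson_term_invariant:
  assumes h: "h \<in> imats 1" and g: "g \<in> imats n" "n > 0" and z: "Im z > 0"
  shows "petersson_term (imult h g) z = petersson_term g z"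
proof -
  have w: "Im (mob g z) > 0" using Im_mob_pos[OF g z] .
  have "autfac h (mob g z) \<noteq> 0" using autfac_nonzero[OF h _ w] by simp
  then show ?thesis unfolding petersson_term_def
    using mob_imult[OF g(1) _ z, of h] autfac_imult[OF g(1) _ z, of h] g(2) modular[OF h w]
    by (simp add: power_mult_distrib)
qed

text \<open>Pointwise self-adjointness: moving by the adjugate exchanges the two arguments of f, and
  the cocycle relation for \<open>autfac\<close> with the height formula for \<open>iadj g\<close>
  balances the remaining factors.\<close>

lemma petersson_term_adjoint:
  assumes g: "g \<in> imats n" "n > 0" and z: "Im z > 0"
  shows "petersson_term g (mob (iadj g) z) = cnj (petersson_term (iadj g) z)"
proof -
  define j where "j = autfac (iadj g) z"
  define w where "w = mob (iadj g) z"
  have j: "j \<noteq> 0" using autfac_nonzero[of "iadj g" n z] g z by (simp add: j_def)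
  have 1: "autfac g w = of_int n / j" using autfac_iadj[OF g z] j by (simp add: j_def w_def field_simps)
  have 2: "complex_of_real (Im w) = of_int n * of_real (Im z) / (j * cnj j)"
    using Im_mob[of "iadj g" n z] g unfolding w_def j_def
    by (simp add: complex_norm_square del: of_real_power)
  have 3: "mob g w = z" using mob_iadj(2)[OF g z] by (simp add: w_def)
  show ?thesis
    unfolding petersson_term_def w_def[symmetric] j_def[symmetric] 1 3 of_real_power 2
    using j g(2) by (simp add: power_divide power_mult_distrib field_simps)
qed

text \<open>The square of the norm times n^k is the product of the heights at gz and z, so one
  constant serves all g and all n >= 1.\<close>

lemma petersson_bound:
  obtains C where "\<And>n g z. g \<in> imats n \<Longrightarrow> n > 0 \<Longrightarrow> Im z > 0 \<Longrightarrow> norm (petersson_term g z) \<le> C"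
proof -
  obtain C where C: "C > 0" "\<And>z. Im z > 0 \<Longrightarrow> height z \<le> C"
    using height_bound by metis
  show ?thesis
  proof (rule that[of C])
    fix n :: int and g z assume g: "g \<in> imats n" "n > 0" and z: "Im z > 0"
    define A where "A = height (mob g z)"
    define B where "B = height z"
    have AB: "A \<le> C" "B \<le> C" "A \<ge> 0" "B \<ge> 0"
      using C(2)[OF z] C(2)[OF Im_mob_pos[OF g z]] z Im_mob_pos[OF g z] by (simp_all add: A_def B_def)
    have nz: "norm (autfac g z) > 0" using autfac_nonzero[OF g(1) _ z] g by simp
    have "(norm (petersson_term g z))\<^sup>2 * of_int n ^ k = A * B"
      unfolding A_def B_def Im_mob[OF g(1)] petersson_term_def norm_mult norm_divide norm_power
      using nz z by (simp add: power_mult_distrib power_divide field_simps flip: power_mult)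
        (simp add: norm_power power_mult power2_eq_square mult_ac)
    moreover have "1 \<le> real_of_int n ^ k" using g(2) by (intro one_le_power) auto
    then have "(norm (petersson_term g z))\<^sup>2 * 1 \<le> (norm (petersson_term g z))\<^sup>2 * of_int n ^ k"
      by (intro mult_left_mono) auto
    moreover have "A * B \<le> C * C" using AB by (intro mult_mono) auto
    ultimately have "(norm (petersson_term g z))\<^sup>2 \<le> C\<^sup>2" by (simp add: power2_eq_square)
    then show "norm (petersson_term g z) \<le> C" using power2_le_imp_le[of "norm (petersson_term g z)" C] C(1) by auto
  qed
qed

lemma petersson_continuous:
  assumes g: "g \<in> imats n" "n > 0"
  shows "continuous_on upper_half_plane (petersson_term g)"
proof -
  have fc: "continuous_on upper_half_plane f" using hol holomorphic_on_imp_continuous_on by blast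
  have m: "continuous_on upper_half_plane (mob g)"
    using mob_has_field_derivative[OF g] by (intro continuous_at_imp_continuous_on ballI DERIV_isCont)
      (auto simp: upper_half_plane_def)
  have "continuous_on upper_half_plane (\<lambda>z. f (mob g z))"
    using Im_mob_pos[OF g] by (intro continuous_on_compose2[OF fc m]) (auto simp: upper_half_plane_def)
  moreover have "continuous_on upper_half_plane (autfac g)"
  proof -
    obtain a b c d where gg: "g = (a, b, c, d)" by (metis prod.exhaust)
    have "autfac g = (\<lambda>z. of_int c * z + of_int d)" by (simp add: gg fun_eq_iff)
    then show ?thesis by (simp add: continuous_intros)
  qed
  ultimately show ?thesis unfolding petersson_term_def[abs_def]
    using fc autfac_nonzero[OF g(1)] g(2) by (intro continuous_intros) (auto simp: upper_half_plane_def)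
qed

text \<open>A matrix g with gz in the Siegel set is uniquely h r, with r in
  \<open>hecke_reps n\<close> and h in \<open>returns (mob r z)\<close>. The term depends only on r
  and the weights over h sum to 1, which leaves T_n f. The gain is that, unlike
  \<open>hecke_reps n\<close>, the set \<open>siegel_mats n\<close> is stable under the
  adjugate.\<close>

lemma hecke_petersson:
  assumes n: "n > 0" and z: "z \<in> siegel"
  shows "of_nat n powi (int k - 1) * (\<Sum>g\<in>siegel_mats (int n). petersson_term g z * of_real (weight (mob g z)))
    = a n * of_real (height z)"
proof -
  let ?P = "\<lambda>h r. petersson_term (imult h r) z * of_real (weight (mob (imult h r) z))"
  let ?R = "SIGMA r:hecke_reps n. returns (mob r z)"
  have Imz: "Im z > 0" using siegel_Im_pos[OF z] .
  define T where "T = {g \<in> imats (int n). mob g z \<in> siegel}"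
  have "(\<Sum>g\<in>siegel_mats (int n). petersson_term g z * of_real (weight (mob g z))) =
      (\<Sum>g\<in>T. petersson_term g z * of_real (weight (mob g z)))"
    using finite_siegel_mats[of "int n"] n z
    by (intro sum.mono_neutral_right) (auto simp: T_def siegel_mats_def weight_outside simp del: mob.simps)
  also have "\<dots> = (\<Sum>(r, h)\<in>?R.
      (?P h r))"
  proof -
    have bij: "bij_betw (\<lambda>(r, h). imult h r) ?R T"
    proof (intro bij_betw_imageI)
      have sub: "imult h r \<in> T" if rh: "r \<in> hecke_reps n" "h \<in> returns (mob r z)" for r h
      proof -
        have "r \<in> imats (int n)" "h \<in> imats 1" using rh hecke_reps_imats n by (auto simp: returns_def)
        then show ?thesis
          using imats_imult[of h 1 r "int n"] mob_imult[of r "int n" z h] rh n Imz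
          by (simp add: T_def returns_def del: mob.simps imult.simps)
      qed
      show "inj_on (\<lambda>(r, h). imult h r) ?R"
        using hecke_reps_unique n by (auto simp: inj_on_def returns_def simp del: imult.simps mob.simps)
      show "(\<lambda>(r, h). imult h r) ` ?R = T"
      proof (intro subset_antisym subsetI)
        fix g assume "g \<in> (\<lambda>(r, h). imult h r) ` ?R"
        then show "g \<in> T" using sub by (auto simp del: imult.simps mob.simps)
      next
        fix g assume g: "g \<in> T"
        then have "g \<in> imats (int n)" by (simp add: T_def)
        then obtain h r where hr: "h \<in> imats 1" "r \<in> hecke_reps n" "g = imult h r"
          by (rule hecke_reps_cover[OF _ n])
        have "r \<in> imats (int n)" using hecke_reps_imats hr n by blast
        then have "h \<in> returns (mob r z)"
          using g hr mob_imult[of r "int n" z h] n Imz by (simp add: T_def returns_def del: mob.simps imult.simps)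
        then show "g \<in> (\<lambda>(r, h). imult h r) ` ?R"
          using hr by (intro image_eqI[of _ _ "(r, h)"]) auto
      qed
    qed
    show ?thesis
      by (subst sum.reindex_bij_betw[OF bij, symmetric]) (simp add: case_prod_unfold)
  qed
  also have "\<dots> = (\<Sum>r\<in>hecke_reps n. \<Sum>h\<in>returns (mob r z).
      (?P h r))"
    using hecke_reps_finite[OF n] returns_finite_nonempty Im_mob_pos[OF hecke_reps_imats[OF n]] n Imz
    by (intro sum.Sigma[symmetric]) auto
  also have "\<dots> = (\<Sum>r\<in>hecke_reps n. petersson_term r z)"
  proof (rule sum.cong[OF refl])
    fix r assume r: "r \<in> hecke_reps n"
    then have rn: "r \<in> imats (int n)" using hecke_reps_imats n by blast
    have w: "Im (mob r z) > 0" using Im_mob_pos[OF rn _ Imz] n by simp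
    have "(\<Sum>h\<in>returns (mob r z). (?P h r)) =
       (\<Sum>h\<in>returns (mob r z). petersson_term r z * of_real (weight (mob h (mob r z))))"
      using petersson_term_invariant[OF _ rn _ Imz] mob_imult[OF rn _ Imz] n
      by (intro sum.cong refl) (auto simp: returns_def simp del: mob.simps imult.simps)
    also have "\<dots> = petersson_term r z"
      unfolding sum_distrib_left[symmetric] of_real_sum[symmetric] weight_partition[OF w] by simp
    finally show "(\<Sum>h\<in>returns (mob r z). (?P h r))
       = petersson_term r z" .
  qed
  also have "of_nat n powi (int k - 1) * (\<Sum>r\<in>hecke_reps n. petersson_term r z) =
      hecke_operator k n f z * (cnj (f z) * of_real (Im z ^ k))"
  proof -
    have inj: "inj_on (\<lambda>(d, b). (int (n div d), int b, 0, int d)) (SIGMA d:{d. d dvd n}. {..<d})"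
      by (auto simp: inj_on_def)
    have "(\<Sum>r\<in>hecke_reps n. petersson_term r z) =
        (\<Sum>(d, b)\<in>(SIGMA d:{d. d dvd n}. {..<d}). petersson_term (int (n div d), int b, 0, int d) z)"
      unfolding hecke_reps_def by (subst sum.reindex[OF inj]) (simp add: case_prod_unfold)
    also have "\<dots> = (\<Sum>d | d dvd n. \<Sum>b<d. petersson_term (int (n div d), int b, 0, int d) z)"
      using n by (intro sum.Sigma[symmetric]) auto
    also have "\<dots> = (\<Sum>d | d dvd n. \<Sum>b<d. of_nat d powi (- int k) * f ((of_nat (n div d) * z + of_nat b) / of_nat d))
        * (cnj (f z) * of_real (Im z ^ k))"
      unfolding sum_distrib_right
      by (intro sum.cong refl) (simp add: petersson_term_def power_int_minus field_simps)
    finally show ?thesis by (simp add: hecke_operator_def mult.assoc)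
  qed
  also have "\<dots> = a n * of_real (height z)"
    using hecke_eigenvalue(1)[of n z] n Imz by (simp add: complex_norm_square del: of_real_power)
  finally show ?thesis .
qed

text \<open>The integrand is nonnegative, so a positive minimum on one box is enough. The box has
  area 1 and lies in the Siegel set, where the weight is bounded below, and so high that f has no
  zero in it.\<close>

lemma petersson_norm_pos:
  "integral half_space (\<lambda>v. height (plane_pt v) * weight (plane_pt v) / (v $ 2)\<^sup>2) > 0"
  "(\<lambda>v. height (plane_pt v) * weight (plane_pt v) / (v $ 2)\<^sup>2)
     absolutely_integrable_on half_space"
proof -
  define P where "P v = height (plane_pt v) * weight (plane_pt v) / (v $ 2)\<^sup>2" for v
  have fc: "continuous_on upper_half_plane f" using hol holomorphic_on_imp_continuous_on by blast
  obtain C where C: "C > 0" "\<And>z. Im z > 0 \<Longrightarrow> height z \<le> C"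
    using height_bound by metis
  have int: "P absolutely_integrable_on half_space"
    unfolding P_def
  proof (rule siegel_integrable[where C = C])
    fix z assume "z \<in> siegel"
    then have "Im z > 0" by (rule siegel_Im_pos)
    then have "\<bar>height z * weight z\<bar> \<le> C * 1"
      unfolding abs_mult using C(2)[of z] weight_nonneg[of z] weight_le_1[of z] C(1) by (intro mult_mono) (auto simp: abs_mult)
    then show "\<bar>height z * weight z\<bar> \<le> C" by simp
  qed (auto intro!: continuous_intros fc weight_outside)
  show "(\<lambda>v. height (plane_pt v) * weight (plane_pt v) / (v $ 2)\<^sup>2)
     absolutely_integrable_on half_space" by (rule int[unfolded P_def[abs_def]])
  obtain Y where Y: "\<And>z. Im z \<ge> Y \<Longrightarrow> f z \<noteq> 0" using f_nonzero by metis
  define b where "b = max 1 Y"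
  define K where "K = cbox (vector [- 1/2, b] :: real ^ 2) (vector [1/2, b + 1])"
  have K: "v $ 2 \<ge> b" "plane_pt v \<in> siegel" "v \<in> half_space" if "v \<in> K" for v :: "real ^ 2"
    using that by (auto simp: K_def mem_box_cart forall_2 siegel_def half_space_def b_def)
  define Q where "Q v = height (plane_pt v) / (v $ 2)\<^sup>2" for v
  have "compact K" "K \<noteq> {}" by (auto simp: K_def interval_ne_empty_cart forall_2)
  moreover have "continuous_on K Q" unfolding Q_def
  proof (intro continuous_intros)
    have c: "continuous_on K plane_pt"
      using linear_plane_pt by (intro linear_continuous_on) (auto simp: linear_conv_bounded_linear)
    show "continuous_on K (\<lambda>v. f (plane_pt v))"
      by (rule continuous_on_compose2[OF fc c]) (use K in \<open>auto simp: half_space_eq\<close>)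
    show "continuous_on K plane_pt" by (rule c)
    show "\<forall>v\<in>K. (v $ 2)\<^sup>2 \<noteq> 0" using K by (force simp: half_space_def)
  qed
  ultimately obtain v0 where v0: "v0 \<in> K" "\<And>v. v \<in> K \<Longrightarrow> Q v0 \<le> Q v"
    using continuous_attains_inf by metis
  have Q0: "Q v0 > 0" using Y[of "plane_pt v0"] K[OF v0(1)] by (simp add: Q_def b_def half_space_def)
  have card: "card (siegel_mats 1) > 0"
  proof -
    have "\<i> \<in> siegel" by (simp add: siegel_def)
    then have "(1, 0, 0, 1) \<in> siegel_mats 1" by (auto simp: siegel_mats_def imats_def)
    then show ?thesis using finite_siegel_mats[of 1] by (auto simp: card_gt_0_iff)
  qed
  define m where "m = Q v0 * (1 / card (siegel_mats 1))"
  have m: "m > 0" using Q0 card by (simp add: m_def)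
  have Pnn: "P v \<ge> 0" if "v \<in> half_space" for v
    using that weight_nonneg[of "plane_pt v"] by (simp add: P_def half_space_def)
  have intU: "P integrable_on half_space" using int by (rule absolutely_integrable_on_def[THEN iffD1, THEN conjunct1])
  have KU: "K \<subseteq> half_space" using K by blast
  have intK: "P integrable_on K"
    using absolutely_integrable_on_subcbox[OF int, of "vector [- 1/2, b]" "vector [1/2, b + 1]"] KU
    unfolding K_def[symmetric] by (simp add: absolutely_integrable_on_def)
  have "m * measure lborel K = integral K (\<lambda>_. m)"
    unfolding K_def by (simp add: mult.commute)
  also have "\<dots> \<le> integral K P"
  proof (rule integral_le[OF _ intK])
    show "(\<lambda>_. m) integrable_on K" unfolding K_def by (rule integrable_const)
    fix v assume v: "v \<in> K"
    have "m \<le> Q v * weight (plane_pt v)"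
      unfolding m_def using v0(2)[OF v] weight_lower[OF K(2)[OF v]] Q0 by (intro mult_mono) auto
    also have "\<dots> = P v" by (simp add: P_def Q_def)
    finally show "m \<le> P v" .
  qed
  also have "\<dots> \<le> integral half_space P"
    by (rule integral_subset_le[OF KU intK intU]) (use Pnn in blast)
  finally have le: "m * measure lborel K \<le> integral half_space P" .
  have "measure lborel K = 1"
    using \<open>K \<noteq> {}\<close> unfolding K_def by (simp add: content_cbox_cart UNIV_2)
  with le m have pos: "integral half_space P > 0" by simp
  show "integral half_space (\<lambda>v. height (plane_pt v) * weight (plane_pt v) / (v $ 2)\<^sup>2) > 0"
    by (rule pos[unfolded P_def[abs_def]])
qed

text \<open>Im (a n) times the Petersson norm is a multiple of the sum of all \<open>J g\<close>.
  Substituting the adjugate gives \<open>J g = - J (iadj g)\<close>, and since \<open>iadj\<close>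
  permutes \<open>siegel_mats n\<close>, this sum is its own negative.\<close>

theorem coeff_real: "a n \<in> \<real>"
proof (cases "n = 0")
  case False
  then have n: "n > 0" "int n > 0" by auto
  obtain C where C: "\<And>n g z. g \<in> imats n \<Longrightarrow> n > 0 \<Longrightarrow> Im z > 0 \<Longrightarrow> norm (petersson_term g z) \<le> C"
    using petersson_bound by metis
  \<comment> \<open>The weight at z and the weight at gz trade places under the substitution, so
    \<open>F\<close> is antisymmetric under the adjugate.\<close>
  define F where "F g z = Im (petersson_term g z) * (weight z * weight (mob g z))" for g z
  define J where "J g = integral half_space (\<lambda>v. F g (plane_pt v) / (v $ 2)\<^sup>2)" for g
  have Fint: "(\<lambda>v. F g (plane_pt v) / (v $ 2)\<^sup>2) absolutely_integrable_on half_space"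
    if g: "g \<in> siegel_mats (int n)" for g
    unfolding F_def
  proof (rule siegel_integrable[where C = C])
    have gn: "g \<in> imats (int n)" using g by (simp add: siegel_mats_def)
    show "continuous_on upper_half_plane (\<lambda>z. Im (petersson_term g z))"
      by (intro continuous_intros petersson_continuous[OF gn n(2)])
    obtain a b c d where abcd: "g = (a, b, c, d)" by (metis prod.exhaust)
    have "mob g = (\<lambda>z. (of_int a * z + of_int b) / (of_int c * z + of_int d))" by (simp add: abcd fun_eq_iff)
    then have [measurable]: "mob g \<in> borel_measurable borel" by simp
    show "(\<lambda>z. weight z * weight (mob g z)) \<in> borel_measurable borel" by measurable
    fix z
    show "z \<notin> siegel \<Longrightarrow> weight z * weight (mob g z) = 0" by (simp add: weight_outside)
    assume "z \<in> siegel"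
    then have "\<bar>Im (petersson_term g z)\<bar> \<le> C"
      using C[OF gn n(2), of z] abs_Im_le_cmod[of "petersson_term g z"] siegel_Im_pos by fastforce
    moreover have "weight z * weight (mob g z) \<le> 1 * 1"
      by (intro mult_mono weight_le_1 weight_nonneg) auto
    ultimately have "\<bar>Im (petersson_term g z)\<bar> * (weight z * weight (mob g z)) \<le> C * 1"
      using weight_nonneg[of z] weight_nonneg[of "mob g z"] by (intro mult_mono) auto
    then show "\<bar>Im (petersson_term g z) * (weight z * weight (mob g z))\<bar> \<le> C"
      using weight_nonneg[of z] weight_nonneg[of "mob g z"] by (simp add: abs_mult)
  qed
  have Jadj: "J g = - J (iadj g)" if g: "g \<in> siegel_mats (int n)" for g
  proof -
    have gn: "g \<in> imats (int n)" "iadj g \<in> imats (int n)" using g by (simp_all add: siegel_mats_def)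
    have "J g = integral half_space (\<lambda>v. F g (mob (iadj g) (plane_pt v)) / (v $ 2)\<^sup>2)"
      unfolding J_def using invariant_integral[OF gn(2) n(2) Fint[OF g]] by simp
    also have "\<dots> = integral half_space (\<lambda>v. - (F (iadj g) (plane_pt v) / (v $ 2)\<^sup>2))"
    proof (rule integral_cong)
      fix v assume "v \<in> half_space"
      then have "Im (plane_pt v) > 0" by (simp add: half_space_def)
      then show "F g (mob (iadj g) (plane_pt v)) / (v $ 2)\<^sup>2 = - (F (iadj g) (plane_pt v) / (v $ 2)\<^sup>2)"
        using petersson_term_adjoint[OF gn(1) n(2)] mob_iadj(2)[OF gn(1) n(2)] by (simp add: F_def)
    qed
    also have "\<dots> = - J (iadj g)" by (simp add: J_def)
    finally show ?thesis .
  qed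
  have "(\<Sum>g\<in>siegel_mats (int n). J g) = (\<Sum>g\<in>siegel_mats (int n). - J (iadj g))"
    using Jadj by (intro sum.cong) auto
  also have "\<dots> = - (\<Sum>g\<in>siegel_mats (int n). J (iadj g))" by (simp add: sum_negf)
  also have "(\<Sum>g\<in>siegel_mats (int n). J (iadj g)) = (\<Sum>g\<in>siegel_mats (int n). J g)"
    using siegel_mats_iadj[OF n(2)]
    by (intro sum.reindex_bij_betw bij_betw_byWitness[where f' = iadj]) auto
  finally have J0: "(\<Sum>g\<in>siegel_mats (int n). J g) = 0" by simp
  define P where "P z = height z * weight z" for z
  have pt: "Im (a n) * P z = real n powi (int k - 1) * (\<Sum>g\<in>siegel_mats (int n). F g z)" if "Im z > 0" for z
  proof (cases "z \<in> siegel")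
    case True
    have "complex_of_real (real n powi (int k - 1)) * (\<Sum>g\<in>siegel_mats (int n). petersson_term g z * of_real (weight (mob g z)))
      = a n * of_real (height z)"
      using hecke_petersson[OF n(1) True] by (simp add: of_real_power_int)
    then have "Im (complex_of_real (real n powi (int k - 1)) * (\<Sum>g\<in>siegel_mats (int n). petersson_term g z * of_real (weight (mob g z))))
      = Im (a n * of_real (height z))" by simp
    then have "real n powi (int k - 1) * (\<Sum>g\<in>siegel_mats (int n). Im (petersson_term g z) * weight (mob g z))
      = Im (a n) * (height z)"
      by (simp only: Im_complex_of_real Re_complex_of_real Im_sum times_complex.sel mult_zero_left mult_zero_right
          add_0_right add_0_left)
    then have "real n powi (int k - 1) * (\<Sum>g\<in>siegel_mats (int n). Im (petersson_term g z) * weight (mob g z)) * weight z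
      = Im (a n) * (height z) * weight z" by simp
    then show ?thesis by (simp add: P_def F_def sum_distrib_left sum_distrib_right mult_ac)
  qed (simp add: P_def F_def weight_outside)
  have "Im (a n) * integral half_space (\<lambda>v. P (plane_pt v) / (v $ 2)\<^sup>2) =
      integral half_space (\<lambda>v. Im (a n) * (P (plane_pt v) / (v $ 2)\<^sup>2))"
    by (simp only: integral_mult_right)
  also have "\<dots> = integral half_space (\<lambda>v. real n powi (int k - 1) * (\<Sum>g\<in>siegel_mats (int n). F g (plane_pt v) / (v $ 2)\<^sup>2))"
  proof (rule integral_cong)
    fix v assume "v \<in> half_space"
    then have "Im (plane_pt v) > 0" by (simp add: half_space_def)
    from pt[OF this] show "Im (a n) * (P (plane_pt v) / (v $ 2)\<^sup>2) =
      real n powi (int k - 1) * (\<Sum>g\<in>siegel_mats (int n). F g (plane_pt v) / (v $ 2)\<^sup>2)"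
      by (simp add: sum_divide_distrib[symmetric])
  qed
  also have "\<dots> = real n powi (int k - 1) * (\<Sum>g\<in>siegel_mats (int n). J g)"
    unfolding J_def integral_mult_right using Fint finite_siegel_mats[OF n(2)]
    by (subst integral_sum) (auto simp: absolutely_integrable_on_def)
  finally have "Im (a n) = 0"
    using J0 petersson_norm_pos(1) by (simp add: P_def)
  then show ?thesis by (simp add: complex_is_Real_iff)
qed (simp add: a_0)

end

section \<open>The Mellin transform in exponential coordinates\<close>

text \<open>Continuity supplies Borel measurability, so that the Lebesgue integrability given by the
  change of variables passes to \<open>lborel\<close>.\<close>

lemma integral_exp_substitution_real:
  fixes h :: "real \<Rightarrow> real"
  assumes h: "h absolutely_integrable_on {0<..}" and c: "continuous_on {0<..} h"
  shows "has_bochner_integral lborel (\<lambda>u. exp u * h (exp u)) (integral {0<..} h)"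
proof -
  have r: "range (exp :: real \<Rightarrow> real) = {0<..}"
    by (auto simp: image_iff) (metis exp_ln)
  have cont: "continuous_on UNIV (\<lambda>u. exp u * h (exp u))"
    by (intro continuous_intros continuous_on_compose2[OF c]) auto
  have "(\<lambda>u. \<bar>exp u\<bar> * h (exp u)) absolutely_integrable_on UNIV \<and>
      integral UNIV (\<lambda>u. \<bar>exp u\<bar> * h (exp u)) = integral {0<..} h"
    by (subst has_absolute_integral_change_of_variables_1'[where g = exp and g' = exp and f = h])
       (use h in \<open>auto simp: r inj_on_def intro!: derivative_eq_intros\<close>)
  then have 1: "(\<lambda>u. exp u * h (exp u)) absolutely_integrable_on UNIV"
      "integral UNIV (\<lambda>u. exp u * h (exp u)) = integral {0<..} h" by auto
  have "(\<lambda>u. exp u * h (exp u)) \<in> borel_measurable lborel"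
    using cont by (simp add: borel_measurable_continuous_onI)
  then have 2: "integrable lborel (\<lambda>u. exp u * h (exp u))"
    using 1(1) by (subst integrable_completion[symmetric]) (simp_all add: set_integrable_def)
  moreover have "integral\<^sup>L lborel (\<lambda>u. exp u * h (exp u)) = integral {0<..} h"
    using integral_lborel[OF 2] 1(2) by simp
  ultimately show ?thesis by (simp add: has_bochner_integral_iff)
qed

lemma gamma_integral_exp_1:
  assumes s: "Re s > 0"
  shows "has_bochner_integral lborel (\<lambda>u. exp (s * of_real u) * of_real (exp (- exp u))) (Gamma s)"
proof -
  define \<phi> where "\<phi> t = complex_of_real t powr (s - 1) / of_real (exp t)" for t
  have "\<phi> absolutely_integrable_on {0<..}"
    unfolding \<phi>_def using absolutely_integrable_Gamma_integral'[OF s] .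
  \<comment> \<open>Real and imaginary parts are handled separately because the substitution lemma
    is stated for real integrands.\<close>
  then have int: "(\<lambda>t. Re (\<phi> t)) absolutely_integrable_on {0<..}" "(\<lambda>t. Im (\<phi> t)) absolutely_integrable_on {0<..}"
    unfolding set_integrable_def by (force dest: integrable_Re integrable_Im)+
  have cont: "continuous_on {0<..} \<phi>"
    unfolding \<phi>_def by (intro continuous_intros) auto
  have G: "(\<phi> has_integral Gamma s) {0<..}"
    using Gamma_integral_complex'[OF s] unfolding \<phi>_def[abs_def] .
  have ReIm: "integral {0<..} (\<lambda>t. Re (\<phi> t)) = Re (Gamma s)" "integral {0<..} (\<lambda>t. Im (\<phi> t)) = Im (Gamma s)"
    using has_integral_Re[OF G] has_integral_Im[OF G] by (auto simp: integral_unique)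
  have "has_bochner_integral lborel (\<lambda>u. of_real (exp u * Re (\<phi> (exp u))) + \<i> * of_real (exp u * Im (\<phi> (exp u))))
      (of_real (Re (Gamma s)) + \<i> * of_real (Im (Gamma s)))"
    unfolding ReIm[symmetric]
    by (intro has_bochner_integral_add has_bochner_integral_of_real has_bochner_integral_mult_right
        integral_exp_substitution_real int continuous_intros cont)
  also have "(\<lambda>u. of_real (exp u * Re (\<phi> (exp u))) + \<i> * of_real (exp u * Im (\<phi> (exp u)))) =
      (\<lambda>u. of_real (exp u) * \<phi> (exp u))"
    by (simp add: fun_eq_iff complex_eq_iff)
  also have "\<dots> = (\<lambda>u. exp (s * of_real u) * of_real (exp (- exp u)))"
  proof
    fix u :: real
    have "complex_of_real (exp u) powr (s - 1) = exp ((s - 1) * of_real u)"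
      by (simp add: powr_def Ln_of_real)
    moreover have "complex_of_real (exp u) * exp ((s - 1) * of_real u) = exp (s * of_real u)"
      unfolding exp_of_real[symmetric] exp_add[symmetric] by (simp add: algebra_simps)
    ultimately show "of_real (exp u) * \<phi> (exp u) = exp (s * of_real u) * of_real (exp (- exp u))"
      by (simp add: \<phi>_def exp_minus divide_inverse flip: mult.assoc)
  qed
  finally show ?thesis unfolding complex_eq[of "Gamma s", symmetric] .
qed

text \<open>In the coordinate u, scaling by x is translation by ln x.\<close>

lemma gamma_integral_exp:
  assumes s: "Re s > 0" and x: "x > 0"
  shows "has_bochner_integral lborel (\<lambda>u. exp (s * of_real u) * of_real (exp (- (x * exp u))))
     (Gamma s * of_real x powr (- s))"
proof -
  let ?g = "\<lambda>u. exp (s * of_real (ln x + 1 * u)) * of_real (exp (- exp (ln x + 1 * u)))"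
  have "has_bochner_integral lborel (\<lambda>u. (?g u)) (Gamma s)"
    using gamma_integral_exp_1[OF s]
      lborel_integral_real_affine[of 1 "\<lambda>u. exp (s * of_real u) * of_real (exp (- exp u))" "ln x"]
      lborel_integrable_real_affine[of "\<lambda>u. exp (s * of_real u) * of_real (exp (- exp u))" 1 "ln x"]
    by (simp add: has_bochner_integral_iff)
  then have "has_bochner_integral lborel
      (\<lambda>u. of_real x powr (- s) * (?g u))
      (of_real x powr (- s) * Gamma s)"
    by (rule has_bochner_integral_mult_right)
  also have "(\<lambda>u. of_real x powr (- s) * (?g u)) =
      (\<lambda>u. exp (s * of_real u) * of_real (exp (- (x * exp u))))"
  proof
    fix u
    have "of_real x powr (- s) * exp (s * of_real (ln x + 1 * u)) = exp (s * of_real u)"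
      using x by (simp add: powr_def Ln_of_real algebra_simps flip: exp_add)
    moreover have "exp (ln x + 1 * u) = x * exp u" using x by (simp add: exp_add)
    ultimately show "of_real x powr (- s) * (?g u) =
        exp (s * of_real u) * of_real (exp (- (x * exp u)))"
      by (simp only: mult.assoc [symmetric])
  qed
  finally show ?thesis by (simp add: mult.commute)
qed

text \<open>Expanding the exponential and integrating termwise gives a power series that converges
  for every z, with the moments of \<open>g\<close> as coefficients.\<close>

lemma two_sided_laplace_entire:
  fixes g :: "real \<Rightarrow> complex"
  assumes int: "\<And>R. R > 0 \<Longrightarrow> integrable lborel (\<lambda>u. norm (g u) * exp (R * \<bar>u\<bar>))"
    and [measurable]: "g \<in> borel_measurable borel"
  shows "(\<lambda>z. \<integral>u. g u * exp (z * of_real u) \<partial>lborel) holomorphic_on UNIV"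
proof -
  define c where "c n = (\<integral>u. g u * of_real u ^ n / fact n \<partial>lborel)" for n
  have sums: "(\<lambda>n. c n * (z - 0) ^ n) sums (\<integral>u. g u * exp (z * of_real u) \<partial>lborel)" for z
  proof -
    define h where "h n u = g u * (z * of_real u) ^ n / fact n" for n u
    \<comment> \<open>The summand 1 keeps the rate positive at z = 0, as \<open>int\<close>
      demands.\<close>
    define G where "G u = norm (g u) * exp ((norm z + 1) * \<bar>u\<bar>)" for u
    have G: "integrable lborel G" unfolding G_def by (rule int) (simp add: add_nonneg_pos)
    have hs: "(\<lambda>n. norm (h n u)) sums (norm (g u) * exp (norm z * \<bar>u\<bar>))" for u
    proof -
      have "(\<lambda>n. norm (g u) * ((norm z * \<bar>u\<bar>) ^ n / fact n)) sums (norm (g u) * exp (norm z * \<bar>u\<bar>))"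
        using exp_converges[of "norm z * \<bar>u\<bar>"] by (intro sums_mult) (simp add: divide_inverse mult.commute)
      then show ?thesis by (simp add: h_def norm_mult norm_divide norm_power mult.assoc)
    qed
    have le: "norm (g u) * exp (norm z * \<bar>u\<bar>) \<le> G u" for u
      unfolding G_def by (intro mult_left_mono) (auto simp: mult_right_mono)
    have part: "(\<Sum>n<N. norm (h n u)) \<le> G u" for N u
      using sum_le_suminf[OF sums_summable[OF hs[of u]], of "{..<N}"] hs[of u] le[of u]
      by (simp add: sums_iff)
    have hle: "norm (h n u) \<le> G u" for n u
      using part[where N="Suc n" and u=u] sum_nonneg[of "{..<n}" "\<lambda>n. norm (h n u)"] by simp
    have [measurable]: "h n \<in> borel_measurable borel" for n unfolding h_def by measurable
    have hint: "integrable lborel (h n)" for n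
      by (rule Bochner_Integration.integrable_bound[OF G]) (auto intro!: AE_I2 order.trans[OF hle])
    have sm: "summable (\<lambda>n. \<integral>u. norm (h n u) \<partial>lborel)"
    proof (rule summableI_nonneg_bounded)
      fix N
      have "(\<Sum>n<N. \<integral>u. norm (h n u) \<partial>lborel) = (\<integral>u. (\<Sum>n<N. norm (h n u)) \<partial>lborel)"
        by (rule Bochner_Integration.integral_sum[symmetric]) (intro integrable_norm hint)
      also have "\<dots> \<le> (\<integral>u. G u \<partial>lborel)"
        by (intro integral_mono G part Bochner_Integration.integrable_sum integrable_norm hint)
      finally show "(\<Sum>n<N. \<integral>u. norm (h n u) \<partial>lborel) \<le> (\<integral>u. G u \<partial>lborel)" .
    qed simp
    have "(\<lambda>n. \<integral>u. h n u \<partial>lborel) sums (\<integral>u. (\<Sum>n. h n u) \<partial>lborel)"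
      by (rule sums_integral[OF hint _ sm]) (use hs in \<open>auto simp: sums_iff\<close>)
    also have "(\<lambda>n. \<integral>u. h n u \<partial>lborel) = (\<lambda>n. c n * (z - 0) ^ n)"
    proof
      fix n
      have "(\<lambda>u. h n u) = (\<lambda>u. (g u * of_real u ^ n / fact n) * z ^ n)"
        by (simp add: h_def power_mult_distrib fun_eq_iff)
      then show "(\<integral>u. h n u \<partial>lborel) = c n * (z - 0) ^ n" by (simp add: c_def)
    qed
    also have "(\<lambda>u. \<Sum>n. h n u) = (\<lambda>u. g u * exp (z * of_real u))"
    proof
      fix u
      have "(\<lambda>n. g u * ((z * of_real u) ^ n / fact n)) sums (g u * exp (z * of_real u))"
        using exp_converges[of "z * of_real u"]
        by (intro sums_mult) (simp add: scaleR_conv_of_real divide_inverse mult.commute)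
      then show "(\<Sum>n. h n u) = g u * exp (z * of_real u)"
        by (simp add: h_def sums_iff)
    qed
    finally show ?thesis .
  qed
  have "(\<lambda>z. \<integral>u. g u * exp (z * of_real u) \<partial>lborel) holomorphic_on ball 0 r" for r
    by (rule power_series_holomorphic[where a = c]) (use sums in simp)
  then show ?thesis
    by (meson UNIV_I centre_in_ball dist_0_norm holomorphic_on_imp_differentiable_at holomorphic_onI
        field_differentiable_at_within mem_ball open_ball less_add_one)
qed

context normalized_form
begin

text \<open>The coordinate y = exp u and the factor y^(k/2) turn the inversion z -> -1/z into the
  reflection u -> -u, up to the constant i^k.\<close>

definition imag_axis :: "real \<Rightarrow> complex" where
  "imag_axis u = f (\<i> * of_real (exp u)) * of_real (exp (u * (real k / 2)))"

lemma imag_axis_reflect: "imag_axis (- u) = \<i> ^ k * imag_axis u"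
proof -
  have "f (mob (0, -1, 1, 0) (\<i> * of_real (exp u))) = autfac (0, -1, 1, 0) (\<i> * of_real (exp u)) ^ k * f (\<i> * of_real (exp u))"
    by (rule modular) (auto simp: imats_def)
  moreover have "mob (0, -1, 1, 0) (\<i> * of_real (exp u)) = \<i> * of_real (exp (- u))"
    by (simp add: exp_minus field_simps)
  moreover have "exp u ^ k * exp (- u * (real k / 2)) = exp (u * (real k / 2))"
    by (simp add: exp_of_nat_mult[symmetric] exp_add[symmetric])
  then have "complex_of_real (exp u) ^ k * of_real (exp (- u * (real k / 2))) = of_real (exp (u * (real k / 2)))"
    by (metis of_real_mult of_real_power)
  ultimately show ?thesis unfolding imag_axis_def
    by (simp add: power_mult_distrib mult_ac)
qed

lemma norm_imag_axis_minus: "norm (imag_axis (- u)) = norm (imag_axis u)"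
  by (simp add: imag_axis_reflect norm_mult norm_power)

lemma imag_axis_measurable [measurable]: "imag_axis \<in> borel_measurable borel"
proof -
  have "continuous_on UNIV imag_axis" unfolding imag_axis_def[abs_def]
    by (intro continuous_intros continuous_on_compose2[OF holomorphic_on_imp_continuous_on[OF hol]])
       (auto simp: upper_half_plane_def)
  then show ?thesis by (rule borel_measurable_continuous_onI)
qed

text \<open>For u >= 0 the cusp decay is doubly exponential in u and dominated by a Gamma integrand;
  the reflection transfers this to u < 0.\<close>

lemma imag_axis_integrable:
  assumes R: "R > 0"
  shows "integrable lborel (\<lambda>u. norm (imag_axis u) * exp (R * \<bar>u\<bar>))"
proof -
  obtain C where C: "C > 0" "\<And>z. Im z \<ge> 1/2 \<Longrightarrow> norm (f z) \<le> C * exp (- 2 * pi * Im z)"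
    using f_bound by metis
  define s where "s = real k / 2 + R"
  define B where "B u = C * (exp (s * u) * exp (- exp u))" for u
  have "integrable lborel (\<lambda>u. norm (exp (of_real s * complex_of_real u) * of_real (exp (- exp u))))"
    using gamma_integral_exp_1[of "of_real s"] R by (intro integrable_norm) (simp add: s_def has_bochner_integral_iff)
  then have B: "integrable lborel B" unfolding B_def
    by (intro integrable_mult_right) (simp add: norm_mult)
  have B': "integrable lborel (\<lambda>u. B (- u))"
    using lborel_integrable_real_affine[OF B, of "-1" 0] by simp
  have le0: "norm (imag_axis u) * exp (R * \<bar>u\<bar>) \<le> B u" if u: "u \<ge> 0" for u
  proof -
    have "1 \<le> exp u" using u by simp
    then have "1/2 \<le> exp u" by linarith
    then have "norm (f (\<i> * of_real (exp u))) \<le> C * exp (- 2 * pi * exp u)"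
      using C(2)[of "\<i> * of_real (exp u)"] by simp
    also have "\<dots> \<le> C * exp (- exp u)" using C(1) pi_ge_two by (intro mult_left_mono) auto
    finally have "norm (imag_axis u) * exp (R * \<bar>u\<bar>) \<le> C * exp (- exp u) * exp (u * (real k / 2)) * exp (R * \<bar>u\<bar>)"
      unfolding imag_axis_def norm_mult by (intro mult_right_mono) auto
    also have "\<dots> = B u" using u by (simp add: B_def s_def algebra_simps flip: exp_add)
    finally show ?thesis .
  qed
  have Bnn: "B u \<ge> 0" for u using C(1) by (simp add: B_def)
  show ?thesis
  proof (rule Bochner_Integration.integrable_bound)
    show "integrable lborel (\<lambda>u. B u + B (- u))" using B B' by simp
    show "(\<lambda>u. norm (imag_axis u) * exp (R * \<bar>u\<bar>)) \<in> borel_measurable lborel" by measurable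
    show "AE u in lborel. norm (norm (imag_axis u) * exp (R * \<bar>u\<bar>)) \<le> norm (B u + B (- u))"
    proof (rule AE_I2)
      fix u :: real
      show "norm (norm (imag_axis u) * exp (R * \<bar>u\<bar>)) \<le> norm (B u + B (- u))"
        using le0[of u] le0[of "- u"] norm_imag_axis_minus[of u] Bnn[of u] Bnn[of "- u"]
        by (cases "u \<ge> 0") auto
    qed
  qed
qed

text \<open>The completed L-function, centred: the variable is z = s - 1/2, so the functional
  equation becomes z -> -z.\<close>

definition Mellin :: "complex \<Rightarrow> complex" where
  "Mellin z = (\<integral>u. imag_axis u * exp (z * of_real u) \<partial>lborel)"

lemma Mellin_entire: "Mellin holomorphic_on UNIV"
  unfolding Mellin_def[abs_def] by (rule two_sided_laplace_entire[OF imag_axis_integrable]) auto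

lemma Mellin_reflect: "Mellin (- z) = \<i> ^ k * Mellin z"
proof -
  have "Mellin (- z) = \<bar>- 1 :: real\<bar> *\<^sub>R (\<integral>u. imag_axis (0 + - 1 * u) * exp (- z * of_real (0 + - 1 * u)) \<partial>lborel)"
    unfolding Mellin_def by (rule lborel_integral_real_affine) simp
  also have "\<dots> = (\<integral>u. \<i> ^ k * (imag_axis u * exp (z * of_real u)) \<partial>lborel)"
    by (simp add: imag_axis_reflect mult.assoc)
  finally show ?thesis by (simp add: Mellin_def)
qed

end

section \<open>Analytic continuation and the functional equation\<close>

context normalized_eigenform
begin

text \<open>Termwise integration of the q-expansion on the imaginary axis. The exponent s + (k - 1)
  / 2 is both (s - 1/2) + k/2, as it arises from \<open>imag_axis\<close>, and the one that turns
  \<open>a n\<close> into \<open>lam n\<close>.\<close>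

lemma Mellin_Dirichlet:
  assumes s: "Re s > 1"
  shows "Mellin (s - 1/2) = of_real (2 * pi) powr (- (s + half_wt)) *
     Gamma (s + half_wt) * Ldir s"
proof -
  define s' where "s' = s + half_wt"
  have s': "Re s' > 0" using s by (simp add: s'_def field_simps)
  let ?B = "\<lambda>n. norm (Gamma (complex_of_real (Re s'))) * (2 * pi) powr (- Re s') * norm (lam n * of_nat n powr (- s))"
  let ?G = "\<lambda>x u. (exp (s' * of_real u) * of_real (exp (- (x * exp u))))"
  define h where "h n u = a n * (exp (s' * of_real u) * of_real (exp (- (2 * pi * real n * exp u))))" for n u
  define t where "t n = of_real (2 * pi) powr (- s') * Gamma s' * (lam n * of_nat n powr (- s))" for n
  have coeff: "a n * of_real (2 * pi * real n) powr (- s') = of_real (2 * pi) powr (- s') * (lam n * of_nat n powr (- s))" for n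
  proof (cases "n = 0")
    case False
    have "complex_of_real (2 * pi * real n) powr (- s') = of_real (2 * pi) powr (- s') * of_nat n powr (- s')"
      unfolding of_real_mult[of "2 * pi"] of_real_of_nat_eq by (rule powr_times_real) auto
    moreover have "(of_nat n :: complex) powr (- s') = of_nat n powr (- s) / of_real (real n powr ((real k - 1) / 2))"
    proof -
      have "(of_nat n :: complex) powr (- s') = of_nat n powr (- s) * of_real (real n) powr (of_real (- ((real k - 1) / 2)))"
        by (simp add: s'_def powr_def algebra_simps flip: exp_add)
      also have "complex_of_real (real n) powr (of_real (- ((real k - 1) / 2))) = of_real (real n powr (- ((real k - 1) / 2)))"
        by (rule powr_of_real) auto
      also have "real n powr (- ((real k - 1) / 2)) = 1 / real n powr ((real k - 1) / 2)"
        by (rule powr_minus_divide)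
      finally show ?thesis by simp
    qed
    ultimately show ?thesis using False by (simp add: lam_def)
  qed (simp add: a_0)
  have hint: "has_bochner_integral lborel (h n) (t n)" for n
  proof (cases "n = 0")
    case True
    then have "h n = (\<lambda>_. 0)" "t n = 0" by (simp_all add: h_def t_def a_0 fun_eq_iff)
    then show ?thesis by (simp add: has_bochner_integral_zero)
  next
    case False
    have "has_bochner_integral lborel (h n) (a n * (Gamma s' * of_real (2 * pi * real n) powr (- s')))"
      unfolding h_def using False
      by (intro has_bochner_integral_mult_right gamma_integral_exp[OF s', of "2 * pi * real n"]) simp
    also have "a n * (Gamma s' * of_real (2 * pi * real n) powr (- s')) = t n"
      using coeff[of n] by (simp add: t_def mult_ac)
    finally show ?thesis .
  qed
  have hnorm: "(\<integral>u. norm (h n u) \<partial>lborel) \<le> ?B n" for n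
  proof (cases "n = 0")
    case True
    then show ?thesis by (simp add: h_def a_0)
  next
    case False
    define x where "x = 2 * pi * real n"
    have x: "x > 0" using False by (simp add: x_def)
    have "has_bochner_integral lborel (\<lambda>u. exp (of_real (Re s') * complex_of_real u) * of_real (exp (- (x * exp u))))
        (Gamma (of_real (Re s')) * of_real x powr (- of_real (Re s')))"
      using s' x by (intro gamma_integral_exp) auto
    also have "(\<lambda>u. exp (of_real (Re s') * complex_of_real u) * of_real (exp (- (x * exp u)))) =
       (\<lambda>u. complex_of_real (norm (?G x u)))"
      by (simp add: norm_mult flip: exp_of_real)
    finally have "complex_of_real (\<integral>u. norm (?G x u) \<partial>lborel)
        = Gamma (of_real (Re s')) * of_real x powr (- of_real (Re s'))"
      by (simp add: has_bochner_integral_iff)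
    then have "norm (complex_of_real (\<integral>u. norm (?G x u) \<partial>lborel))
        = norm (Gamma (complex_of_real (Re s'))) * x powr (- Re s')"
      using x by (simp add: norm_mult norm_powr_real_powr)
    then have I: "(\<integral>u. norm (?G x u) \<partial>lborel)
        = norm (Gamma (complex_of_real (Re s'))) * x powr (- Re s')"
      by simp
    have "(\<integral>u. norm (h n u) \<partial>lborel) = norm (a n) * (norm (Gamma (complex_of_real (Re s'))) * x powr (- Re s'))"
      unfolding I[symmetric] h_def x_def[symmetric] norm_mult[of "a n"] by simp
    also have "norm (a n) * x powr (- Re s') = norm (a n * of_real x powr (- s'))"
      using x by (simp add: norm_mult norm_powr_real_powr)
    then have "norm (a n) * (norm (Gamma (complex_of_real (Re s'))) * x powr (- Re s')) =
        norm (Gamma (complex_of_real (Re s'))) * norm (a n * of_real x powr (- s'))" by simp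
    also have "norm (a n * of_real x powr (- s')) = (2 * pi) powr (- Re s') * norm (lam n * of_nat n powr (- s))"
      unfolding x_def coeff by (simp add: norm_mult norm_powr_real_powr)
    finally show ?thesis by (simp add: mult.assoc)
  qed
  have sm: "summable (\<lambda>n. \<integral>u. norm (h n u) \<partial>lborel)"
  proof (rule summable_comparison_test')
    show "summable (\<lambda>n. ?B n)"
      by (intro summable_mult Ldir_abs_summable s)
    fix n
    show "norm (\<integral>u. norm (h n u) \<partial>lborel) \<le> ?B n"
      using hnorm[of n] by simp
  qed
  have q: "tpi * of_nat n * (\<i> * of_real (exp u)) = complex_of_real (- (2 * pi * real n * exp u))" for n u
    by simp
  have hsums: "h n u = exp (s' * of_real u) * (a n * exp (tpi * of_nat n * (\<i> * of_real (exp u))))" for n u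
    unfolding h_def q exp_of_real by (simp add: mult_ac)
  have "AE u in lborel. summable (\<lambda>n. norm (h n u))"
  proof (rule AE_I2)
    fix u :: real
    have "summable (\<lambda>n. norm (exp (s' * of_real u)) * (norm (a n) * exp (- 2 * pi * exp u) ^ n))"
      using q_expansion_abs_summable[OF q_exp, of "exp u"] by (intro summable_mult) simp
    also have "(\<lambda>n. norm (exp (s' * of_real u)) * (norm (a n) * exp (- 2 * pi * exp u) ^ n)) = (\<lambda>n. norm (h n u))"
      unfolding hsums exp_q_power by (simp add: norm_mult norm_power)
    finally show "summable (\<lambda>n. norm (h n u))" .
  qed
  then have "(\<lambda>n. \<integral>u. h n u \<partial>lborel) sums (\<integral>u. (\<Sum>n. h n u) \<partial>lborel)"
    using hint by (intro sums_integral sm) (auto simp: has_bochner_integral_iff)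
  also have "(\<lambda>n. \<integral>u. h n u \<partial>lborel) = t"
    using hint by (auto simp: has_bochner_integral_iff)
  also have "(\<lambda>u. \<Sum>n. h n u) = (\<lambda>u. imag_axis u * exp ((s - 1/2) * of_real u))"
  proof
    fix u
    have "(\<lambda>n. a n * exp (tpi * of_nat n * (\<i> * of_real (exp u)))) sums f (\<i> * of_real (exp u))"
      unfolding exp_q_power by (rule f_sums) simp
    then have "(\<lambda>n. h n u) sums (exp (s' * of_real u) * f (\<i> * of_real (exp u)))"
      unfolding hsums by (rule sums_mult)
    moreover have "exp (s' * of_real u) = of_real (exp (u * (real k / 2))) * exp ((s - 1/2) * of_real u)"
      unfolding s'_def exp_of_real[symmetric] exp_add[symmetric]
      by (rule arg_cong[of _ _ exp]) (simp add: algebra_simps diff_divide_distrib)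
    ultimately show "(\<Sum>n. h n u) = imag_axis u * exp ((s - 1/2) * of_real u)"
      by (simp add: imag_axis_def sums_iff mult_ac)
  qed
  finally have "t sums Mellin (s - 1/2)" by (simp add: Mellin_def)
  moreover have "t sums (of_real (2 * pi) powr (- s') * Gamma s' * Ldir s)"
    unfolding t_def by (intro sums_mult Ldir_sums s)
  ultimately show ?thesis unfolding s'_def by (rule sums_unique2)
qed

text \<open>This is \<open>Mellin_Dirichlet\<close> solved for \<open>Ldir\<close>; as
  \<open>rGamma\<close> is entire, dividing by the Gamma factor preserves holomorphy
  everywhere.\<close>

definition Lfun :: "complex \<Rightarrow> complex" where
  "Lfun s = of_real (2 * pi) powr (s + half_wt) * rGamma (s + half_wt) * Mellin (s - 1/2)"

lemma Lfun_entire: "Lfun holomorphic_on UNIV"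
proof -
  have "(\<lambda>s. Mellin (s - 1/2)) holomorphic_on UNIV"
    using holomorphic_on_compose_gen[OF _ Mellin_entire, of "\<lambda>s. s - 1/2" UNIV]
    by (simp add: o_def holomorphic_intros)
  then show ?thesis unfolding Lfun_def[abs_def]
    by (intro holomorphic_intros) auto
qed

lemma Lfun_Dirichlet:
  assumes s: "Re s > 1"
  shows "Lfun s = Ldir s"
proof -
  define s' where "s' = s + half_wt"
  have "Re s' > 0" using s by (simp add: s'_def field_simps)
  then have "s' \<notin> \<int>\<^sub>\<le>\<^sub>0" by (auto elim!: nonpos_Ints_cases)
  then have G: "rGamma s' * Gamma s' = 1"
    by (simp add: Gamma_def rGamma_eq_zero_iff)
  have "Lfun s = (of_real (2 * pi) powr s' * of_real (2 * pi) powr (- s')) * (rGamma s' * Gamma s') * Ldir s"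
    unfolding Lfun_def Mellin_Dirichlet[OF s] s'_def[symmetric] by (simp only: mult_ac)
  then show ?thesis by (simp add: G powr_minus)
qed

lemma Lfun_unique:
  assumes "L holomorphic_on UNIV" "\<And>s. Re s > 1 \<Longrightarrow> L s = Ldir s"
  shows "L = Lfun"
proof
  fix z
  show "L z = Lfun z"
  proof (rule analytic_continuation_open[of "{s. Re s > 1}" UNIV L Lfun z])
    show "open {s. Re s > 1}" by (rule open_halfspace_Re_gt)
    have "2 \<in> {s. Re s > 1}" by simp
    then show "{s. Re s > 1} \<noteq> {}" by blast
  qed (use assms Lfun_entire Lfun_Dirichlet in auto)
qed

text \<open>The asymmetric form comes from the reflection formula: the reciprocal Gamma at 1 - w
  becomes Gamma at w times a sine, which an even weight turns into the cosine.\<close>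

lemma functional_equation:
  assumes w: "Re w > 1" "norm w > real k"
  shows "Lfun (1 - w) = 2 * of_real (2 * pi) powr (- 2 * w) * Gamma (w + half_wt) *
    Gamma (w - half_wt) * cos (of_real pi * w) * Ldir w"
proof -
  define h where "h = half_wt"
  obtain l where l: "k = 2 * l" using even_weight by blast
  \<comment> \<open>A pole would make w real and at most (k - 1) / 2, against Re w > 1 and |w| >
    k.\<close>
  have v: "w - h \<notin> \<int>\<^sub>\<le>\<^sub>0"
  proof
    assume "w - h \<in> \<int>\<^sub>\<le>\<^sub>0"
    then obtain j where j: "w - h = - of_nat j" by (auto elim!: nonpos_Ints_cases')
    then have "w = of_real ((real k - 1) / 2 - real j)" unfolding h_def by (simp add: algebra_simps)
    then have "norm w = \<bar>(real k - 1) / 2 - real j\<bar>" "Re w = (real k - 1) / 2 - real j"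
      by (metis norm_of_real) (metis \<open>w = _\<close> Re_complex_of_real)
    define x where "x = (real k - 1) / 2 - real j"
    have "norm w = \<bar>x\<bar>" "Re w = x" unfolding x_def by fact+
    then have "x > real k" using w by auto
    then show False by (simp add: x_def field_simps)
  qed
  \<comment> \<open>For k = 2l the shift (k - 1) / 2 is l - 1/2, so the sine is a cosine up to
    (-1)^l. This sign later cancels against i^k.\<close>
  have sin: "sin (of_real pi * (w - h)) = (- 1) ^ l * cos (of_real pi * w)"
  proof -
    have "of_real pi * (w - h) = of_real pi * w + of_real pi / 2 - of_nat l * of_real pi"
      by (simp add: h_def l algebra_simps diff_divide_distrib)
    then show ?thesis
    proof (induction l arbitrary: w h)
      case 0
      then show ?case by (simp add: sin_add)
    next
      case (Suc l)
      have "of_real pi * (w - h) = of_real pi * (w - (h - 1)) - of_real pi" by (simp add: algebra_simps)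
      then have "sin (of_real pi * (w - h)) = - sin (of_real pi * (w - (h - 1)))"
        by (simp only: sin_diff) simp
      also have "sin (of_real pi * (w - (h - 1))) = (- 1) ^ l * cos (of_real pi * w)"
        by (rule Suc.IH) (use Suc.prems in \<open>simp add: field_simps\<close>)
      finally show ?case by simp
    qed
  qed
  have refl: "rGamma (1 - (w - h)) = Gamma (w - h) * (sin (of_real pi * (w - h)) / of_real pi)"
    using rGamma_reflection_complex[of "w - h"] v by (simp add: Gamma_def field_simps rGamma_eq_zero_iff)
  have ik: "\<i> ^ k = (- 1) ^ l" by (simp add: l power_mult)
  have "Mellin (1 - w - 1/2) = Mellin (- (w - 1/2))" by (simp add: algebra_simps)
  also have "\<dots> = \<i> ^ k * (of_real (2 * pi) powr (- (w + h)) * Gamma (w + h) * Ldir w)"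
    unfolding Mellin_reflect Mellin_Dirichlet[OF w(1)] h_def ..
  finally have M: "Mellin (1 - w - 1/2) = \<i> ^ k * (of_real (2 * pi) powr (- (w + h)) * Gamma (w + h) * Ldir w)" .
  have h1: "1 - w + h = 1 - (w - h)" by simp
  have p: "complex_of_real (2 * pi) powr (1 - (w - h)) * of_real (2 * pi) powr (- (w + h)) =
      of_real (2 * pi) * of_real (2 * pi) powr (- 2 * w)"
    by (simp add: powr_def exp_add[symmetric] algebra_simps) (simp add: exp_diff exp_minus divide_inverse mult_ac)
  have "Lfun (1 - w) = (of_real (2 * pi) powr (1 - (w - h)) * of_real (2 * pi) powr (- (w + h))) *
      (Gamma (w - h) * (((- 1) ^ l * (- 1) ^ l) * cos (of_real pi * w) / of_real pi)) * Gamma (w + h) * Ldir w"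
    unfolding Lfun_def h_def[symmetric] M h1 refl sin ik by (simp add: mult_ac)
  also have "(- 1) ^ l * (- 1) ^ l = (1 :: complex)" by (simp flip: power_mult_distrib)
  finally show ?thesis unfolding p h_def[symmetric] by simp
qed

end

section \<open>Asymptotics in right half planes\<close>

text \<open>|w| tends to infinity inside a closed half plane. Limits along this filter are uniform
  in the direction and include the edge Re w = c.\<close>

definition region :: "real \<Rightarrow> complex filter" where
  "region c = inf at_infinity (principal {w. c \<le> Re w})"

lemma eventually_region:
  "eventually P (region c) \<longleftrightarrow> (\<exists>R. \<forall>w. c \<le> Re w \<and> R \<le> norm w \<longrightarrow> P w)"
  unfolding region_def eventually_inf_principal eventually_at_infinity by auto

lemma eventually_region_norm: "eventually (\<lambda>w. c \<le> Re w \<and> r < norm w) (region c)"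
  unfolding eventually_region by (rule exI[of _ "r + 1"]) auto

text \<open>Despite the name there is no angular condition: this is an open half plane outside a
  closed disc about 0, the open domain on which the functions are holomorphic.\<close>

definition sector :: "real \<Rightarrow> real \<Rightarrow> complex set" where
  "sector c r = {w. c < Re w \<and> r < norm w}"

lemma open_sector: "open (sector c r)"
  unfolding sector_def by (intro open_Collect_conj open_Collect_less continuous_intros)

lemma eventually_sector: "c0 < c \<Longrightarrow> eventually (\<lambda>w. w \<in> sector c0 r) (region c)"
  using eventually_region_norm[of c r] by eventually_elim (auto simp: sector_def)

text \<open>Cauchy's estimate on discs of the fixed radius (c - c0) / 2. The discs reach to the left
  of Re w = c, which is why the limit is assumed for every c > c0.\<close>

lemma deriv_tendsto_0_region:
  assumes hol: "f holomorphic_on sector c0 r"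
    and lim: "\<And>c. c > c0 \<Longrightarrow> (f \<longlongrightarrow> l) (region c)" and c: "c > c0"
  shows "(deriv f \<longlongrightarrow> 0) (region c)"
proof (rule tendstoI)
  fix e :: real assume e: "e > 0"
  define \<rho> where "\<rho> = (c - c0) / 2"
  have \<rho>: "\<rho> > 0" "c - \<rho> > c0" using c by (simp_all add: \<rho>_def field_simps)
  have "eventually (\<lambda>w. dist (f w) l < e * \<rho> / 2) (region (c - \<rho>))"
    using lim[OF \<rho>(2)] e \<rho> by (intro tendstoD) auto
  then obtain R where R: "\<And>w. c - \<rho> \<le> Re w \<Longrightarrow> R \<le> norm w \<Longrightarrow> dist (f w) l < e * \<rho> / 2"
    unfolding eventually_region by blast
  have "dist (deriv f w) 0 < e" if w: "c \<le> Re w \<and> max R (r + 1) + \<rho> \<le> norm w" for w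
  proof -
    have near: "c - \<rho> \<le> Re v" "R \<le> norm v" "r < norm v" if v: "v \<in> cball w \<rho>" for v
    proof -
      have "norm (w - v) \<le> \<rho>" using v by (simp add: dist_norm)
      then have "Re w - Re v \<le> \<rho>" "norm w - norm v \<le> \<rho>"
        using complex_Re_le_cmod[of "w - v"] norm_triangle_ineq2[of w v] by auto
      moreover have "R \<le> max R (r + 1)" "r + 1 \<le> max R (r + 1)" by auto
      ultimately show "c - \<rho> \<le> Re v" "R \<le> norm v" "r < norm v"
        using w by linarith+
    qed
    have sub: "cball w \<rho> \<subseteq> sector c0 r"
    proof
      fix v assume "v \<in> cball w \<rho>"
      from near(1,3)[OF this] show "v \<in> sector c0 r" using \<rho>(2) by (simp add: sector_def)
    qed
    have "norm ((deriv ^^ 1) f w) \<le> fact 1 * (e * \<rho> / 2) / \<rho> ^ 1"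
    proof (rule Cauchy_higher_deriv_bound)
      show "f holomorphic_on ball w \<rho>" "continuous_on (cball w \<rho>) f"
        using holomorphic_on_subset[OF hol order.trans[OF ball_subset_cball sub]]
          holomorphic_on_imp_continuous_on[OF holomorphic_on_subset[OF hol sub]] by simp_all
      fix v assume "v \<in> ball w \<rho>"
      then have "v \<in> cball w \<rho>" by auto
      then show "f v \<in> ball l (e * \<rho> / 2)" using R near by (simp add: dist_commute)
    qed (use \<rho> in auto)
    then show ?thesis using \<rho> e by simp
  qed
  then show "eventually (\<lambda>w. dist (deriv f w) 0 < e) (region c)"
    unfolding eventually_region by blast
qed

lemma holomorphic_higher_deriv_DERIV:
  assumes "f holomorphic_on S" "open S" "z \<in> S"
  shows "((deriv ^^ n) f has_field_derivative (deriv ^^ Suc n) f z) (at z)"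
  using holomorphic_derivI[OF holomorphic_higher_deriv[OF assms(1,2)] assms(2,3), of n UNIV] by simp

text \<open>The error terms are controlled by Cauchy estimates for the reciprocal \<open>\<phi>\<close> of the logarithmic
  derivative.\<close>

lemma higher_deriv_asymptotics:
  assumes P: "P holomorphic_on sector c0 r" "\<And>w. w \<in> sector c0 r \<Longrightarrow> P w \<noteq> 0"
    and \<phi>: "\<phi> holomorphic_on sector c0 r" "\<And>w. w \<in> sector c0 r \<Longrightarrow> \<phi> w * deriv P w = P w"
    and lim: "\<And>c. c > c0 \<Longrightarrow> (\<phi> \<longlongrightarrow> 0) (region c)"
  defines "F \<equiv> \<lambda>m w. (deriv ^^ m) P w * \<phi> w ^ m / P w"
  shows "F m holomorphic_on sector c0 r" and "c > c0 \<Longrightarrow> (F m \<longlongrightarrow> 1) (region c)"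
proof -
  have holF: "F m holomorphic_on sector c0 r" for m
    unfolding F_def using P \<phi> open_sector by (intro holomorphic_intros holomorphic_higher_deriv) auto
  then show "F m holomorphic_on sector c0 r" .
  \<comment> \<open>The quotient rule with \<phi> P' = P. Since \<phi> and, by the previous lemma,
    the derivatives of \<phi> and \<open>F m\<close> tend to 0, only the last summand survives in
    the limit.\<close>
  have step: "F (Suc m) w = \<phi> w * deriv (F m) w - of_nat m * deriv \<phi> w * F m w + F m w"
    if w: "w \<in> sector c0 r" for m w
  proof -
    define D where "D n = (deriv ^^ n) P w" for n
    have d1: "((deriv ^^ m) P has_field_derivative D (Suc m)) (at w)"
      unfolding D_def by (rule holomorphic_higher_deriv_DERIV[OF P(1) open_sector w])
    have d2: "(\<phi> has_field_derivative deriv \<phi> w) (at w)"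
      using holomorphic_derivI[OF \<phi>(1) open_sector w] .
    have d3: "(P has_field_derivative deriv P w) (at w)"
      using holomorphic_derivI[OF P(1) open_sector w] .
    have "(F m has_field_derivative
        ((D m * (of_nat m * \<phi> w ^ (m - 1) * deriv \<phi> w) + D (Suc m) * \<phi> w ^ m) * P w - D m * \<phi> w ^ m * deriv P w)
          / (P w * P w)) (at w)"
      unfolding F_def D_def[symmetric] using P(2)[OF w]
      by (auto intro!: derivative_eq_intros d1 d2 d3 simp: D_def)
    from DERIV_imp_deriv[OF this]
    have dF: "deriv (F m) w * (P w * P w) =
        (D m * (of_nat m * \<phi> w ^ (m - 1) * deriv \<phi> w) + D (Suc m) * \<phi> w ^ m) * P w - D m * \<phi> w ^ m * deriv P w"
      using P(2)[OF w] by simp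
    have pw: "\<phi> w * (of_nat m * \<phi> w ^ (m - 1)) = of_nat m * \<phi> w ^ m" by (cases m) auto
    have "\<phi> w * deriv (F m) w * (P w * P w) =
        (D m * (\<phi> w * (of_nat m * \<phi> w ^ (m - 1))) * deriv \<phi> w + D (Suc m) * \<phi> w ^ Suc m) * P w
          - D m * \<phi> w ^ m * (\<phi> w * deriv P w)"
      unfolding mult.assoc[of "\<phi> w"] dF by (simp add: algebra_simps)
    also have "\<dots> = (of_nat m * deriv \<phi> w * F m w + F (Suc m) w - F m w) * (P w * P w)"
      unfolding pw \<phi>(2)[OF w] F_def D_def[symmetric] using P(2)[OF w] by (simp add: D_def field_simps)
    finally show ?thesis using P(2)[OF w] by simp
  qed
  show "(F m \<longlongrightarrow> 1) (region c)" if c: "c > c0" using c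
  proof (induction m arbitrary: c)
    case 0
    have "eventually (\<lambda>w. F 0 w = 1) (region c)"
      using eventually_sector[OF 0, of r] by eventually_elim (use P in \<open>simp add: F_def\<close>)
    then show ?case by (rule tendsto_eventually)
  next
    case (Suc m)
    have "((\<lambda>w. \<phi> w * deriv (F m) w - of_nat m * deriv \<phi> w * F m w + F m w) \<longlongrightarrow> 0 * 0 - of_nat m * 0 * 1 + 1) (region c)"
      using Suc lim by (intro tendsto_intros deriv_tendsto_0_region[OF holF] deriv_tendsto_0_region[OF \<phi>(1)]) auto
    moreover have "eventually (\<lambda>w. \<phi> w * deriv (F m) w - of_nat m * deriv \<phi> w * F m w + F m w = F (Suc m) w) (region c)"
      using eventually_sector[OF Suc.prems, of r] by eventually_elim (simp add: step)
    ultimately show ?case using tendsto_cong by fastforce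
  qed
qed

text \<open>Two functions are allowed because conjugation exchanges the terms with exp (i pi w) and
  exp (- i pi w).\<close>

lemma higher_deriv_cnj:
  assumes S: "open S" "\<And>w. w \<in> S \<Longrightarrow> cnj w \<in> S"
    and f: "f holomorphic_on S" and g: "g holomorphic_on S" and eq: "\<And>w. w \<in> S \<Longrightarrow> g (cnj w) = cnj (f w)"
    and w: "w \<in> S"
  shows "(deriv ^^ m) g (cnj w) = cnj ((deriv ^^ m) f w)"
  using w
proof (induction m arbitrary: w)
  case (Suc m)
  define F where "F = (deriv ^^ m) f"
  have "(F has_field_derivative (deriv ^^ Suc m) f w) (at w)"
    unfolding F_def by (rule holomorphic_higher_deriv_DERIV[OF f S(1) Suc.prems])
  then have "((cnj \<circ> F \<circ> cnj) has_field_derivative cnj ((deriv ^^ Suc m) f w)) (at (cnj w))"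
    by (intro has_field_derivative_cnj_cnj) auto
  then have "((deriv ^^ m) g has_field_derivative cnj ((deriv ^^ Suc m) f w)) (at (cnj w))"
  proof (rule has_field_derivative_transform_within_open[OF _ S(1)])
    show "cnj w \<in> S" using S Suc.prems by blast
    fix v assume "v \<in> S"
    then show "(cnj \<circ> F \<circ> cnj) v = (deriv ^^ m) g v"
      using Suc.IH[of "cnj v"] S(2) by (simp add: F_def)
  qed
  then show ?case by (simp add: DERIV_imp_deriv)
qed (use eq in auto)

section \<open>Growth of the digamma function in right half planes\<close>

text \<open>For Re z >= 1 every term of the digamma series has nonnegative real part, so all terms
  from K on may be dropped.\<close>

lemma Re_Digamma_ge:
  assumes z: "Re z \<ge> 1"
  shows "Re (Digamma z) \<ge> (\<Sum>n<K. 1 / real (Suc n) - 1 / norm (z + of_nat n)) - euler_mascheroni"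
proof -
  define t where "t n = Re (inverse (of_nat (Suc n)) - inverse (z + of_nat n))" for n
  have "z \<noteq> 0" using z by auto
  then have "(\<lambda>n. inverse (of_nat (Suc n)) - inverse (z + of_nat n)) sums (Digamma z + euler_mascheroni)"
    using summable_Digamma[of z] by (simp add: Digamma_def summable_sums)
  moreover have "t sums (Re (Digamma z) + euler_mascheroni)"
    if "(\<lambda>n. inverse (of_nat (Suc n)) - inverse (z + of_nat n)) sums (Digamma z + euler_mascheroni)"
  proof -
    have e: "Re (euler_mascheroni :: complex) = euler_mascheroni"
      by (metis Re_complex_of_real of_real_euler_mascheroni)
    show ?thesis using sums_Re[OF that] unfolding t_def plus_complex.sel e .
  qed
  ultimately have sums: "t sums (Re (Digamma z) + euler_mascheroni)" by blast
  have tn: "t n = 1 / real (Suc n) - Re (inverse (z + of_nat n))" for n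
  proof -
    have "complex_of_nat (Suc n) = of_real (real (Suc n))" by simp
    then have "Re (inverse (complex_of_nat (Suc n))) = inverse (real (Suc n))"
      by (metis Re_complex_of_real of_real_inverse)
    then show ?thesis unfolding t_def minus_complex.sel by (simp add: divide_inverse)
  qed
  have Re_le: "Re (inverse u) \<le> 1 / Re u" if "Re u > 0" for u
  proof -
    have "Re (inverse u) = Re u / ((Re u)\<^sup>2 + (Im u)\<^sup>2)" by simp
    also have "\<dots> \<le> Re u / (Re u)\<^sup>2" using that by (intro divide_left_mono) (auto intro!: mult_pos_pos add_pos_nonneg)
    finally show ?thesis using that by (simp add: power2_eq_square)
  qed
  have "t n \<ge> 0" for n
  proof -
    have "Re (inverse (z + of_nat n)) \<le> 1 / Re (z + of_nat n)" using z by (intro Re_le) auto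
    also have "\<dots> \<le> 1 / real (Suc n)" using z by (intro divide_left_mono) (auto intro!: mult_pos_pos)
    finally show ?thesis by (simp add: tn)
  qed
  then have "(\<Sum>n<K. t n) \<le> Re (Digamma z) + euler_mascheroni"
    using sum_le_suminf[of t "{..<K}"] sums by (simp add: sums_iff)
  moreover have "(\<Sum>n<K. 1 / real (Suc n) - 1 / norm (z + of_nat n)) \<le> (\<Sum>n<K. t n)"
    unfolding tn using complex_Re_le_cmod[of "inverse (z + of_nat n)" for n]
    by (intro sum_mono) (auto simp: norm_inverse divide_inverse)
  ultimately show ?thesis by linarith
qed

text \<open>By divergence of the harmonic series, K terms exceed M by enough, and for |z| >= 3K the
  subtracted 1 / |z + n| contribute at most 1 in total.\<close>

lemma eventually_Digamma_1: "eventually (\<lambda>z. Re (Digamma z) \<ge> M) (region 1)"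
proof -
  have "\<not> summable (\<lambda>n. 1 / real (Suc n))"
    using not_summable_harmonic[where ?'a = real] summable_Suc_iff[of "\<lambda>n. inverse (real n)"]
    by (simp add: inverse_eq_divide)
  then obtain K where K: "(\<Sum>n<K. 1 / real (Suc n)) \<ge> M + euler_mascheroni + 1"
    using summableI_nonneg_bounded[of "\<lambda>n. 1 / real (Suc n)" "M + euler_mascheroni + 1"]
    by (metis linorder_linear divide_nonneg_nonneg of_nat_0_le_iff zero_le_one)
  have "Re (Digamma z) \<ge> M" if z: "1 \<le> Re z \<and> real K + 2 * real K \<le> norm z" for z
  proof -
    have "1 / norm (z + of_nat n) \<le> 1 / real K" if n: "n < K" for n
    proof -
      have "norm (z + of_nat n) \<ge> norm z - real n" using norm_diff_ineq[of z "of_nat n"] by simp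
      then have "norm (z + of_nat n) \<ge> real K" using z n by linarith
      then show ?thesis using n by (intro frac_le) auto
    qed
    then have "(\<Sum>n<K. 1 / norm (z + of_nat n)) \<le> (\<Sum>n<K. 1 / real K)"
      by (intro sum_mono) auto
    also have "\<dots> \<le> 1" by simp
    finally have "(\<Sum>n<K. 1 / norm (z + of_nat n)) \<le> 1" .
    then show ?thesis using Re_Digamma_ge[of z K] z K by (simp add: sum_subtractf)
  qed
  then show ?thesis unfolding eventually_region by blast
qed

lemma Digamma_plus_of_nat:
  assumes "\<And>j. j < n \<Longrightarrow> z + of_nat j \<noteq> 0"
  shows "Digamma (z + of_nat n :: complex) = Digamma z + (\<Sum>j<n. 1 / (z + of_nat j))"
  using assms
proof (induction n)
  case (Suc n)
  have "Digamma (z + of_nat n + 1) = Digamma (z + of_nat n) + 1 / (z + of_nat n)"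
    by (rule Digamma_plus1) (use Suc.prems in auto)
  then show ?case using Suc by (simp add: add_ac)
qed simp

text \<open>The recurrence moves the argument to Re z >= 1 in n steps. Away from the poles each step
  changes the real part by at most 1, hence the reserve M + n.\<close>

lemma eventually_Digamma: "eventually (\<lambda>w. Re (Digamma (w + of_real b)) \<ge> M) (region c)"
proof -
  define n where "n = nat \<lceil>1 - b - c\<rceil>"
  have n: "c + b + real n \<ge> 1" unfolding n_def by linarith
  obtain R where R: "\<And>z. 1 \<le> Re z \<Longrightarrow> R \<le> norm z \<Longrightarrow> Re (Digamma z) \<ge> M + real n"
    using eventually_Digamma_1[of "M + real n"] unfolding eventually_region by blast
  have "Re (Digamma (w + of_real b)) \<ge> M" if w: "c \<le> Re w \<and> max R 1 + \<bar>b\<bar> + real n \<le> norm w" for w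
  proof -
    define z where "z = w + of_real b"
    have nz: "norm (z + of_nat j) \<ge> max R 1" if "j \<le> n" for j
    proof -
      define q where "q = complex_of_real (b + real j)"
      have "norm w - norm q \<le> norm (w + q)" by (rule norm_diff_ineq)
      moreover have "norm q \<le> \<bar>b\<bar> + real n"
        using that unfolding q_def norm_of_real by linarith
      moreover have "z + of_nat j = w + q" by (simp add: z_def q_def)
      ultimately show ?thesis using w by (simp only: z_def) linarith
    qed
    have "Re (1 / (z + of_nat j)) \<le> 1" if "j < n" for j
    proof -
      have "norm (1 / (z + of_nat j)) \<le> 1" using nz[of j] that by (simp add: norm_divide divide_le_eq)
      then show ?thesis using complex_Re_le_cmod[of "1 / (z + of_nat j)"] by linarith
    qed
    then have "(\<Sum>j<n. Re (1 / (z + of_nat j))) \<le> (\<Sum>j<n. 1)" by (intro sum_mono) auto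
    moreover have "Digamma (z + of_nat n) = Digamma z + (\<Sum>j<n. 1 / (z + of_nat j))"
    proof (rule Digamma_plus_of_nat)
      fix j assume "j < n"
      then have "norm (z + of_nat j) \<ge> 1" using nz[of j] by simp
      then show "z + of_nat j \<noteq> 0" by auto
    qed
    then have "Re (Digamma (z + of_nat n)) = Re (Digamma z) + (\<Sum>j<n. Re (1 / (z + of_nat j)))"
      by simp
    moreover have "Re (Digamma (z + of_nat n)) \<ge> M + real n"
      using R[of "z + of_nat n"] nz[of n] n w by (simp add: z_def)
    ultimately show ?thesis by (simp add: z_def)
  qed
  then show ?thesis unfolding eventually_region by blast
qed

context normalized_eigenform
begin

section \<open>Zeros in the left half plane\<close>

lemma Lfun_bounded:
  assumes "c > 1"
  obtains B where "B > 0" "\<And>w. Re w \<ge> c \<Longrightarrow> norm (Lfun w) \<le> B"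
proof
  have sm: "summable (\<lambda>n. norm (lam n) * real n powr (- c))" by (rule lam_summable[OF assms])
  show "(\<Sum>n. norm (lam n) * real n powr (- c)) + 1 > 0"
    using suminf_nonneg[OF sm] by (simp add: add_nonneg_pos)
  fix w assume w: "Re w \<ge> c"
  have "norm (Ldir w) \<le> (\<Sum>n. norm (lam n) * real n powr (- c))"
    unfolding Ldir_def
  proof (rule norm_suminf_le[OF _ sm])
    fix n
    have "real n powr (- Re w) \<le> real n powr (- c)"
      using w by (cases "n = 0") (auto intro!: powr_mono)
    then show "norm (lam n * of_nat n powr (- w)) \<le> norm (lam n) * real n powr (- c)"
      unfolding norm_Ldir_term by (intro mult_left_mono) auto
  qed
  then show "norm (Lfun w) \<le> (\<Sum>n. norm (lam n) * real n powr (- c)) + 1"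
    using Lfun_Dirichlet[of w] w assms by simp
qed

text \<open>The numerator is bounded by Cauchy's estimate on discs still inside Re w > 1, the
  denominator from below by the sieve.\<close>

lemma Lfun_log_deriv_bounded:
  assumes c: "c > 1"
  obtains B where "\<And>w. Re w \<ge> c \<Longrightarrow> norm (deriv Lfun w / Lfun w) \<le> B"
proof -
  define \<rho> where "\<rho> = (c - 1) / 2"
  have \<rho>: "\<rho> > 0" "c - \<rho> > 1" using c by (simp_all add: \<rho>_def field_simps)
  obtain B where B: "B > 0" "\<And>w. Re w \<ge> c - \<rho> \<Longrightarrow> norm (Lfun w) \<le> B"
    using Lfun_bounded[OF \<rho>(2)] by metis
  obtain \<kappa> where \<kappa>: "\<kappa> > 0" "\<And>w. Re w \<ge> c \<Longrightarrow> norm (Ldir w) \<ge> \<kappa>"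
    using Ldir_lower_bound[OF c] by metis
  show ?thesis
  proof (rule that[of "B / \<rho> / \<kappa>"])
    fix w assume w: "Re w \<ge> c"
    have "norm ((deriv ^^ 1) Lfun w) \<le> fact 1 * B / \<rho> ^ 1"
    proof (rule Cauchy_inequality)
      show "Lfun holomorphic_on ball w \<rho>" using Lfun_entire holomorphic_on_subset by blast
      show "continuous_on (cball w \<rho>) Lfun"
        using Lfun_entire holomorphic_on_subset holomorphic_on_imp_continuous_on by blast
      fix x assume "norm (w - x) = \<rho>"
      then show "norm (Lfun x) \<le> B" using B(2)[of x] w abs_Re_le_cmod[of "w - x"] by simp
    qed (use \<rho> in auto)
    moreover have "norm (Lfun w) \<ge> \<kappa>" using \<kappa>(2)[OF w] Lfun_Dirichlet[of w] w c by simp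
    ultimately show "norm (deriv Lfun w / Lfun w) \<le> B / \<rho> / \<kappa>"
      unfolding norm_divide using \<kappa>(1) B(1) \<rho>(1) by (intro frac_le) auto
  qed
qed

lemma Ldir_nonzero: "Re w > 1 \<Longrightarrow> Ldir w \<noteq> 0"
  using Ldir_lower_bound[of "Re w"] by (metis norm_zero order_refl not_less)

text \<open>The zero-free factor \<Phi>: everything in the functional equation except twice the
  cosine.\<close>

definition Gam :: "complex \<Rightarrow> complex" where
  "Gam w = of_real (2 * pi) powr (- 2 * w) * Gamma (w + half_wt) *
    Gamma (w - half_wt) * Lfun w"

text \<open>The logarithmic derivative of \<open>Gam\<close>. The second digamma argument is written
  as a sum to match \<open>eventually_Digamma\<close>.\<close>

definition Gam_ld :: "complex \<Rightarrow> complex" where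
  "Gam_ld w = - 2 * of_real (ln (2 * pi)) + Digamma (w + half_wt) +
     Digamma (w + of_real (- ((real k - 1) / 2))) + deriv Lfun w / Lfun w"

lemma functional_equation_exp:
  assumes w: "w \<in> sector 1 (real k)"
  shows "Lfun (1 - w) = Gam w * exp (\<i> * of_real pi * w) + Gam w * exp (- \<i> * of_real pi * w)"
proof -
  have "2 * cos (of_real pi * w) = exp (\<i> * of_real pi * w) + exp (- \<i> * of_real pi * w)"
    by (simp add: cos_exp_eq mult.assoc)
  moreover have "Lfun (1 - w) = Gam w * (2 * cos (of_real pi * w))"
    using functional_equation[of w] w Lfun_Dirichlet[of w] by (simp add: sector_def Gam_def)
  ultimately show ?thesis by (simp add: distrib_left)
qed

lemma Gamma_args:
  assumes w: "w \<in> sector 1 (real k)"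
  shows "w + half_wt \<notin> \<int>\<^sub>\<le>\<^sub>0" "w - half_wt \<notin> \<int>\<^sub>\<le>\<^sub>0"
proof -
  have "Re (w + half_wt) > 0" using w by (simp add: sector_def field_simps)
  moreover have "v \<notin> \<int>\<^sub>\<le>\<^sub>0" if "Re v > 0" for v :: complex using that by (auto elim!: nonpos_Ints_cases)
  ultimately show "w + half_wt \<notin> \<int>\<^sub>\<le>\<^sub>0" by blast
  show "w - half_wt \<notin> \<int>\<^sub>\<le>\<^sub>0"
  proof
    assume "w - half_wt \<in> \<int>\<^sub>\<le>\<^sub>0"
    then obtain j where "w - half_wt = - of_nat j" by (auto elim!: nonpos_Ints_cases')
    then have w': "w = of_real ((real k - 1) / 2 - real j)" by (simp add: algebra_simps)
    define x where "x = (real k - 1) / 2 - real j"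
    have "w = of_real x" unfolding w' x_def ..
    then have "norm w = \<bar>x\<bar>" "Re w = x" by simp_all
    then have "x > real k" using w by (auto simp: sector_def)
    then show False by (simp add: x_def field_simps)
  qed
qed

lemma Gam_nonzero: "w \<in> sector 1 (real k) \<Longrightarrow> Gam w \<noteq> 0"
  using Gamma_args[of w] Ldir_nonzero[of w] Lfun_Dirichlet[of w]
  by (auto simp: Gam_def Gamma_eq_zero_iff sector_def)

lemma Gam_DERIV:
  assumes w: "w \<in> sector 1 (real k)"
  shows "(Gam has_field_derivative Gam w * Gam_ld w) (at w)"
proof -
  have L: "(Lfun has_field_derivative deriv Lfun w) (at w)"
    using holomorphic_derivI[OF Lfun_entire] by auto
  have nz: "Lfun w \<noteq> 0" using Ldir_nonzero[of w] Lfun_Dirichlet[of w] w by (simp add: sector_def)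
  have "((\<lambda>w. of_real (2 * pi) powr (- 2 * w)) has_field_derivative
      - 2 * of_real (ln (2 * pi)) * of_real (2 * pi) powr (- 2 * w)) (at w)"
  proof -
    have eq: "complex_of_real (2 * pi) powr v = exp (v * of_real (ln (2 * pi)))" for v
      unfolding powr_def using Ln_of_real[of "2 * pi"] by simp
    show ?thesis unfolding eq by (auto intro!: derivative_eq_intros)
  qed
  moreover have "((\<lambda>w. Gamma (w + b)) has_field_derivative Gamma (w + b) * Digamma (w + b)) (at w)"
    if "w + b \<notin> \<int>\<^sub>\<le>\<^sub>0" for b
    by (rule DERIV_shift[THEN iffD1], rule has_field_derivative_Gamma[OF that])
  note this[OF Gamma_args(1)[OF w]] this[of "- half_wt"]
  ultimately have der:
    "((\<lambda>w. of_real (2 * pi) powr (- 2 * w)) has_field_derivative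
      - 2 * of_real (ln (2 * pi)) * of_real (2 * pi) powr (- 2 * w)) (at w)"
    "((\<lambda>w. Gamma (w + half_wt)) has_field_derivative
       Gamma (w + half_wt) * Digamma (w + half_wt)) (at w)"
    "((\<lambda>w. Gamma (w - half_wt)) has_field_derivative
       Gamma (w - half_wt) * Digamma (w + of_real (- ((real k - 1) / 2)))) (at w)"
    using Gamma_args[OF w] by simp_all
  show ?thesis
    unfolding Gam_def[abs_def]
    by (rule derivative_eq_intros der L refl | simp)+
       (simp add: Gam_ld_def nz distrib_left distrib_right add_divide_distrib, use nz in \<open>simp add: field_simps\<close>)
qed

lemma Gam_holomorphic: "Gam holomorphic_on sector 1 (real k)"
  unfolding holomorphic_on_open[OF open_sector] using Gam_DERIV by blast

lemma eventually_Gam_ld: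
  assumes "c > 1"
  shows "eventually (\<lambda>w. Re (Gam_ld w) \<ge> M) (region c)"
proof -
  obtain B where B: "\<And>w. Re w \<ge> c \<Longrightarrow> norm (deriv Lfun w / Lfun w) \<le> B"
    using Lfun_log_deriv_bounded[OF assms] by metis
  define M' where "M' = (M + 2 * ln (2 * pi) + B) / 2"
  show ?thesis
    using eventually_Digamma[of M' "(real k - 1) / 2" c] eventually_Digamma[of M' "- ((real k - 1) / 2)" c]
      eventually_region_norm[of c 0]
  proof eventually_elim
    case (elim w)
    have "\<bar>Re (deriv Lfun w / Lfun w)\<bar> \<le> B"
      using B[of w] abs_Re_le_cmod[of "deriv Lfun w / Lfun w"] elim by linarith
    moreover have "2 * M' = M + 2 * ln (2 * pi) + B" by (simp add: M'_def)
    moreover have "Re (Gam_ld w) = - 2 * ln (2 * pi) + Re (Digamma (w + half_wt)) +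
     Re (Digamma (w + of_real (- ((real k - 1) / 2)))) + Re (deriv Lfun w / Lfun w)"
      unfolding Gam_ld_def plus_complex.sel by (simp add: Re_complex_of_real)
    ultimately show ?case using elim by linarith
  qed
qed

end

section \<open>The equation for zeros of the derivatives and its solutions\<close>

context normalized_eigenform
begin

abbreviation DL :: "nat \<Rightarrow> complex \<Rightarrow> complex" where "DL m \<equiv> (deriv ^^ m) Lfun"

lemma lam_real: "cnj (lam n) = lam n"
  using coeff_real[of n] by (simp add: lam_def Reals_cnj_iff)

lemma Ldir_cnj:
  assumes "Re w > 1"
  shows "Ldir (cnj w) = cnj (Ldir w)"
proof -
  have "(\<lambda>n. cnj (lam n * of_nat n powr (- w))) sums cnj (Ldir w)"
    using Ldir_sums[OF assms] by (simp only: sums_cnj)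
  moreover have "cnj (of_nat n powr (- w)) = of_nat n powr (- cnj w)" for n
    by (subst cnj_powr) auto
  ultimately have "(\<lambda>n. lam n * of_nat n powr (- cnj w)) sums cnj (Ldir w)"
    by (simp add: lam_real)
  then show ?thesis unfolding Ldir_def by (simp add: sums_iff)
qed

lemma Gam_cnj:
  assumes "w \<in> sector 1 (real k)"
  shows "Gam (cnj w) = cnj (Gam w)"
proof -
  have "cnj (complex_of_real (2 * pi) powr (- 2 * w)) = of_real (2 * pi) powr (- 2 * cnj w)"
    by (subst cnj_powr) auto
  moreover have "Lfun (cnj w) = cnj (Lfun w)"
    using Ldir_cnj[of w] Lfun_Dirichlet[of w] Lfun_Dirichlet[of "cnj w"] assms by (simp add: sector_def)
  ultimately show ?thesis by (simp add: Gam_def cnj_Gamma)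
qed

text \<open>By the functional equation \<open>L(1 - w)\<close> is a sum of two terms that oscillate in opposite directions,
  and each derivative multiplies both by nearly the same factor, whose quotient is \<open>R\<close>.\<close>

lemma reflected_zeros:
  assumes c0: "c0 > 1"
  obtains R r where "R holomorphic_on sector c0 r" "\<And>c. c > c0 \<Longrightarrow> (R \<longlongrightarrow> 1) (region c)"
    "\<And>w. w \<in> sector c0 r \<Longrightarrow> DL m (1 - w) = 0 \<longleftrightarrow> nome w = - R w"
    "\<And>w. w \<in> sector c0 r \<Longrightarrow> Im w = 0 \<Longrightarrow> norm (R w) = 1"
proof -
  \<comment> \<open>The midpoint leaves room to the left of c0, so that limits along
    \<open>region c0\<close> itself are available.\<close>
  define c1 where "c1 = (1 + c0) / 2"
  have c1: "c1 > 1" "c1 < c0" using c0 by (simp_all add: c1_def)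
  obtain R1 where R1: "\<And>w. c1 \<le> Re w \<Longrightarrow> R1 \<le> norm w \<Longrightarrow> Re (Gam_ld w) \<ge> 1"
    using eventually_Gam_ld[OF c1(1), of 1] unfolding eventually_region by blast
  \<comment> \<open>Outside radius \<open>R1\<close> the real part of \<open>Gam_ld\<close> is at
    least 1, which keeps \<theta> away from 0; outside radius k the functional equation
    applies.\<close>
  define r1 where "r1 = max R1 (real k)"
  define S where "S = sector c1 r1"
  have S: "open S" "S \<subseteq> sector 1 (real k)"
    using c1 open_sector[of c1 r1] by (auto simp: S_def) (auto simp: sector_def r1_def)
  have SR: "Re (Gam_ld w) \<ge> 1" if "w \<in> S" for w
    using that by (intro R1) (auto simp: S_def sector_def r1_def)
  have Gam_hol: "Gam holomorphic_on S" using Gam_holomorphic S(2) holomorphic_on_subset by blast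
  have "(\<lambda>w. deriv Gam w / Gam w) holomorphic_on S"
    using Gam_nonzero S by (intro holomorphic_intros Gam_hol) auto
  moreover have "deriv Gam w / Gam w = Gam_ld w" if "w \<in> S" for w
    using DERIV_imp_deriv[OF Gam_DERIV] Gam_nonzero that S by auto
  ultimately have ld_hol: "Gam_ld holomorphic_on S" by (rule holomorphic_transform)
  \<comment> \<open>The logarithmic derivative of the term \<open>P e\<close>. For e = 1 or -1 the
    added constant is purely imaginary, so the real part still tends to infinity.\<close>
  define \<theta> where "\<theta> e w = Gam_ld w + e * \<i> * of_real pi" for e w
  define \<phi> where "\<phi> e w = 1 / \<theta> e w" for e w
  define P where "P e w = Gam w * exp (e * \<i> * of_real pi * w)" for e w
  define A where "A e w = (deriv ^^ m) (P e) w / P e w" for e w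
  define F where "F e w = (deriv ^^ m) (P e) w * \<phi> e w ^ m / P e w" for e w
  have Re_\<theta>: "Re (\<theta> e w) = Re (Gam_ld w)" if "e \<in> {1, -1}" for e w
    using that by (auto simp: \<theta>_def)
  have \<theta>_nz: "\<theta> e w \<noteq> 0" if "e \<in> {1, -1}" "w \<in> S" for e w
    using SR[OF that(2)] Re_\<theta>[OF that(1), of w] by (metis not_one_le_zero zero_complex.sel(1))
  have \<phi>_hol: "\<phi> e holomorphic_on S" if "e \<in> {1, -1}" for e
    unfolding \<phi>_def[abs_def] using \<theta>_nz[OF that] unfolding \<theta>_def by (intro holomorphic_intros ld_hol)
  have P_hol: "P e holomorphic_on S" for e
    unfolding P_def[abs_def] by (intro holomorphic_intros Gam_hol)
  have P_nz: "P e w \<noteq> 0" if "w \<in> S" for e w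
    using Gam_nonzero that S by (auto simp: P_def)
  have P_deriv: "\<phi> e w * deriv (P e) w = P e w" if "e \<in> {1, -1}" "w \<in> S" for e w
  proof -
    have "w \<in> sector 1 (real k)" using that S by blast
    note G = Gam_DERIV[OF this]
    have "(P e has_field_derivative P e w * \<theta> e w) (at w)"
      unfolding P_def[abs_def] by (auto intro!: derivative_eq_intros G simp: \<theta>_def algebra_simps)
    from DERIV_imp_deriv[OF this] show ?thesis using \<theta>_nz[OF that] by (simp add: \<phi>_def)
  qed
  have \<phi>_lim: "(\<phi> e \<longlongrightarrow> 0) (region c)" if e: "e \<in> {1, -1}" and c: "c > c1" for e c
  proof (rule tendstoI)
    fix \<epsilon> :: real assume \<epsilon>: "\<epsilon> > 0"
    have "c > 1" using c c1 by simp
    from eventually_Gam_ld[OF this, of "1 / \<epsilon> + 1"]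
    show "eventually (\<lambda>w. dist (\<phi> e w) 0 < \<epsilon>) (region c)"
    proof eventually_elim
      case (elim w)
      then have "1 / \<epsilon> + 1 \<le> norm (\<theta> e w)"
        using Re_\<theta>[OF e, of w] complex_Re_le_cmod[of "\<theta> e w"] by simp
      then have "1 / \<epsilon> < norm (\<theta> e w)" by linarith
      moreover have "0 < norm (\<theta> e w)" using calculation \<epsilon> by (auto intro: less_trans[of 0 "1 / \<epsilon>"])
      ultimately have "1 / norm (\<theta> e w) < \<epsilon>" using \<epsilon> by (simp add: field_simps)
      then show ?case by (simp add: \<phi>_def norm_divide)
    qed
  qed
  have F_lim: "(F e \<longlongrightarrow> 1) (region c)" if "e \<in> {1, -1}" "c > c1" for e c
    unfolding F_def[abs_def]
    by (rule higher_deriv_asymptotics(2)[of "P e" c1 r1 "\<phi> e"])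
       (use that P_hol P_nz \<phi>_hol P_deriv \<phi>_lim in \<open>auto simp: S_def\<close>)
  have AF: "A e w = F e w * \<theta> e w ^ m" if "e \<in> {1, -1}" "w \<in> S" for e w
    using \<theta>_nz[OF that] by (simp add: A_def F_def \<phi>_def power_divide)
  have "eventually (\<lambda>w. dist (F 1 w) 1 < 1) (region c0)"
    using F_lim[of 1 c0] c1 by (intro tendstoD) auto
  then obtain R2 where R2: "\<And>w. c0 \<le> Re w \<Longrightarrow> R2 \<le> norm w \<Longrightarrow> dist (F 1 w) 1 < 1"
    unfolding eventually_region by blast
  define r where "r = max r1 R2"
  have sub: "sector c0 r \<subseteq> S" using c1 by (auto simp: S_def sector_def r_def)
  have A_nz: "A 1 w \<noteq> 0" if "w \<in> sector c0 r" for w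
  proof -
    have "dist (F 1 w) 1 < 1" using that by (intro R2) (auto simp: sector_def r_def)
    then have "F 1 w \<noteq> 0" by auto
    then show ?thesis using AF[of 1 w] \<theta>_nz[of 1 w] that sub by auto
  qed
  define R where "R w = A (- 1) w / A 1 w" for w
  have A_hol: "A e holomorphic_on S" for e
    unfolding A_def[abs_def] using P_nz by (intro holomorphic_intros holomorphic_higher_deriv P_hol S)
  show ?thesis
  proof (rule that[of R r])
    show "R holomorphic_on sector c0 r"
      unfolding R_def[abs_def] using A_nz sub
      by (intro holomorphic_intros holomorphic_on_subset[OF A_hol]) auto
  next
    fix c assume c: "c > c0"
    \<comment> \<open>Since \<open>A e\<close> is \<open>F e\<close> times the m-th power of
      \<open>\<theta> e\<close>, the quotient R involves \<theta>(-1) / \<theta>(1) = 1 - 2 pi i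
      \<phi>(1), which tends to 1.\<close>
    have "((\<lambda>w. F (- 1) w / F 1 w * (1 - 2 * \<i> * of_real pi * \<phi> 1 w) ^ m) \<longlongrightarrow>
        1 / 1 * (1 - 2 * \<i> * of_real pi * 0) ^ m) (region c)"
      using c c1 by (intro tendsto_intros F_lim \<phi>_lim) auto
    moreover have "eventually (\<lambda>w. F (- 1) w / F 1 w * (1 - 2 * \<i> * of_real pi * \<phi> 1 w) ^ m = R w) (region c)"
      using eventually_sector[OF c, of r]
    proof eventually_elim
      case (elim w)
      then have w: "w \<in> S" using sub by blast
      have "1 - 2 * \<i> * of_real pi * \<phi> 1 w = \<theta> (- 1) w / \<theta> 1 w"
        using \<theta>_nz[of 1 w] w by (simp add: \<phi>_def field_simps) (simp add: \<theta>_def algebra_simps)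
      then show ?case using AF[of 1 w] AF[of "- 1" w] w by (simp add: R_def power_divide)
    qed
    ultimately show "(R \<longlongrightarrow> 1) (region c)" using tendsto_cong by fastforce
  next
    fix w assume w: "w \<in> sector c0 r"
    then have wS: "w \<in> S" using sub by blast
    have compose: "(deriv ^^ m) (\<lambda>w. Lfun (- 1 * w + 1)) w = (- 1) ^ m * DL m (- 1 * w + 1)"
      by (rule higher_deriv_compose_linear'[OF Lfun_entire open_UNIV open_UNIV]) auto
    have sum: "(deriv ^^ m) (\<lambda>w. Lfun (- 1 * w + 1)) w = (deriv ^^ m) (\<lambda>w. P 1 w + P (- 1) w) w"
    proof (rule higher_deriv_transform_within_open[OF _ _ S(1) wS])
      show "(\<lambda>w. Lfun (- 1 * w + 1)) holomorphic_on S"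
        using holomorphic_on_compose_gen[OF _ Lfun_entire, of "\<lambda>w. - 1 * w + 1" S]
        by (simp add: o_def holomorphic_intros)
      show "(\<lambda>w. P 1 w + P (- 1) w) holomorphic_on S" by (intro holomorphic_intros P_hol)
      fix v assume "v \<in> S"
      then show "Lfun (- 1 * v + 1) = P 1 v + P (- 1) v"
        using functional_equation_exp[of v] S(2) by (auto simp: P_def)
    qed
    have split: "(deriv ^^ m) (\<lambda>w. P 1 w + P (- 1) w) w = (deriv ^^ m) (P 1) w + (deriv ^^ m) (P (- 1)) w"
      by (rule higher_deriv_add[OF P_hol P_hol S(1) wS])
    have "DL m (1 - w) = 0 \<longleftrightarrow> (deriv ^^ m) (P 1) w + (deriv ^^ m) (P (- 1)) w = 0"
    proof -
      have "(deriv ^^ m) (P 1) w + (deriv ^^ m) (P (- 1)) w = (- 1) ^ m * DL m (- 1 * w + 1)"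
        using compose unfolding sum split .
      then show ?thesis by simp
    qed
    also have "\<dots> \<longleftrightarrow> A 1 w * P 1 w + A (- 1) w * P (- 1) w = 0"
      using P_nz[OF wS] by (simp add: A_def)
    also have "P 1 w = nome w * P (- 1) w"
      by (simp add: P_def mult_ac flip: exp_add)
    also have "A 1 w * (nome w * P (- 1) w) + A (- 1) w * P (- 1) w =
        A 1 w * P (- 1) w * (nome w + R w)"
      using A_nz[OF w] by (simp add: R_def field_simps)
    also have "\<dots> = 0 \<longleftrightarrow> nome w = - R w"
      using A_nz[OF w] P_nz[OF wS] by (simp add: eq_neg_iff_add_eq_0)
    finally show "DL m (1 - w) = 0 \<longleftrightarrow> nome w = - R w" .
    assume "Im w = 0"
    then have cw: "cnj w = w" by (simp add: complex_eq_iff)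
    \<comment> \<open>Here the reality of the coefficients enters, through \<open>Gam_cnj\<close>:
      on the real line \<open>A (- 1)\<close> and \<open>A 1\<close> are conjugate, so their
      quotient has modulus 1.\<close>
    have P_cnj: "P (- 1) (cnj v) = cnj (P 1 v)" if "v \<in> S" for v
      using Gam_cnj[of v] that S(2) by (auto simp: P_def exp_cnj)
    have "(deriv ^^ m) (P (- 1)) (cnj w) = cnj ((deriv ^^ m) (P 1) w)"
      by (rule higher_deriv_cnj[OF S(1) _ P_hol P_hol P_cnj wS]) (auto simp: S_def sector_def)
    then have "A (- 1) w = cnj (A 1 w)" using P_cnj[OF wS] by (simp add: A_def cw)
    then show "norm (R w) = 1" using A_nz[OF w] by (simp add: R_def norm_divide)
  qed
qed

text \<open>For |Im w| >= \<epsilon> the modulus of \<open>nome w\<close> is at least q or at most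
  1/q, with q = exp (2 pi \<epsilon>) > 1, whereas |R| tends to 1. The free parameter b absorbs the
  lower bound on \<delta> asked for by the theorem.\<close>

lemma no_zeros_left:
  assumes \<epsilon>: "\<epsilon> > 0"
  shows "\<exists>\<delta>>b. \<forall>s. norm s \<ge> \<delta> \<and> Re s \<le> - \<epsilon> \<and> \<bar>Im s\<bar> \<ge> \<epsilon> \<longrightarrow> DL m s \<noteq> 0"
proof -
  define c0 where "c0 = 1 + \<epsilon> / 2"
  have c0: "c0 > 1" "1 + \<epsilon> > c0" using \<epsilon> by (simp_all add: c0_def)
  obtain R r where R: "\<And>c. c > c0 \<Longrightarrow> (R \<longlongrightarrow> 1) (region c)"
    "\<And>w. w \<in> sector c0 r \<Longrightarrow> DL m (1 - w) = 0 \<longleftrightarrow> nome w = - R w"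
    using reflected_zeros[OF c0(1), of m] by metis
  define q where "q = exp (2 * pi * \<epsilon>)"
  have q: "q > 1" using \<epsilon> by (simp add: q_def)
  have "((\<lambda>w. norm (R w)) \<longlongrightarrow> norm (1 :: complex)) (region (1 + \<epsilon>))"
    by (intro tendsto_norm R c0)
  then have "eventually (\<lambda>w. norm (R w) < q) (region (1 + \<epsilon>))"
      "eventually (\<lambda>w. inverse q < norm (R w)) (region (1 + \<epsilon>))"
    using q by (auto elim!: order_tendstoD simp: inverse_less_1_iff)
  then have "eventually (\<lambda>w. norm (R w) < q \<and> inverse q < norm (R w)) (region (1 + \<epsilon>))"
    by (rule eventually_conj)
  then obtain X where X: "\<And>w. 1 + \<epsilon> \<le> Re w \<Longrightarrow> X \<le> norm w \<Longrightarrow> norm (R w) < q \<and> inverse q < norm (R w)"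
    unfolding eventually_region by blast
  \<comment> \<open>The extra 1 pays for |w| >= |s| - 1.\<close>
  define \<delta> where "\<delta> = max (max X (r + 1) + 1) (b + 1)"
  have "DL m s \<noteq> 0" if s: "norm s \<ge> \<delta>" "Re s \<le> - \<epsilon>" "\<bar>Im s\<bar> \<ge> \<epsilon>" for s
  proof
    assume zero: "DL m s = 0"
    define w where "w = 1 - s"
    have nw: "norm w \<ge> norm s - 1" unfolding w_def by (metis norm_minus_commute norm_one norm_triangle_ineq2)
    then have w: "1 + \<epsilon> \<le> Re w" "X \<le> norm w" "r < norm w" "\<bar>Im w\<bar> \<ge> \<epsilon>"
      using s by (auto simp: w_def \<delta>_def)
    have "w \<in> sector c0 r" using w c0 by (simp add: sector_def)
    from R(2)[OF this] have "nome w = - R w" using zero by (simp add: w_def)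
    then have e: "exp (- 2 * pi * Im w) = norm (R w)" using norm_exp_q[of w] by simp
    show False
    proof (cases "Im w \<ge> 0")
      case True
      then have "exp (- 2 * pi * Im w) \<le> inverse q"
        using w(4) by (simp add: q_def flip: exp_minus)
      then show False using X[OF w(1,2)] e by simp
    next
      case False
      then have "q \<le> exp (- 2 * pi * Im w)"
        using w(4) mult_left_mono[of \<epsilon> "- Im w" "2 * pi"] by (simp add: q_def)
      then show False using X[OF w(1,2)] e by simp
    qed
  qed
  moreover have "\<delta> > b" by (simp add: \<delta>_def)
  ultimately show ?thesis by blast
qed

text \<open>Centring the strip at N + 1/2 absorbs the minus sign of \<open>nome w = - R w\<close>;
  for R = 1 the solutions are exactly these half-integers.\<close>

lemma exp_centered:
  "exp (tpi * (w - of_int N - 1/2)) = - nome w"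
proof -
  have "tpi * (w - of_int N - 1/2) = tpi * w - 2 * of_int N * of_real pi * \<i> - of_real pi * \<i>"
    by (simp add: algebra_simps diff_divide_distrib)
  moreover have "exp (2 * of_int N * of_real pi * \<i>) = 1" using exp_integer_2pi[of "of_int N"] by simp
  ultimately show ?thesis by (simp add: exp_diff)
qed

text \<open>With l = Ln R, zeros in the strip are the solutions of 2 pi i (w - N - 1/2) = l(w). The
  derivative of l is at most 1 < 2 pi, so two solutions coincide. On the real axis |R| = 1 leaves a
  single real equation, solved by the intermediate value theorem.\<close>

lemma real_zeros_reflected:
  obtains N0 :: int where "real_of_int N0 > b"
    "\<And>N w w'. N \<ge> N0 \<Longrightarrow> of_int N \<le> Re w \<Longrightarrow> Re w \<le> of_int N + 1 \<Longrightarrow> of_int N \<le> Re w' \<Longrightarrow> Re w' \<le> of_int N + 1 \<Longrightarrow>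
      DL m (1 - w) = 0 \<Longrightarrow> DL m (1 - w') = 0 \<Longrightarrow> w = w'"
    "\<And>N. N \<ge> N0 \<Longrightarrow> \<exists>x::real. of_int N < x \<and> x < of_int N + 1 \<and> DL m (1 - of_real x) = 0"
proof -
  obtain R r where R_hol: "R holomorphic_on sector 2 r" and R_lim: "\<And>c. c > 2 \<Longrightarrow> (R \<longlongrightarrow> 1) (region c)"
    and R_zero: "\<And>w. w \<in> sector 2 r \<Longrightarrow> DL m (1 - w) = 0 \<longleftrightarrow> nome w = - R w"
    and R_norm: "\<And>w. w \<in> sector 2 r \<Longrightarrow> Im w = 0 \<Longrightarrow> norm (R w) = 1"
    using reflected_zeros[of 2 m] by auto
  have "eventually (\<lambda>w. dist (R w) 1 < 1/2) (region 3)"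
    using R_lim[of 3] by (intro tendstoD) auto
  moreover have "eventually (\<lambda>w. dist (deriv R w) 0 < 1/2) (region 3)"
    using deriv_tendsto_0_region[OF R_hol R_lim, of 3] by (intro tendstoD) auto
  ultimately have "eventually (\<lambda>w. dist (R w) 1 < 1/2 \<and> dist (deriv R w) 0 < 1/2) (region 3)"
    by (rule eventually_conj)
  then obtain X where X: "\<And>w. 3 \<le> Re w \<Longrightarrow> X \<le> norm w \<Longrightarrow> dist (R w) 1 < 1/2 \<and> dist (deriv R w) 0 < 1/2"
    unfolding eventually_region by blast
  define N0 where "N0 = \<lceil>max (max 3 X) (max (r + 1) (b + 1))\<rceil>"
  have N0: "of_int N0 \<ge> (3 :: real)" "of_int N0 \<ge> X" "of_int N0 > r" "of_int N0 > b"
    using le_of_int_ceiling[of "max (max 3 X) (max (r + 1) (b + 1))"] by (auto simp: N0_def[symmetric])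
  define H where "H = {w. Re w \<ge> of_int N0}"
  have H: "w \<in> sector 2 r" "norm (R w - 1) < 1/2" "norm (deriv R w) < 1/2" if "w \<in> H" for w
    using that N0 X[of w] complex_Re_le_cmod[of w] by (auto simp: H_def sector_def dist_norm)
  have Re_R: "Re (R w) > 1/2" if "w \<in> H" for w
    using H(2)[OF that] abs_Re_le_cmod[of "R w - 1"] by simp
  define l where "l w = Ln (R w)" for w
  have R_slit: "R w \<notin> \<real>\<^sub>\<le>\<^sub>0" if "w \<in> H" for w
    using Re_R[OF that] by (auto simp: complex_nonpos_Reals_iff)
  have l_deriv: "(l has_field_derivative deriv R w / R w) (at w)" if w: "w \<in> H" for w
  proof -
    have "(R has_field_derivative deriv R w) (at w)"
      using holomorphic_derivI[OF R_hol open_sector H(1)[OF w]] .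
    from has_field_derivative_Ln[OF R_slit[OF w]] this
    have "((\<lambda>w. Ln (R w)) has_field_derivative inverse (R w) * deriv R w) (at w)"
      by (rule DERIV_chain2)
    then show ?thesis by (simp add: l_def[abs_def] divide_inverse mult.commute)
  qed
  have exp_l: "exp (l w) = R w" if "w \<in> H" for w
  proof -
    have "R w \<noteq> 0" using Re_R[OF that] by auto
    then show ?thesis by (simp add: l_def)
  qed
  have Im_l: "\<bar>Im (l w)\<bar> < pi / 2" if "w \<in> H" for w
  proof -
    have "R w \<noteq> 0" using Re_R[OF that] by auto
    then show ?thesis using Re_Ln_pos_lt[of "R w"] Re_R[OF that] by (simp add: l_def)
  qed
  have l_lip: "norm (l w - l w') \<le> 1 * norm (w - w')" if "w \<in> H" "w' \<in> H" for w w'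
  proof (rule field_differentiable_bound)
    show "convex H" unfolding H_def by (rule convex_halfspace_Re_ge)
    show "(l has_field_derivative deriv R z / R z) (at z within H)" if "z \<in> H" for z
      using l_deriv[OF that] by (rule has_field_derivative_at_within)
    show "norm (deriv R z / R z) \<le> 1" if "z \<in> H" for z
    proof -
      have "norm (R z) \<ge> 1/2" using Re_R[OF that] complex_Re_le_cmod[of "R z"] by linarith
      then show ?thesis using H(3)[OF that] by (simp add: norm_divide divide_le_eq)
    qed
  qed (use that in auto)
  \<comment> \<open>In the closed strip the left side has imaginary part at most pi in modulus and
    |Im l| < pi / 2, so the two logarithms cannot differ by a nonzero multiple of 2 pi i.\<close>
  have zero_iff: "DL m (1 - w) = 0 \<longleftrightarrow> tpi * (w - of_int N - 1/2) = l w"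
    if N: "N \<ge> N0" and w: "of_int N \<le> Re w" "Re w \<le> of_int N + 1" for N w
  proof -
    have wH: "w \<in> H" using N w by (simp add: H_def)
    define u where "u = tpi * (w - of_int N - 1/2)"
    have "DL m (1 - w) = 0 \<longleftrightarrow> exp u = exp (l w)"
      unfolding u_def exp_centered exp_l[OF wH] using R_zero[OF H(1)[OF wH]] by (metis minus_minus)
    also have "\<dots> \<longleftrightarrow> u = l w"
    proof
      assume "exp u = exp (l w)"
      then obtain j :: int where j: "u = l w + of_real (of_int (2 * j) * pi) * \<i>"
        unfolding exp_eq by blast
      have "Im u = 2 * pi * (Re w - of_int N - 1/2)" by (simp add: u_def)
      moreover have "Im u = Im (l w) + 2 * of_int j * pi" by (simp add: j)
      ultimately have "2 * pi * of_int j = 2 * pi * (Re w - of_int N - 1/2) - Im (l w)"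
        by (simp add: mult_ac)
      moreover have "\<bar>2 * pi * (Re w - of_int N - 1/2)\<bar> \<le> 2 * pi * (1/2)"
      proof -
        have "\<bar>Re w - of_int N - 1/2\<bar> \<le> 1/2" using w by (auto simp: abs_if)
        then show ?thesis unfolding abs_mult by (intro mult_mono) auto
      qed
      ultimately have "\<bar>2 * pi * of_int j\<bar> < 2 * pi * 1"
        using Im_l[OF wH] pi_gt_zero by linarith
      then have "\<bar>real_of_int j\<bar> < 1" by (simp add: abs_mult)
      then have "j = 0" by linarith
      then show "u = l w" by (simp add: j)
    qed simp
    finally show ?thesis unfolding u_def .
  qed
  show ?thesis
  proof (rule that[of N0])
    show "real_of_int N0 > b" by (rule N0(4))
  next
    fix N w w'
    assume N: "N \<ge> N0" and w: "of_int N \<le> Re w" "Re w \<le> of_int N + 1" "of_int N \<le> Re w'" "Re w' \<le> of_int N + 1"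
      and z: "DL m (1 - w) = 0" "DL m (1 - w') = 0"
    have wH: "w \<in> H" "w' \<in> H" using N w by (simp_all add: H_def)
    have "tpi * (w - of_int N - 1/2) - tpi * (w' - of_int N - 1/2) = l w - l w'"
      using zero_iff[OF N w(1,2)] zero_iff[OF N w(3,4)] z by simp
    then have "tpi * (w - w') = l w - l w'" by (simp add: algebra_simps)
    then have "norm (tpi * (w - w')) \<le> norm (w - w')" using l_lip[OF wH] by simp
    then have "2 * pi * norm (w - w') \<le> 1 * norm (w - w')" by (simp add: norm_mult)
    moreover have "2 * pi > 1" using pi_gt3 by linarith
    ultimately show "w = w'"
      by (metis eq_iff_diff_eq_0 mult_le_cancel_right not_less norm_le_zero_iff)
  next
    fix N assume N: "N \<ge> N0"
    \<comment> \<open>The imaginary part of the equation, divided by 2 pi. The correction is smaller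
      than 1/2, so g changes sign strictly inside the interval.\<close>
    define g where "g x = of_int N + 1/2 + Im (l (of_real x)) / (2 * pi) - x" for x :: real
    have xH: "complex_of_real x \<in> H" if "x \<ge> of_int N" for x
      using that N by (simp add: H_def)
    have Im_bound: "\<bar>Im (l (of_real x)) / (2 * pi)\<bar> < 1/2" if "x \<ge> of_int N" for x
      using Im_l[OF xH[OF that]] pi_gt_zero by (simp add: field_simps)
    have "continuous_on H l" using l_deriv by (intro continuous_at_imp_continuous_on ballI DERIV_isCont)
    then have "continuous_on {of_int N..of_int N + 1} (\<lambda>x. l (of_real x))"
      by (rule continuous_on_compose2) (use xH in \<open>auto intro!: continuous_intros\<close>)
    then have cont: "continuous_on {of_int N..of_int N + 1} g"
      unfolding g_def by (intro continuous_intros) auto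
    have gN: "g (of_int N) > 0" "g (of_int N + 1) < 0"
      using Im_bound[of "of_int N"] Im_bound[of "of_int N + 1"] unfolding g_def by linarith+
    then obtain x where x: "of_int N \<le> x" "x \<le> of_int N + 1" "g x = 0"
      using IVT2'[of g "of_int N + 1" 0 "of_int N"] cont by auto
    have "x \<noteq> of_int N" "x \<noteq> of_int N + 1" using gN x(3) by auto
    then have strict: "of_int N < x" "x < of_int N + 1" using x by auto
    have "norm (R (of_real x)) = 1" using R_norm[OF H(1)[OF xH[OF x(1)]]] by simp
    moreover from this have "R (of_real x) \<noteq> 0" by auto
    ultimately have "Re (l (of_real x)) = 0" by (simp add: l_def)
    moreover have "2 * pi * (x - of_int N - 1/2) = Im (l (of_real x))"
      using x(3) by (simp add: g_def field_simps)
    ultimately have "tpi * (of_real x - of_int N - 1/2) = l (of_real x)"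
      by (simp add: complex_eq_iff)
    then have "DL m (1 - of_real x) = 0" using zero_iff[OF N, of "of_real x"] x by simp
    then show "\<exists>x::real. of_int N < x \<and> x < of_int N + 1 \<and> DL m (1 - of_real x) = 0"
      using strict by blast
  qed
qed

text \<open>Reflection by s = 1 - w sends the strip at N to the one at n = 1 - N. Any zero in a
  strip coincides with the real zero already found there, so reality and uniqueness come from the
  same fact.\<close>

lemma real_zeros_left:
  "\<exists>\<alpha><b. (\<forall>s. Re s \<le> \<alpha> \<and> DL m s = 0 \<longrightarrow> s \<in> \<real>) \<and>
     (\<forall>n::int. of_int n \<le> \<alpha> \<longrightarrow> (\<exists>!x::real. of_int n - 1 < x \<and> x < of_int n \<and> DL m (of_real x) = 0))"
proof -
  show ?thesis
  proof (rule real_zeros_reflected[of "1 - b" m])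
    fix N0 :: int
    assume N0: "real_of_int N0 > 1 - b"
      and uniq: "\<And>N w w'. N \<ge> N0 \<Longrightarrow> of_int N \<le> Re w \<Longrightarrow> Re w \<le> of_int N + 1 \<Longrightarrow> of_int N \<le> Re w' \<Longrightarrow> Re w' \<le> of_int N + 1 \<Longrightarrow>
        DL m (1 - w) = 0 \<Longrightarrow> DL m (1 - w') = 0 \<Longrightarrow> w = w'"
      and ex: "\<And>N. N \<ge> N0 \<Longrightarrow> \<exists>x::real. of_int N < x \<and> x < of_int N + 1 \<and> DL m (1 - of_real x) = 0"
    show ?thesis
    proof (intro exI[of _ "1 - real_of_int N0"] conjI allI impI)
      show "1 - real_of_int N0 < b" using N0 by simp
    next
      fix s assume s: "Re s \<le> 1 - real_of_int N0 \<and> DL m s = 0"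
      define w where "w = 1 - s"
      define N where "N = \<lfloor>Re w\<rfloor>"
      have "real_of_int N0 \<le> Re w" using s by (simp add: w_def)
      then have N: "N \<ge> N0" "of_int N \<le> Re w" "Re w \<le> of_int N + 1"
        unfolding N_def by linarith+
      obtain x :: real where x: "of_int N < x" "x < of_int N + 1" "DL m (1 - of_real x) = 0"
        using ex[OF N(1)] by blast
      have z: "DL m (1 - w) = 0" using s by (simp add: w_def)
      have "w = of_real x" by (rule uniq[OF N(1,2,3) _ _ z x(3)]) (use x in auto)
      then have "s = of_real (1 - x)" by (simp add: w_def algebra_simps)
      then show "s \<in> \<real>" by (metis Reals_of_real)
    next
      fix n :: int assume "real_of_int n \<le> 1 - real_of_int N0"
      then have N: "1 - n \<ge> N0" by linarith
      obtain x :: real where x: "of_int (1 - n) < x" "x < of_int (1 - n) + 1" "DL m (1 - of_real x) = 0"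
        using ex[OF N] by blast
      show "\<exists>!x::real. of_int n - 1 < x \<and> x < of_int n \<and> DL m (of_real x) = 0"
      proof (rule ex1I[of _ "1 - x"])
        show "of_int n - 1 < 1 - x \<and> 1 - x < of_int n \<and> DL m (of_real (1 - x)) = 0"
          using x by simp
        fix y :: real assume y: "of_int n - 1 < y \<and> y < of_int n \<and> DL m (of_real y) = 0"
        have "complex_of_real (1 - y) = of_real x"
          by (rule uniq[OF N _ _ _ _ _ x(3)]) (use x y in auto)
        then have "1 - y = x" by (simp only: of_real_eq_iff)
        then show "y = 1 - x" by simp
      qed
    qed
  qed
qed

section \<open>Zero-free right half plane\<close>

text \<open>For n >= N and Re s >= 2 one has n^(- Re s) <= n^(-2) N^(2 - Re s), and the series
  converges absolutely at exponent 2.\<close>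

lemma Ldir_tail_bound:
  assumes N: "N \<ge> 1"
  obtains C where "C > 0"
    "\<And>s. Re s \<ge> 2 \<Longrightarrow> norm (Ldir s - (\<Sum>n<N. lam n * of_nat n powr (- s))) \<le> C * real N powr (- Re s)"
proof -
  let ?t = "\<lambda>n. norm (lam (n + N)) * real (n + N) powr (- 2)"
  have sm: "summable (\<lambda>n. norm (lam n) * real n powr (- 2))" by (rule lam_summable) simp
  define T where "T = (\<Sum>n. (?t n))"
  have T: "T \<ge> 0" unfolding T_def by (rule suminf_nonneg[OF summable_ignore_initial_segment[OF sm]]) simp
  show ?thesis
  proof (rule that[of "(T + 1) * real N powr 2"])
    show "(T + 1) * real N powr 2 > 0" using T N by simp
    fix s assume s: "Re s \<ge> 2"
    have "(\<Sum>n. lam (n + N) * of_nat (n + N) powr (- s)) = Ldir s - (\<Sum>n<N. lam n * of_nat n powr (- s))"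
      using suminf_split_initial_segment[of "\<lambda>n. lam n * of_nat n powr (- s)" N] Ldir_sums[of s] s
      unfolding Ldir_def by (simp add: sums_iff)
    moreover have "norm (\<Sum>n. lam (n + N) * of_nat (n + N) powr (- s)) \<le>
        (\<Sum>n. (?t n) * real N powr (2 - Re s))"
    proof (rule norm_suminf_le)
      show "summable (\<lambda>n. (?t n) * real N powr (2 - Re s))"
        by (rule summable_mult2[OF summable_ignore_initial_segment[OF sm]])
      fix n
      have "real (n + N) powr (- Re s) = real (n + N) powr (- 2) * real (n + N) powr (2 - Re s)"
        by (simp flip: powr_add)
      also have "\<dots> \<le> real (n + N) powr (- 2) * real N powr (2 - Re s)"
        using N s by (intro mult_left_mono powr_mono2') auto
      finally have "norm (lam (n + N)) * real (n + N) powr (- Re s) \<le>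
          norm (lam (n + N)) * (real (n + N) powr (- 2) * real N powr (2 - Re s))"
        by (intro mult_left_mono) auto
      then show "norm (lam (n + N) * of_nat (n + N) powr (- s)) \<le>
          (?t n) * real N powr (2 - Re s)"
        unfolding norm_Ldir_term by (simp add: mult.assoc)
    qed
    moreover have "(\<Sum>n. (?t n) * real N powr (2 - Re s)) = T * real N powr (2 - Re s)"
      unfolding T_def by (rule suminf_mult2[OF summable_ignore_initial_segment[OF sm], symmetric])
    moreover have "T * real N powr (2 - Re s) \<le> (T + 1) * real N powr (2 - Re s)" by (intro mult_right_mono) auto
    moreover have "real N powr (2 - Re s) = real N powr 2 * real N powr (- Re s)"
      unfolding powr_add[symmetric] by simp
    ultimately show "norm (Ldir s - (\<Sum>n<N. lam n * of_nat n powr (- s))) \<le> (T + 1) * real N powr 2 * real N powr (- Re s)"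
      by (simp add: mult.assoc)
  qed
qed

text \<open>The head h ends at index p, and its m-th derivative has size \<kappa> p^(- Re s).
  Cauchy's estimate on unit discs bounds the m-th derivative of the rest by a constant times (p +
  1)^(- Re s), which is eventually smaller.\<close>

lemma zero_free_right_aux:
  fixes p :: nat
  assumes head: "h holomorphic_on UNIV" "\<And>s. Re s > 1 \<Longrightarrow> h s = (\<Sum>n<Suc p. lam n * of_nat n powr (- s))"
    and p: "p \<ge> 1" and lead: "\<kappa> \<noteq> 0" "\<And>s. norm ((deriv ^^ m) h s) = \<kappa> * real p powr (- Re s)" and "\<kappa> > 0"
  shows "\<exists>\<sigma>>1. \<forall>s. Re s \<ge> \<sigma> \<longrightarrow> DL m s \<noteq> 0"
proof -
  define N where "N = real (Suc p)"
  obtain C where C: "C > 0"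
    "\<And>s. Re s \<ge> 2 \<Longrightarrow> norm (Ldir s - (\<Sum>n<Suc p. lam n * of_nat n powr (- s))) \<le> C * N powr (- Re s)"
    using Ldir_tail_bound[of "Suc p"] unfolding N_def by auto
  define E where "E s = Lfun s - h s" for s
  have E_hol: "E holomorphic_on UNIV" unfolding E_def[abs_def] by (intro holomorphic_intros Lfun_entire head)
  have E_bound: "norm (E s) \<le> C * N powr (- Re s)" if "Re s \<ge> 2" for s
    using C(2)[OF that] Lfun_Dirichlet[of s] head(2)[of s] that by (simp add: E_def)
  define K where "K = fact m * C * N / \<kappa>"
  \<comment> \<open>The power (N / p)^x exceeds x ln (N / p), which passes K once x > K / ln (N /
    p). The value 3 keeps unit discs inside Re s >= 2.\<close>
  define \<sigma> where "\<sigma> = max 3 (K / ln (N / real p) + 1)"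
  have Np: "N / real p > 1" using p by (simp add: N_def)
  have "DL m s \<noteq> 0" if s: "Re s \<ge> \<sigma>" for s
  proof
    assume zero: "DL m s = 0"
    have s3: "Re s \<ge> 3" using s by (simp add: \<sigma>_def)
    have "(deriv ^^ m) (\<lambda>s. Lfun s - h s) s = DL m s - (deriv ^^ m) h s"
      by (rule higher_deriv_diff[OF Lfun_entire head(1)]) auto
    then have "norm ((deriv ^^ m) E s) = \<kappa> * real p powr (- Re s)"
      using zero lead(2)[of s] unfolding E_def[abs_def] by simp
    moreover have "norm ((deriv ^^ m) E s) \<le> fact m * (C * N powr (1 - Re s)) / 1 ^ m"
    proof (rule Cauchy_inequality)
      show "E holomorphic_on ball s 1" "continuous_on (cball s 1) E"
        using E_hol holomorphic_on_subset holomorphic_on_imp_continuous_on by blast+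
      fix x assume x: "norm (s - x) = 1"
      then have xs: "Re x \<ge> Re s - 1" using complex_Re_le_cmod[of "s - x"] by simp
      have "norm (E x) \<le> C * N powr (- Re x)" using xs s3 by (intro E_bound) auto
      also have "\<dots> \<le> C * N powr (1 - Re s)" using xs C(1) by (intro mult_left_mono powr_mono) (auto simp: N_def)
      finally show "norm (E x) \<le> C * N powr (1 - Re s)" .
    qed simp
    ultimately have "\<kappa> * real p powr (- Re s) \<le> fact m * C * N * N powr (- Re s)"
      by (simp add: N_def powr_diff powr_minus divide_inverse mult.assoc)
    then have "(N / real p) powr Re s \<le> K"
      using \<open>\<kappa> > 0\<close> p by (simp add: K_def N_def powr_divide powr_minus field_simps)
    moreover have "(N / real p) powr Re s > Re s * ln (N / real p)"
    proof -
      have "exp (Re s * ln (N / real p)) > Re s * ln (N / real p)"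
        using exp_ge_add_one_self[of "Re s * ln (N / real p)"] by linarith
      moreover have "N / real p \<noteq> 0" using Np by linarith
      ultimately show ?thesis unfolding powr_def by (simp only: if_False)
    qed
    moreover have "Re s * ln (N / real p) > K"
    proof -
      have "Re s > K / ln (N / real p)" using s by (simp add: \<sigma>_def)
      then show ?thesis using Np by (simp add: pos_divide_less_eq)
    qed
    ultimately show False by linarith
  qed
  moreover have "\<sigma> > 1" by (simp add: \<sigma>_def)
  ultimately show ?thesis by blast
qed

text \<open>For m = 0 the leading term is the constant 1. For m > 0 it differentiates to 0, and the
  first nonzero coefficient at an index p >= 2 takes over, with factor ln p nonzero.\<close>

lemma zero_free_right: "\<exists>\<sigma>>1. \<forall>s. Re s \<ge> \<sigma> \<longrightarrow> DL m s \<noteq> 0"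
proof (cases "m = 0")
  case True
  show ?thesis
    by (rule zero_free_right_aux[of "\<lambda>_. 1" 1 1]) (auto simp: True)
next
  case False
  define p where "p = (LEAST n. n \<ge> 2 \<and> lam n \<noteq> 0)"
  have "\<exists>n. n \<ge> 2 \<and> lam n \<noteq> 0" using exists_coeff by (auto simp: lam_def)
  then have p: "p \<ge> 2" "lam p \<noteq> 0" unfolding p_def by (metis (mono_tags, lifting) LeastI_ex)+
  have small: "lam n = 0" if "n \<ge> 2" "n < p" for n
    using that not_less_Least[of n "\<lambda>n. n \<ge> 2 \<and> lam n \<noteq> 0"] by (auto simp: p_def)
  define l where "l = - complex_of_real (ln (real p))"
  define h where "h s = 1 + lam p * exp (l * s)" for s
  have pw: "of_nat p powr (- s) = exp (l * s)" for s
    using p Ln_of_real[of "real p"] by (simp add: powr_def l_def mult.commute)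
  show ?thesis
  proof (rule zero_free_right_aux[of h p "norm (lam p) * ln (real p) ^ m"])
    show "h holomorphic_on UNIV" unfolding h_def[abs_def] by (intro holomorphic_intros)
    fix s :: complex
    have "(\<Sum>n<Suc p. lam n * of_nat n powr (- s)) = (\<Sum>n\<in>{1, p}. lam n * of_nat n powr (- s))"
    proof (rule sum.mono_neutral_right)
      show "\<forall>i\<in>{..<Suc p} - {1, p}. lam i * of_nat i powr (- s) = 0"
      proof
        fix i assume "i \<in> {..<Suc p} - {1, p}"
        then have "i = 0 \<or> i \<ge> 2 \<and> i < p" by auto
        then show "lam i * of_nat i powr (- s) = 0" using small by auto
      qed
    qed (use p in auto)
    then show "h s = (\<Sum>n<Suc p. lam n * of_nat n powr (- s))"
      using p by (simp add: h_def pw)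
    have d: "(deriv ^^ j) h = (\<lambda>s. lam p * l ^ j * exp (l * s))" if "j > 0" for j
      using that
    proof (induction j)
      case (Suc j)
      have "((deriv ^^ j) h has_field_derivative lam p * l ^ Suc j * exp (l * s)) (at s)" for s
      proof (cases "j = 0")
        case True
        then show ?thesis unfolding h_def[abs_def] by (auto intro!: derivative_eq_intros)
      next
        case False
        then have "(deriv ^^ j) h = (\<lambda>s. lam p * l ^ j * exp (l * s))" using Suc.IH by simp
        then show ?thesis by (auto intro!: derivative_eq_intros simp: mult_ac)
      qed
      then show ?case by (auto simp: DERIV_imp_deriv)
    qed simp
    have "norm (exp (l * s)) = real p powr (- Re s)"
      using p unfolding pw[symmetric] by (simp add: norm_nat_powr)
    moreover have "norm l = ln (real p)" using p by (simp add: l_def)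
    ultimately show "norm ((deriv ^^ m) h s) = norm (lam p) * ln (real p) ^ m * real p powr (- Re s)"
      using d[of m] False by (simp add: norm_mult norm_power)
  qed (use p in auto)
qed

section \<open>Identification with the L-function of the statement\<close>

text \<open>The definite description is resolved by the identity theorem. The shift to
  \<open>Suc n\<close> is harmless because the term at index 0 is 0.\<close>

lemma cusp_L_eq:
  assumes "fourier_coeff f = a"
  shows "cusp_L k f = Lfun"
proof -
  have sums_iff: "(\<lambda>n. hecke_lambda k f (Suc n) * of_nat (Suc n) powr (- s)) sums L \<longleftrightarrow> L = Ldir s"
    if "Re s > 1" for s L
  proof -
    have "hecke_lambda k f n = lam n" for n by (simp add: hecke_lambda_def lam_def assms)
    moreover have "(\<lambda>n. lam (Suc n) * of_nat (Suc n) powr (- s)) sums Ldir s"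
      using Ldir_sums[OF that] sums_Suc_iff[of "\<lambda>n. lam n * of_nat n powr (- s)"] by simp
    ultimately show ?thesis using sums_unique2 by auto
  qed
  show ?thesis unfolding cusp_L_def
  proof (rule the_equality)
    show "Lfun holomorphic_on UNIV \<and> (\<forall>s. Re s > 1 \<longrightarrow>
        (\<lambda>n. hecke_lambda k f (Suc n) * of_nat (Suc n) powr (- s)) sums Lfun s)"
      using Lfun_entire Lfun_Dirichlet sums_iff by auto
    fix L assume "L holomorphic_on UNIV \<and> (\<forall>s. Re s > 1 \<longrightarrow>
        (\<lambda>n. hecke_lambda k f (Suc n) * of_nat (Suc n) powr (- s)) sums L s)"
    then show "L = Lfun" using sums_iff by (intro Lfun_unique) auto
  qed
qed

end

lemma normalized_eigenformI:
  assumes "normalized_hecke_eigenform k f"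
  shows "normalized_eigenform k f (fourier_coeff f)"
proof -
  have cf: "cusp_form k f" and a1: "fourier_coeff f 1 = 1"
    and eig: "\<forall>n\<ge>1. \<exists>c. \<forall>z\<in>upper_half_plane. hecke_operator k n f z = c * f z"
    using assms by (auto simp: normalized_hecke_eigenform_def)
  obtain a where a: "has_q_expansion f a" "a 0 = 0" using cf by (auto simp: cusp_form_def)
  have eq: "fourier_coeff f = a" by (rule fourier_coeff_eqI[OF a(1)])
  show ?thesis
  proof
    fix g z assume g: "g \<in> imats 1" and z: "Im z > 0"
    obtain p q r s where "g = (p, q, r, s)" by (metis prod.exhaust)
    then show "f (mob g z) = autfac g z ^ k * f z"
      using cf g z by (auto simp: cusp_form_def imats_def upper_half_plane_def)
  qed (use cf a a1 eig eq in \<open>auto simp: cusp_form_def\<close>)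
qed

theorem theorem1:
  fixes k m :: nat and f :: "complex \<Rightarrow> complex"
  assumes "normalized_hecke_eigenform k f"
  shows "(\<exists>\<sigma>::real. \<sigma> > 1 \<and>
            (\<forall>s. Re s \<ge> \<sigma> \<longrightarrow> (deriv ^^ m) (cusp_L k f) s \<noteq> 0)) \<and>
         (\<forall>\<epsilon>::real. \<epsilon> > 0 \<longrightarrow>
            (\<exists>\<delta>::real. \<delta> > (real k - 1) / 2 + 1 \<and>
              (\<forall>s. norm s \<ge> \<delta> \<and> Re s \<le> - \<epsilon> \<and> \<bar>Im s\<bar> \<ge> \<epsilon> \<longrightarrow>
                 (deriv ^^ m) (cusp_L k f) s \<noteq> 0))) \<and>
         (\<exists>\<alpha>::real. \<alpha> < - ((real k - 1) / 2) - 1 \<and>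
            (\<forall>s. Re s \<le> \<alpha> \<and> (deriv ^^ m) (cusp_L k f) s = 0 \<longrightarrow> s \<in> \<real>) \<and>
            (\<forall>n::int. real_of_int n \<le> \<alpha> \<longrightarrow>
               (\<exists>!x::real. real_of_int n - 1 < x \<and> x < real_of_int n \<and>
                  (deriv ^^ m) (cusp_L k f) (complex_of_real x) = 0)))"
proof -
  interpret normalized_eigenform k f "fourier_coeff f"
    by (rule normalized_eigenformI[OF assms])
  show ?thesis
    unfolding cusp_L_eq[OF refl]
    by (intro conjI allI impI zero_free_right no_zeros_left real_zeros_left)
qed

end
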